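(* For every $p\in(p_c(2),1)$, $$\mu_2(p)<p\,\mu_2(1),$$ meaning that $Z_N/\mathbb{E}_p[Z_N]$ tends to zero exponentially fast, i.e. $\mathbb{P}_p$-almost surely $\limsup_{N\to\infty}\big(Z_N/\mathbb{E}_p[Z_N]\big)^{1/N}<1$. Moreover, the function $$p\mapsto \frac{\mu_2(p)}{p\,\mu_2(1)}$$ is strictly increasing on $(p_c(2),1]$.
   Context: $\mathbb{Z}^2$ carries its usual nearest-neighbor lattice structure, with edge set $E_2$. Under $\mathbb{P}_p$ (expectation $\mathbb{E}_p$), $(\omega(e))_{e\in E_2}$ is an IID family of $\{0,1\}$-valued Bernoulli variables with $\mathbb{P}_p(\omega(e)=1)=p$; an edge $e$ is open if $\omega(e)=1$ and closed otherwise. $p_c(2)=1/2$ is the percolation threshold; for $p\in(p_c(2),1]$ there is $\mathbb{P}_p$-a.s. a unique infinite open cluster $\mathcal C$. A self-avoiding path of length $N$ starting at $x$ is a nearest-neighbor path $(S_n)_{0\le n\le N}$ with $S_0=x$ visiting no vertex twice; it is open if all its edges are open. $Z_N(x)$ is the number of open self-avoiding paths of length $N$ starting at $x$, and $Z_N=Z_N(0)$. The quenched connective constant $\mu_2(p)$, $p\in(p_c(2),1]$, is the non-random constant such that $\mathbb{P}_p$-a.s., for every $x\in\mathcal C$, $\limsup_{N\to\infty}(Z_N(x))^{1/N}=\mu_2(p)$ (this limsup is known to be a.s. the same for all $x\in\mathcal C$ and non-random). In particular $\mu_2(1)=\lim_{N\to\infty}s_N^{1/N}$ where $s_N$ is the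 number of self-avoiding paths of length $N$ on $\mathbb{Z}^2$ starting at $0$, and $\mathbb{E}_p[Z_N]=p^Ns_N$. *)

theory Defs
  imports "HOL-Probability.Probability"
begin

type_synonym vertex = "int \<times> int"
type_synonym edge = "vertex set"

definition E2 :: "edge set" where
  "E2 = {{x, y} | x y. \<bar>fst x - fst y\<bar> + \<bar>snd x - snd y\<bar> = 1}"

text \<open>The value \<open>True\<close> plays the role of 1 (open), \<open>False\<close> that of 0 (closed).\<close>

definition perc :: "real \<Rightarrow> (edge \<Rightarrow> bool) measure" where
  "perc p = (\<Pi>\<^sub>M e\<in>E2. measure_pmf (bernoulli_pmf p))"

definition open_adj :: "(edge \<Rightarrow> bool) \<Rightarrow> vertex \<Rightarrow> vertex \<Rightarrow> bool" where
  "open_adj \<omega> x y \<longleftrightarrow> {x, y} \<in> E2 \<and> \<omega> {x, y}"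

definition cluster :: "(edge \<Rightarrow> bool) \<Rightarrow> vertex \<Rightarrow> vertex set" where
  "cluster \<omega> x = {y. (open_adj \<omega>)\<^sup>*\<^sup>* x y}"

text \<open>On the event that the infinite open cluster exists and is unique, the following set is
  exactly that cluster.\<close>

definition infinite_cluster :: "(edge \<Rightarrow> bool) \<Rightarrow> vertex set" where
  "infinite_cluster \<omega> = {x. infinite (cluster \<omega> x)}"

definition percolation_prob :: "real \<Rightarrow> real" where
  "percolation_prob p = \<P>(\<omega> in perc p. (0, 0) \<in> infinite_cluster \<omega>)"

definition p_c :: real where
  "p_c = Sup {p \<in> {0..1}. percolation_prob p = 0}"

text \<open>A path \<open>(S\<^sub>0, \<dots>, S\<^sub>N)\<close> is the list of its \<open>N + 1\<close> vertices.\<close>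

definition open_saws :: "(edge \<Rightarrow> bool) \<Rightarrow> nat \<Rightarrow> vertex \<Rightarrow> vertex list set" where
  "open_saws \<omega> N x =
     {S. length S = Suc N \<and> S ! 0 = x \<and> distinct S \<and> (\<forall>n<N. open_adj \<omega> (S ! n) (S ! Suc n))}"

definition Z :: "(edge \<Rightarrow> bool) \<Rightarrow> nat \<Rightarrow> vertex \<Rightarrow> real" where
  "Z \<omega> N x = real (card (open_saws \<omega> N x))"

text \<open>The upper limit is formed in the extended reals, where it always exists; it is finite
  because \<open>Z \<omega> N x \<le> 4 ^ N\<close>.\<close>

definition is_quenched_connective_constant :: "real \<Rightarrow> real \<Rightarrow> bool" where
  "is_quenched_connective_constant p m \<longleftrightarrow>
     (AE \<omega> in perc p. \<forall>x\<in>infinite_cluster \<omega>.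
        limsup (\<lambda>N. ereal (root N (Z \<omega> N x))) = ereal m)"

definition mu2 :: "real \<Rightarrow> real" where
  "mu2 p = (THE m. is_quenched_connective_constant p m)"

end

theory Submission
  imports Defs
begin

text \<open>
  For \<open>p < q\<close> realise the percolation of density \<open>p\<close> as the intersection of one of density
  \<open>q\<close> with an independent one \<open>\<eta>\<close> of density \<open>r = p / q\<close>; given the former, a self-avoiding path of
  length \<open>N\<close> survives with probability \<open>r ^ N\<close>. A path that is open in \<open>\<eta>\<close> can be detected: it runs
  through at least \<open>N / L\<^sup>2\<close> boxes of side \<open>L\<close>, and in each of them stays inside the surrounding block
  for \<open>L\<close> steps. The quadratic statistic \<open>\<Sum> V(e, e') (\<eta> e - r) (\<eta> e' - r)\<close> of the block with
  \<open>V(e, e')\<close> about \<open>1 / |e - e'|\<close> has standard deviation of order \<open>L sqrt (ln L)\<close>, whereas a path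
  with \<open>L\<close> edges shifts its mean by order \<open>L ln L\<close>: two dimensions are critical, and the
  logarithm makes the test reliable for large \<open>L\<close>. As there are only exponentially many coarse-grained
  paths, typically none of them sees a large statistic in most of its boxes, while all paths that
  are compatible with this contribute an exponentially small fraction of the mean. Markov's
  inequality and Borel-Cantelli then give \<open>mu2 p / p \<le> \<rho> * mu2 q / q\<close> with \<open>\<rho> < 1\<close>.

  That \<open>mu2\<close> is well defined follows from three facts: the growth rate is constant along clusters, since
  a path that misses or meets a given neighbour of its starting point is a tail or is composed of
  two paths from that neighbour; the largest growth rate is not changed by closing an edge, hence
  constant by the zero-one law; and the infinite cluster is unique, by the argument of Aizenman,
  Kesten and Newman.
\<close>

text \<open>The path hidden in a block is unknown, so the test must work for every self-avoiding run
  at once. Weights decaying like the inverse distance achieve this: edges at time lag d along a run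
  have midpoints at l1 distance at most d, so a run of length L collects order L ln L however it
  winds. The obstacle is the variance under the planted law, whose linear part depends on the run.
  The inequality \<open>V k e * V k e' \<le> V e e' * (V k e + V k e')\<close> bounds it by the mean
  shift itself times a row sum of order L. The other obstacle is entropy. The union bound runs over
  sets of visited boxes, at most \<open>81 ^ K\<close> for \<open>K\<close> boxes, not over paths,
  and blocks must be disjoint for expectations to factorise. Both cost constants that are fixed
  before \<open>L\<close> is chosen. Estimates are made with finite sums \<open>bexp\<close>, so
  that edge-dependent weights, conditioning and changes of parameter are plain algebra. In the
  uniqueness argument, a box of side k^2 and a perturbation 1 / k are balanced: about k^3 closed
  edges are expected to separate two boundary clusters, against order k^4 edges in the box.\<close>

section \<open>Finite Bernoulli expectations\<close>

text \<open>The expectation of \<open>f\<close> at a random subset of \<open>J\<close> that contains each \<open>e\<close> independently with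
  probability \<open>w e\<close>.\<close>

definition bexp :: "'a set \<Rightarrow> ('a \<Rightarrow> real) \<Rightarrow> ('a set \<Rightarrow> real) \<Rightarrow> real" where
  "bexp J w f = (\<Sum>A\<in>Pow J. (\<Prod>e\<in>A. w e) * (\<Prod>e\<in>J - A. 1 - w e) * f A)"

lemma bexp_empty [simp]: "bexp {} w f = f {}"
  by (simp add: bexp_def)

text \<open>Reveals one element. The identities below for constants, independence, intersections and
  second moments are inductions over \<open>J\<close> by this recursion.\<close>

lemma bexp_insert:
  assumes "finite J" "k \<notin> J"
  shows "bexp (insert k J) w f =
    w k * bexp J w (\<lambda>A. f (insert k A)) + (1 - w k) * bexp J w f"
proof -
  have inj: "inj_on (insert k) (Pow J)"
    using assms(2) by (auto simp: inj_on_def)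
  have disj: "Pow J \<inter> insert k ` Pow J = {}"
    using assms(2) by auto
  let ?t = "\<lambda>A. (\<Prod>e\<in>A. w e) * (\<Prod>e\<in>insert k J - A. 1 - w e) * f A"
  have "bexp (insert k J) w f = sum ?t (Pow J) + sum ?t (insert k ` Pow J)"
    unfolding bexp_def Pow_insert using assms(1) disj by (intro sum.union_disjoint) auto
  also have "sum ?t (Pow J) = (1 - w k) * bexp J w f"
    unfolding bexp_def sum_distrib_left
  proof (rule sum.cong[OF refl])
    fix A assume A: "A \<in> Pow J"
    have "insert k J - A = insert k (J - A)" using A assms(2) by auto
    then show "?t A = (1 - w k) * ((\<Prod>e\<in>A. w e) * (\<Prod>e\<in>J - A. 1 - w e) * f A)"
      using assms by simp
  qed
  also have "sum ?t (insert k ` Pow J) = w k * bexp J w (\<lambda>A. f (insert k A))"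
    unfolding bexp_def sum_distrib_left sum.reindex[OF inj] o_def
  proof (rule sum.cong[OF refl])
    fix A assume A: "A \<in> Pow J"
    have "insert k J - insert k A = J - A" using assms(2) A by auto
    moreover have "finite A" "k \<notin> A" using A assms finite_subset by auto
    ultimately show "?t (insert k A) =
        w k * ((\<Prod>e\<in>A. w e) * (\<Prod>e\<in>J - A. 1 - w e) * f (insert k A))"
      by simp
  qed
  finally show ?thesis by simp
qed

lemma bexp_cong:
  assumes "\<And>A. A \<subseteq> J \<Longrightarrow> f A = g A" "\<And>e. e \<in> J \<Longrightarrow> w e = v e"
  shows "bexp J w f = bexp J v g"
proof -
  have "(\<Prod>e\<in>A. w e) = (\<Prod>e\<in>A. v e)" "(\<Prod>e\<in>J - A. 1 - w e) = (\<Prod>e\<in>J - A. 1 - v e)"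
    if "A \<subseteq> J" for A
    using assms(2) that by (auto intro!: prod.cong)
  then show ?thesis unfolding bexp_def using assms(1) by (auto intro!: sum.cong)
qed

lemma bexp_add: "bexp J w (\<lambda>A. f A + g A) = bexp J w f + bexp J w g"
  by (simp add: bexp_def algebra_simps sum.distrib)

lemma bexp_diff: "bexp J w (\<lambda>A. f A - g A) = bexp J w f - bexp J w g"
  by (simp add: bexp_def algebra_simps sum_subtractf)

lemma bexp_cmult: "bexp J w (\<lambda>A. c * f A) = c * bexp J w f"
  by (simp add: bexp_def sum_distrib_left mult_ac)

lemma bexp_divide: "bexp J w (\<lambda>A. f A / c) = bexp J w f / c"
  using bexp_cmult[of J w "1 / c" f] by simp

lemma bexp_sum: "bexp J w (\<lambda>A. \<Sum>i\<in>I. f i A) = (\<Sum>i\<in>I. bexp J w (f i))"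
  unfolding bexp_def sum_distrib_left by (rule sum.swap)

lemma bexp_const: "finite J \<Longrightarrow> bexp J w (\<lambda>_. c) = c"
  by (induction J rule: finite_induct) (auto simp: bexp_insert algebra_simps)

lemma bexp_mono:
  assumes "\<And>A. A \<subseteq> J \<Longrightarrow> f A \<le> g A" "\<And>e. e \<in> J \<Longrightarrow> 0 \<le> w e \<and> w e \<le> 1"
  shows "bexp J w f \<le> bexp J w g"
proof -
  have "0 \<le> (\<Prod>e\<in>A. w e) * (\<Prod>e\<in>J - A. 1 - w e)" if "A \<subseteq> J" for A
    using assms(2) that by (intro mult_nonneg_nonneg prod_nonneg) auto
  then show ?thesis
    unfolding bexp_def using assms(1) by (intro sum_mono mult_left_mono) auto
qed

lemma bexp_nonneg:
  assumes "\<And>A. A \<subseteq> J \<Longrightarrow> 0 \<le> f A" "\<And>e. e \<in> J \<Longrightarrow> 0 \<le> w e \<and> w e \<le> 1"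
  shows "0 \<le> bexp J w f"
  using bexp_mono[of J "\<lambda>_. 0" f w] assms by (simp add: bexp_def)

lemma bexp_indep:
  assumes "finite I" "finite J" "I \<inter> J = {}"
  shows "bexp (I \<union> J) w (\<lambda>A. f (A \<inter> I) * g (A \<inter> J)) = bexp I w f * bexp J w g"
  using assms
proof (induction I arbitrary: f rule: finite_induct)
  case empty
  have "bexp J w (\<lambda>A. f {} * g (A \<inter> J)) = bexp J w (\<lambda>A. f {} * g A)"
    by (intro bexp_cong) (auto simp: Int_absorb2)
  then show ?case by (simp add: bexp_cmult)
next
  case (insert k I)
  have kJ: "k \<notin> J" and IJ: "I \<inter> J = {}" using insert.prems by auto
  have 1: "bexp (I \<union> J) w (\<lambda>A. f (insert k A \<inter> insert k I) * g (insert k A \<inter> J)) =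
      bexp (I \<union> J) w (\<lambda>A. f (insert k (A \<inter> I)) * g (A \<inter> J))"
    using kJ insert.hyps by (intro bexp_cong) (auto intro!: arg_cong[of _ _ f] arg_cong[of _ _ g])
  have 2: "bexp (I \<union> J) w (\<lambda>A. f (A \<inter> insert k I) * g (A \<inter> J)) =
      bexp (I \<union> J) w (\<lambda>A. f (A \<inter> I) * g (A \<inter> J))"
    using kJ insert.hyps by (intro bexp_cong) (auto intro!: arg_cong[of _ _ f])
  have "bexp (insert k I \<union> J) w (\<lambda>A. f (A \<inter> insert k I) * g (A \<inter> J)) =
     w k * bexp (I \<union> J) w (\<lambda>A. f (insert k A \<inter> insert k I) * g (insert k A \<inter> J)) +
     (1 - w k) * bexp (I \<union> J) w (\<lambda>A. f (A \<inter> insert k I) * g (A \<inter> J))"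
    using insert.hyps insert.prems kJ by (simp add: bexp_insert)
  also have "\<dots> = w k * (bexp I w (\<lambda>A. f (insert k A)) * bexp J w g) +
      (1 - w k) * (bexp I w f * bexp J w g)"
    unfolding 1 2 using insert.IH[OF insert.prems(1) IJ, of "\<lambda>A. f (insert k A)"]
      insert.IH[OF insert.prems(1) IJ, of f] by simp
  also have "\<dots> = bexp (insert k I) w f * bexp J w g"
    using insert.hyps by (simp add: bexp_insert algebra_simps)
  finally show ?case .
qed

lemma bexp_restrict:
  assumes "finite J" "I \<subseteq> J"
  shows "bexp J w (\<lambda>A. f (A \<inter> I)) = bexp I w f"
proof -
  have fin: "finite I" "finite (J - I)" using assms finite_subset by auto
  have "bexp (I \<union> (J - I)) w (\<lambda>A. f (A \<inter> I) * (\<lambda>_. 1) (A \<inter> (J - I))) =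
     bexp I w f * bexp (J - I) w (\<lambda>_. 1)"
    by (rule bexp_indep) (use fin in auto)
  moreover have "I \<union> (J - I) = J" using assms by auto
  ultimately show ?thesis using bexp_const[OF fin(2), of w 1] by simp
qed

lemma bexp_prod_indep:
  assumes "finite B" "\<And>b. b \<in> B \<Longrightarrow> finite (J b)" "disjoint_family_on J B"
  shows "bexp (\<Union>b\<in>B. J b) w (\<lambda>A. \<Prod>b\<in>B. f b (A \<inter> J b)) = (\<Prod>b\<in>B. bexp (J b) w (f b))"
  using assms
proof (induction B rule: finite_induct)
  case (insert b B)
  let ?U = "\<Union>b\<in>B. J b"
  have fin: "finite ?U" "finite (J b)" using insert by auto
  have "J b \<inter> J c = {}" if "c \<in> B" for c
    using insert.prems(2) insert.hyps that by (intro disjoint_family_onD[of J "insert b B"]) auto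
  then have dj: "J b \<inter> ?U = {}" by blast
  have dB: "disjoint_family_on J B" using insert.prems(2) by (auto simp: disjoint_family_on_def)
  have *: "(\<Prod>c\<in>B. f c (A \<inter> J c)) = (\<Prod>c\<in>B. f c (A \<inter> ?U \<inter> J c))" for A
    by (intro prod.cong refl arg_cong[of _ _ "f _"]) auto
  have "bexp (J b \<union> ?U) w (\<lambda>A. f b (A \<inter> J b) * (\<Prod>c\<in>B. f c (A \<inter> ?U \<inter> J c))) =
      bexp (J b) w (f b) * bexp ?U w (\<lambda>A. \<Prod>c\<in>B. f c (A \<inter> J c))"
    using bexp_indep[OF fin(2) fin(1) dj, of w "f b" "\<lambda>A. \<Prod>c\<in>B. f c (A \<inter> J c)"] by simp
  also have "(\<lambda>A. f b (A \<inter> J b) * (\<Prod>c\<in>B. f c (A \<inter> ?U \<inter> J c))) =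
      (\<lambda>A. \<Prod>c\<in>insert b B. f c (A \<inter> J c))"
    using insert.hyps *[symmetric] by simp
  finally show ?case using insert.IH insert.prems insert.hyps dB by simp
qed simp

text \<open>The form in which products of tests on disjoint blocks are evaluated inside one large
  region.\<close>

lemma bexp_prod_indep_superset:
  assumes "finite J'" "finite B" "\<And>b. b \<in> B \<Longrightarrow> J b \<subseteq> J'" "disjoint_family_on J B"
  shows "bexp J' w (\<lambda>A. \<Prod>b\<in>B. f b (A \<inter> J b)) = (\<Prod>b\<in>B. bexp (J b) w (f b))"
proof -
  let ?U = "\<Union>b\<in>B. J b"
  have *: "(\<Prod>c\<in>B. f c (A \<inter> J c)) = (\<Prod>c\<in>B. f c (A \<inter> ?U \<inter> J c))" for A
    by (intro prod.cong refl arg_cong[of _ _ "f _"]) auto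
  have "bexp J' w (\<lambda>A. \<Prod>b\<in>B. f b (A \<inter> J b)) = bexp ?U w (\<lambda>A. \<Prod>b\<in>B. f b (A \<inter> J b))"
    by (subst *, rule bexp_restrict) (use assms in auto)
  also have "\<dots> = (\<Prod>b\<in>B. bexp (J b) w (f b))"
    by (rule bexp_prod_indep) (use assms in \<open>auto intro: finite_subset[of _ J']\<close>)
  finally show ?thesis .
qed

text \<open>Conditioning a product law on containing \<open>G\<close> gives the product law with
  weight 1 on \<open>G\<close>. This is why \<open>bexp\<close> carries edge-dependent weights: the
  open path becomes a planted set, and disjoint blocks stay independent.\<close>

lemma bexp_condition:
  assumes "finite J" "G \<subseteq> J"
  shows "bexp J w (\<lambda>A. if G \<subseteq> A then f A else 0) =
    (\<Prod>e\<in>G. w e) * bexp J (\<lambda>e. if e \<in> G then 1 else w e) f"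
  unfolding bexp_def sum_distrib_left
proof (rule sum.cong[OF refl])
  fix A assume "A \<in> Pow J"
  then have A: "A \<subseteq> J" "finite A" using assms finite_subset by auto
  let ?v = "\<lambda>e. if e \<in> G then 1 else w e"
  show "(\<Prod>e\<in>A. w e) * (\<Prod>e\<in>J - A. 1 - w e) * (if G \<subseteq> A then f A else 0) =
    (\<Prod>e\<in>G. w e) * ((\<Prod>e\<in>A. ?v e) * (\<Prod>e\<in>J - A. 1 - ?v e) * f A)"
  proof (cases "G \<subseteq> A")
    case True
    have "(\<Prod>e\<in>A. w e) = (\<Prod>e\<in>G. w e) * (\<Prod>e\<in>A - G. w e)"
      using True A(2) by (metis prod.subset_diff mult.commute)
    moreover have "(\<Prod>e\<in>A. ?v e) = (\<Prod>e\<in>A - G. w e)"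
      using True A(2) prod.subset_diff[of G A ?v] by simp
    moreover have "(\<Prod>e\<in>J - A. 1 - ?v e) = (\<Prod>e\<in>J - A. 1 - w e)"
      using True by (intro prod.cong) auto
    ultimately show ?thesis using True by simp
  next
    case False
    then obtain e where "e \<in> G" "e \<notin> A" by auto
    then have "(\<Prod>e\<in>J - A. 1 - ?v e) = 0" using assms by (intro prod_zero) auto
    then show ?thesis using False by simp
  qed
qed

text \<open>The two products form the density of the law with weights \<open>v\<close> relative to
  the one with weights \<open>w\<close>.\<close>

lemma bexp_change_parameter:
  assumes "\<And>e. e \<in> J \<Longrightarrow> w e \<noteq> 0 \<and> w e \<noteq> 1"
  shows "bexp J w (\<lambda>A. (\<Prod>e\<in>A. v e / w e) * (\<Prod>e\<in>J - A. (1 - v e) / (1 - w e)) * f A) = bexp J v f"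
  unfolding bexp_def
proof (rule sum.cong[OF refl])
  fix A assume A: "A \<in> Pow J"
  have "(\<Prod>e\<in>A. w e) * (\<Prod>e\<in>A. v e / w e) = (\<Prod>e\<in>A. v e)"
    unfolding prod.distrib[symmetric] using A assms by (intro prod.cong) auto
  moreover have "(\<Prod>e\<in>J - A. 1 - w e) * (\<Prod>e\<in>J - A. (1 - v e) / (1 - w e)) = (\<Prod>e\<in>J - A. 1 - v e)"
    unfolding prod.distrib[symmetric] using A assms by (intro prod.cong) auto
  moreover have "a * b * (a' * b' * c) = (a * a') * (b * b') * c" for a b a' b' c :: real
    by simp
  ultimately show "(\<Prod>e\<in>A. w e) * (\<Prod>e\<in>J - A. 1 - w e) *
      ((\<Prod>e\<in>A. v e / w e) * (\<Prod>e\<in>J - A. (1 - v e) / (1 - w e)) * f A) =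
      (\<Prod>e\<in>A. v e) * (\<Prod>e\<in>J - A. 1 - v e) * f A"
    by metis
qed

lemma bexp_markov:
  assumes "finite J" "\<And>e. e \<in> J \<Longrightarrow> 0 \<le> w e \<and> w e \<le> 1" "0 < t"
    "\<And>A. A \<subseteq> J \<Longrightarrow> 0 \<le> f A"
  shows "bexp J w (\<lambda>A. of_bool (t \<le> f A)) \<le> bexp J w f / t"
proof -
  have "bexp J w (\<lambda>A. of_bool (t \<le> f A)) \<le> bexp J w (\<lambda>A. f A / t)"
    using assms by (intro bexp_mono) (auto simp: field_simps)
  then show ?thesis by (simp add: bexp_divide)
qed

section \<open>A quadratic statistic and its second moments\<close>

text \<open>A chaos of degree two. The centring stays at \<open>r\<close> even under a planted law,
  so that planting \<open>G\<close> raises the mean by \<open>(1 - r)\<^sup>2\<close> times the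
  total weight of pairs in \<open>G\<close>, for \<open>V\<close> vanishing on the diagonal.\<close>

definition quad_form :: "'a set \<Rightarrow> ('a \<Rightarrow> 'a \<Rightarrow> real) \<Rightarrow> real \<Rightarrow> 'a set \<Rightarrow> real" where
  "quad_form J V r A =
     (\<Sum>e\<in>J. \<Sum>e'\<in>J. V e e' * ((of_bool (e \<in> A) - r) * (of_bool (e' \<in> A) - r)))"

text \<open>The offset \<open>b\<close> carries the induction: revealing \<open>k\<close> moves it
  by \<open>c k * (1 - w k)\<close> or by \<open>- c k * w k\<close>, a centred change, so the cross
  terms cancel.\<close>

lemma bexp_linear_second_moment:
  assumes "finite J"
  shows "bexp J w (\<lambda>A. (b + (\<Sum>e\<in>J. c e * (of_bool (e \<in> A) - w e)))\<^sup>2) =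
    b\<^sup>2 + (\<Sum>e\<in>J. (c e)\<^sup>2 * (w e * (1 - w e)))"
  using assms
proof (induction J arbitrary: b rule: finite_induct)
  case (insert k J)
  have 1: "bexp J w (\<lambda>A. (b + (\<Sum>e\<in>insert k J. c e * (of_bool (e \<in> insert k A) - w e)))\<^sup>2) =
      bexp J w (\<lambda>A. ((b + c k * (1 - w k)) + (\<Sum>e\<in>J. c e * (of_bool (e \<in> A) - w e)))\<^sup>2)"
  proof (rule bexp_cong)
    fix A assume "A \<subseteq> J"
    have "(\<Sum>e\<in>J. c e * (of_bool (e \<in> insert k A) - w e)) = (\<Sum>e\<in>J. c e * (of_bool (e \<in> A) - w e))"
      using insert.hyps by (intro sum.cong) auto
    then show "(b + (\<Sum>e\<in>insert k J. c e * (of_bool (e \<in> insert k A) - w e)))\<^sup>2 =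
       ((b + c k * (1 - w k)) + (\<Sum>e\<in>J. c e * (of_bool (e \<in> A) - w e)))\<^sup>2"
      using insert.hyps by (simp add: add.assoc)
  qed simp
  have 2: "bexp J w (\<lambda>A. (b + (\<Sum>e\<in>insert k J. c e * (of_bool (e \<in> A) - w e)))\<^sup>2) =
      bexp J w (\<lambda>A. ((b - c k * w k) + (\<Sum>e\<in>J. c e * (of_bool (e \<in> A) - w e)))\<^sup>2)"
    using insert.hyps by (intro bexp_cong) (auto simp: algebra_simps)
  have "w k * ((b + c k * (1 - w k))\<^sup>2 + s) + (1 - w k) * ((b - c k * w k)\<^sup>2 + s) =
      b\<^sup>2 + ((c k)\<^sup>2 * (w k * (1 - w k)) + s)" for s
    by (simp add: algebra_simps power2_eq_square)
  then show ?case
    unfolding bexp_insert[OF insert.hyps] 1 2 insert.IH unfolding sum.insert[OF insert.hyps] .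
qed simp

lemma mult_one_minus_le_one: "0 \<le> w \<Longrightarrow> w \<le> 1 \<Longrightarrow> w * (1 - w) \<le> (1::real)"
  using mult_mono[of w 1 "1 - w" 1] by simp

text \<open>Revealing \<open>k\<close> adds \<open>2 * z A k * T A\<close>, where \<open>T\<close>
  is affine in the other variables. As \<open>z A k\<close> is centred and independent of them, the
  cross term with \<open>Y\<close> vanishes, and the second moment of \<open>T\<close> is the linear
  case above.\<close>

lemma bexp_quadratic_second_moment:
  assumes "finite J" and sym: "\<And>e e'. V e e' = V e' e" and diag: "\<And>e. V e e = 0"
    and w: "\<And>e. e \<in> J \<Longrightarrow> 0 \<le> w e \<and> w e \<le> 1"
  shows "bexp J w (\<lambda>A. ((\<Sum>e\<in>J. 2 * b e * (of_bool (e \<in> A) - w e)) +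
      (\<Sum>e\<in>J. \<Sum>e'\<in>J. V e e' * ((of_bool (e \<in> A) - w e) * (of_bool (e' \<in> A) - w e'))))\<^sup>2) \<le>
    4 * (\<Sum>e\<in>J. (b e)\<^sup>2) + 2 * (\<Sum>e\<in>J. \<Sum>e'\<in>J. (V e e')\<^sup>2)"
  using assms(1) w
proof (induction J rule: finite_induct)
  case (insert k J)
  define z :: "'a set \<Rightarrow> 'a \<Rightarrow> real" where "z A e = of_bool (e \<in> A) - w e" for A e
  define Y where "Y K A = (\<Sum>e\<in>K. 2 * b e * z A e) + (\<Sum>e\<in>K. \<Sum>e'\<in>K. V e e' * (z A e * z A e'))"
    for K A
  define T where "T A = b k + (\<Sum>e\<in>J. V k e * z A e)" for A
  have kJ: "k \<notin> J" and fin: "finite J" using insert.hyps by auto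
  have Yins: "Y (insert k J) A = Y J A + 2 * z A k * T A" for A
  proof -
    have "(\<Sum>e\<in>J. V e k * (z A e * z A k)) = (\<Sum>e\<in>J. V k e * (z A k * z A e))"
      by (intro sum.cong) (auto simp: sym)
    then show ?thesis using kJ fin diag
      by (simp add: Y_def T_def sum.distrib sum_distrib_left algebra_simps)
  qed
  have zk: "z (insert k A) e = z A e" if "e \<in> J" for A e
    using that kJ by (auto simp: z_def)
  have YJ: "Y J (insert k A) = Y J A" and TJ: "T (insert k A) = T A" for A
    using zk by (simp_all add: Y_def T_def)
  have wk: "0 \<le> w k" "w k \<le> 1" using insert.prems by auto
  have "bexp (insert k J) w (\<lambda>A. (Y (insert k J) A)\<^sup>2) =
      w k * bexp J w (\<lambda>A. (Y J A + 2 * (1 - w k) * T A)\<^sup>2) + (1 - w k) * bexp J w (\<lambda>A. (Y J A - 2 * w k * T A)\<^sup>2)"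
  proof -
    have "bexp J w (\<lambda>A. (Y (insert k J) A)\<^sup>2) = bexp J w (\<lambda>A. (Y J A - 2 * w k * T A)\<^sup>2)"
      using kJ by (intro bexp_cong) (auto simp: Yins z_def)
    moreover have "bexp J w (\<lambda>A. (Y (insert k J) (insert k A))\<^sup>2) = bexp J w (\<lambda>A. (Y J A + 2 * (1 - w k) * T A)\<^sup>2)"
      by (intro bexp_cong) (auto simp: Yins YJ TJ z_def)
    ultimately show ?thesis using kJ fin by (simp add: bexp_insert)
  qed
  also have "\<dots> = bexp J w (\<lambda>A. (Y J A)\<^sup>2 + 4 * (w k * (1 - w k)) * (T A)\<^sup>2)"
    unfolding bexp_cmult[symmetric] bexp_add[symmetric]
    by (intro bexp_cong refl) (simp add: algebra_simps power2_eq_square)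
  also have "\<dots> = bexp J w (\<lambda>A. (Y J A)\<^sup>2) + 4 * ((w k * (1 - w k)) * bexp J w (\<lambda>A. (T A)\<^sup>2))"
    by (simp add: bexp_add bexp_cmult)
  also have "\<dots> \<le> (4 * (\<Sum>e\<in>J. (b e)\<^sup>2) + 2 * (\<Sum>e\<in>J. \<Sum>e'\<in>J. (V e e')\<^sup>2)) +
      4 * (1 * ((b k)\<^sup>2 + (\<Sum>e\<in>J. (V k e)\<^sup>2)))"
  proof (intro add_mono mult_left_mono mult_mono)
    show "bexp J w (\<lambda>A. (Y J A)\<^sup>2) \<le> 4 * (\<Sum>e\<in>J. (b e)\<^sup>2) + 2 * (\<Sum>e\<in>J. \<Sum>e'\<in>J. (V e e')\<^sup>2)"
      using insert.IH insert.prems by (simp add: Y_def z_def)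
    show "w k * (1 - w k) \<le> 1" using wk by (rule mult_one_minus_le_one)
    have "bexp J w (\<lambda>A. (T A)\<^sup>2) = (b k)\<^sup>2 + (\<Sum>e\<in>J. (V k e)\<^sup>2 * (w e * (1 - w e)))"
      unfolding T_def z_def by (rule bexp_linear_second_moment[OF fin])
    also have "\<dots> \<le> (b k)\<^sup>2 + (\<Sum>e\<in>J. (V k e)\<^sup>2 * 1)"
      using insert.prems by (intro add_left_mono sum_mono mult_left_mono mult_one_minus_le_one) auto
    finally show "bexp J w (\<lambda>A. (T A)\<^sup>2) \<le> (b k)\<^sup>2 + (\<Sum>e\<in>J. (V k e)\<^sup>2)" by simp
    show "0 \<le> bexp J w (\<lambda>A. (T A)\<^sup>2)" using insert.prems by (intro bexp_nonneg) auto
  qed auto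
  also have "\<dots> = 4 * (\<Sum>e\<in>insert k J. (b e)\<^sup>2) + 2 * (\<Sum>e\<in>insert k J. \<Sum>e'\<in>insert k J. (V e e')\<^sup>2)"
    using kJ fin diag sym[of _ k] by (simp add: sum.distrib algebra_simps)
  finally show ?case by (simp add: Y_def z_def)
qed simp

text \<open>Chebyshev's inequality; without planting the form has no linear part, so the second
  moment bound is applied with \<open>b\<close> equal to 0.\<close>

lemma quad_form_null_bound:
  assumes "finite J" and sym: "\<And>e e'. V e e' = V e' e" and diag: "\<And>e. V e e = 0"
    and r: "0 \<le> r" "r \<le> 1" and T: "0 < T"
  shows "bexp J (\<lambda>_. r) (\<lambda>A. of_bool (T \<le> quad_form J V r A)) \<le>
    2 * (\<Sum>e\<in>J. \<Sum>e'\<in>J. (V e e')\<^sup>2) / T\<^sup>2"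
proof -
  have "bexp J (\<lambda>_. r) (\<lambda>A. of_bool (T \<le> quad_form J V r A)) \<le>
      bexp J (\<lambda>_. r) (\<lambda>A. of_bool (T\<^sup>2 \<le> (quad_form J V r A)\<^sup>2))"
    using T r by (intro bexp_mono) (auto intro: power_mono)
  also have "\<dots> \<le> bexp J (\<lambda>_. r) (\<lambda>A. (quad_form J V r A)\<^sup>2) / T\<^sup>2"
    using T r assms(1) by (intro bexp_markov) auto
  also have "bexp J (\<lambda>_. r) (\<lambda>A. (quad_form J V r A)\<^sup>2) \<le> 2 * (\<Sum>e\<in>J. \<Sum>e'\<in>J. (V e e')\<^sup>2)"
    using bexp_quadratic_second_moment[of J V "\<lambda>_. r" "\<lambda>_. 0"] assms by (simp add: quad_form_def)
  finally show ?thesis using T by (simp add: divide_right_mono)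
qed

text \<open>Chebyshev's inequality around the planted mean \<open>m\<close>. The linear part has
  coefficients \<open>b k\<close> that depend on the unknown \<open>G\<close>; assumption
  \<open>tri\<close> turns the sum of their squares into \<open>2 * R * m\<close> plus a sum
  independent of \<open>G\<close>, so only the size of \<open>m\<close> matters and not the shape of
  \<open>G\<close>.\<close>

lemma quad_form_planted_bound:
  assumes fin: "finite J" and G: "G \<subseteq> J"
    and sym: "\<And>e e'. V e e' = V e' e" and diag: "\<And>e. V e e = 0" and nonneg: "\<And>e e'. 0 \<le> V e e'"
    and tri: "\<And>e e' k. e \<noteq> e' \<Longrightarrow> V k e * V k e' \<le> V e e' * (V k e + V k e')"
    and row: "\<And>e. e \<in> J \<Longrightarrow> (\<Sum>e'\<in>J. V e' e) \<le> R"
    and r: "0 \<le> r" "r \<le> 1" and T: "0 < T" "2 * T \<le> m"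
    and m: "m = (1 - r)\<^sup>2 * (\<Sum>e\<in>G. \<Sum>e'\<in>G. V e e')"
  shows "bexp J (\<lambda>e. if e \<in> G then 1 else r) (\<lambda>A. of_bool (quad_form J V r A < T)) \<le>
    32 * R / m + 24 * (\<Sum>e\<in>J. \<Sum>e'\<in>J. (V e e')\<^sup>2) / m\<^sup>2"
proof -
  let ?w = "\<lambda>e. if e \<in> G then 1 else r"
  let ?S = "\<Sum>e\<in>J. \<Sum>e'\<in>J. (V e e')\<^sup>2"
  define a where "a e = ?w e - r" for e
  define b where "b k = (\<Sum>e\<in>J. V k e * a e)" for k
  have finG: "finite G" using fin G finite_subset by auto
  have aG: "(\<Sum>e\<in>J. f e * a e) = (1 - r) * (\<Sum>e\<in>G. f e)" for f :: "'a \<Rightarrow> real"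
  proof -
    have "(\<Sum>e\<in>J. f e * a e) = (\<Sum>e\<in>G. f e * a e)"
      using fin G by (intro sum.mono_neutral_right) (auto simp: a_def)
    then show ?thesis by (simp add: a_def sum_distrib_left mult.commute)
  qed
  \<comment> \<open>Writing the centring at \<open>r\<close> as the true centring at
    \<open>?w\<close> plus the shift \<open>a\<close>, which is supported on \<open>G\<close>,
    splits the form into the constant \<open>m\<close> and the centred fluctuation
    \<open>Y\<close>.\<close>
  define Y where "Y A = (\<Sum>e\<in>J. 2 * b e * (of_bool (e \<in> A) - ?w e)) +
      (\<Sum>e\<in>J. \<Sum>e'\<in>J. V e e' * ((of_bool (e \<in> A) - ?w e) * (of_bool (e' \<in> A) - ?w e')))" for A
  have X: "quad_form J V r A = m + Y A" for A
  proof -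
    define z where "z e = of_bool (e \<in> A) - ?w e" for e
    have "quad_form J V r A = (\<Sum>e\<in>J. \<Sum>e'\<in>J. V e e' * ((a e + z e) * (a e' + z e')))"
      by (simp add: quad_form_def a_def z_def)
    also have "\<dots> = (\<Sum>e\<in>J. \<Sum>e'\<in>J. V e e' * (a e * a e')) + (\<Sum>e\<in>J. \<Sum>e'\<in>J. V e e' * (z e * z e')) +
        ((\<Sum>e\<in>J. \<Sum>e'\<in>J. V e e' * (a e * z e')) + (\<Sum>e\<in>J. \<Sum>e'\<in>J. V e e' * (z e * a e')))"
      by (simp add: algebra_simps sum.distrib)
    also have "(\<Sum>e\<in>J. \<Sum>e'\<in>J. V e e' * (a e * z e')) = (\<Sum>e\<in>J. \<Sum>e'\<in>J. V e e' * (z e * a e'))"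
      by (subst sum.swap) (simp add: sym mult.commute)
    also have "(\<Sum>e\<in>J. \<Sum>e'\<in>J. V e e' * (z e * a e')) = (\<Sum>e\<in>J. b e * z e)"
      by (simp add: b_def sum_distrib_left sum_distrib_right mult_ac)
    also have "(\<Sum>e\<in>J. \<Sum>e'\<in>J. V e e' * (a e * a e')) = m"
    proof -
      have "(\<Sum>e\<in>J. \<Sum>e'\<in>J. V e e' * (a e * a e')) = (\<Sum>e\<in>J. (\<Sum>e'\<in>J. V e e' * a e') * a e)"
        by (simp add: sum_distrib_left sum_distrib_right mult_ac)
      also have "\<dots> = m" unfolding aG m by (simp add: sum_distrib_left power2_eq_square mult_ac)
      finally show ?thesis .
    qed
    finally show ?thesis by (simp add: Y_def z_def sum_distrib_left sum.distrib algebra_simps)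
  qed
  have m0: "0 < m" using T by simp
  have "(\<Sum>k\<in>J. (b k)\<^sup>2) = (1 - r)\<^sup>2 * (\<Sum>k\<in>J. \<Sum>e\<in>G. \<Sum>e'\<in>G. V k e * V k e')"
    unfolding b_def aG
    by (simp add: power_mult_distrib sum_distrib_left power2_eq_square sum_product mult_ac)
  also have "\<dots> \<le> (1 - r)\<^sup>2 * (\<Sum>k\<in>J. \<Sum>e\<in>G. \<Sum>e'\<in>G. V e e' * (V k e + V k e') + (if e = e' then (V k e)\<^sup>2 else 0))"
    using tri by (intro mult_left_mono sum_mono) (auto simp: diag power2_eq_square)
  also have "\<dots> = (1 - r)\<^sup>2 * ((\<Sum>e\<in>G. \<Sum>e'\<in>G. V e e' * (\<Sum>k\<in>J. V k e + V k e')) + (\<Sum>k\<in>J. \<Sum>e\<in>G. (V k e)\<^sup>2))"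
  proof -
    have "(\<Sum>k\<in>J. \<Sum>e\<in>G. \<Sum>e'\<in>G. V e e' * (V k e + V k e')) = (\<Sum>e\<in>G. \<Sum>e'\<in>G. \<Sum>k\<in>J. V e e' * (V k e + V k e'))"
      by (subst sum.swap, rule sum.cong[OF refl], subst sum.swap) simp
    then have "(\<Sum>k\<in>J. \<Sum>e\<in>G. \<Sum>e'\<in>G. V e e' * (V k e + V k e')) =
        (\<Sum>e\<in>G. \<Sum>e'\<in>G. V e e' * (\<Sum>k\<in>J. V k e + V k e'))"
      by (simp only: sum_distrib_left)
    moreover have "(\<Sum>e'\<in>G. if e = e' then (V k e)\<^sup>2 else 0) = (V k e)\<^sup>2" if "e \<in> G" for k e
      using finG that by simp
    ultimately show ?thesis by (simp add: sum.distrib)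
  qed
  also have "\<dots> \<le> (1 - r)\<^sup>2 * ((\<Sum>e\<in>G. \<Sum>e'\<in>G. V e e' * (2 * R)) + ?S)"
  proof (intro mult_left_mono add_mono sum_mono)
    fix e e' assume "e \<in> G" "e' \<in> G"
    then show "(\<Sum>k\<in>J. V k e + V k e') \<le> 2 * R"
      using row[of e] row[of e'] subsetD[OF G, of e] subsetD[OF G, of e'] by (simp add: sum.distrib)
  next
    fix k show "(\<Sum>e\<in>G. (V k e)\<^sup>2) \<le> (\<Sum>e'\<in>J. (V k e')\<^sup>2)"
      using fin G by (intro sum_mono2) auto
  qed (use nonneg in auto)
  also have "\<dots> = 2 * R * m + (1 - r)\<^sup>2 * ?S"
    unfolding m by (simp add: sum_distrib_left sum_distrib_right algebra_simps)
  also have "(1 - r)\<^sup>2 * ?S \<le> 1 * ?S"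
    using r by (intro mult_right_mono sum_nonneg) (auto simp: power_le_one)
  finally have bsum: "(\<Sum>k\<in>J. (b k)\<^sup>2) \<le> 2 * R * m + ?S" by simp
  have "bexp J ?w (\<lambda>A. of_bool (quad_form J V r A < T)) \<le> bexp J ?w (\<lambda>A. of_bool (m\<^sup>2 / 4 \<le> (Y A)\<^sup>2))"
  proof (intro bexp_mono)
    fix A
    \<comment> \<open>The threshold \<open>T\<close> is at most half of the mean, so missing it
      takes a downward deviation of at least \<open>m / 2\<close>.\<close>
    have "(m / 2)\<^sup>2 \<le> (- Y A)\<^sup>2" if "m + Y A < T"
      using that T m0 by (intro power_mono) auto
    then show "of_bool (quad_form J V r A < T) \<le> (of_bool (m\<^sup>2 / 4 \<le> (Y A)\<^sup>2) :: real)"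
      unfolding X by (auto simp: power_divide)
  qed (use r in auto)
  also have "\<dots> \<le> bexp J ?w (\<lambda>A. (Y A)\<^sup>2) / (m\<^sup>2 / 4)"
    using m0 r fin by (intro bexp_markov) auto
  also have "\<dots> \<le> (4 * (\<Sum>k\<in>J. (b k)\<^sup>2) + 2 * ?S) / (m\<^sup>2 / 4)"
    unfolding Y_def using r by (intro divide_right_mono bexp_quadratic_second_moment fin sym diag) auto
  also have "\<dots> \<le> (4 * (2 * R * m + ?S) + 2 * ?S) / (m\<^sup>2 / 4)"
    using bsum by (intro divide_right_mono) auto
  also have "\<dots> = 32 * R / m + 24 * ?S / m\<^sup>2"
    using m0 by (simp add: field_simps power2_eq_square)
  finally show ?thesis .
qed

section \<open>Detecting a planted path in a block of edges\<close>

lemma E2_cases: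
  assumes "e \<in> E2"
  obtains a b where "e = {(a, b), (a + 1, b)}" | a b where "e = {(a, b), (a, b + 1)}"
proof -
  obtain x1 x2 y1 y2 where e: "e = {(x1, x2), (y1, y2)}" "\<bar>x1 - y1\<bar> + \<bar>x2 - y2\<bar> = 1"
    using assms by (auto simp: E2_def)
  then consider "y1 = x1 + 1" "y2 = x2" | "x1 = y1 + 1" "y2 = x2" | "y1 = x1" "y2 = x2 + 1" | "y1 = x1" "x2 = y2 + 1"
    by linarith
  then show thesis using that e(1) by cases (auto simp: insert_commute)
qed

text \<open>Twice the midpoint of an edge; its two coordinates have different parity, and the parities
  reveal the direction of the edge.\<close>

definition vsum :: "edge \<Rightarrow> int \<times> int" where
  "vsum e = (\<Sum>v\<in>e. fst v, \<Sum>v\<in>e. snd v)"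

lemma vsum_pair: "x \<noteq> y \<Longrightarrow> vsum {x, y} = (fst x + fst y, snd x + snd y)"
  by (simp add: vsum_def)

lemma inj_on_vsum: "inj_on vsum E2"
proof (rule inj_onI)
  fix e e' assume e: "e \<in> E2" "e' \<in> E2" "vsum e = vsum e'"
  have 1: "vsum {(a, b), (a + 1, b)} = (2 * a + 1, 2 * b)" for a b
    by (simp add: vsum_pair)
  have 2: "vsum {(a, b), (a, b + 1)} = (2 * a, 2 * b + 1)" for a b
    by (simp add: vsum_pair)
  have 3: "2 * a + 1 \<noteq> 2 * b" "2 * b \<noteq> 2 * a + 1" for a b :: int
    by presburger+
  show "e = e'"
    using e by (elim E2_cases) (auto simp: 1 2 3)
qed

text \<open>Twice the l1 distance of the midpoints, which keeps it a natural number.\<close>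

definition edge_dist :: "edge \<Rightarrow> edge \<Rightarrow> nat" where
  "edge_dist e e' = nat \<bar>fst (vsum e) - fst (vsum e')\<bar> + nat \<bar>snd (vsum e) - snd (vsum e')\<bar>"

definition edge_weight :: "edge \<Rightarrow> edge \<Rightarrow> real" where
  "edge_weight e e' = (if e = e' then 0 else 1 / (1 + real (edge_dist e e')))"

lemma edge_dist_commute: "edge_dist e e' = edge_dist e' e"
  by (simp add: edge_dist_def abs_minus_commute)

lemma edge_dist_triangle: "edge_dist e e' \<le> edge_dist k e + edge_dist k e'"
proof -
  have "nat \<bar>a - b\<bar> \<le> nat \<bar>c - a\<bar> + nat \<bar>c - b\<bar>" for a b c :: int
    by linarith
  from add_mono[OF this this] show ?thesis
    unfolding edge_dist_def by (simp add: algebra_simps)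
qed

lemma edge_weight_commute: "edge_weight e e' = edge_weight e' e"
  by (simp add: edge_weight_def edge_dist_commute)

lemma edge_weight_same [simp]: "edge_weight e e = 0"
  by (simp add: edge_weight_def)

lemma edge_weight_nonneg: "0 \<le> edge_weight e e'"
  by (simp add: edge_weight_def)

text \<open>This is the triangle inequality \<open>1 + c \<le> (1 + a) + (1 + b)\<close> divided by
  \<open>(1 + a) * (1 + b) * (1 + c)\<close>.\<close>

lemma edge_weight_convolution:
  assumes "e \<noteq> e'"
  shows "edge_weight k e * edge_weight k e' \<le> edge_weight e e' * (edge_weight k e + edge_weight k e')"
proof (cases "k = e \<or> k = e'")
  case True
  then show ?thesis using edge_weight_nonneg by auto
next
  case False
  define a b c where "a = real (edge_dist k e)" "b = real (edge_dist k e')" "c = real (edge_dist e e')"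
  have "c \<le> a + b" using edge_dist_triangle[of e e' k] unfolding a_b_c_def by linarith
  moreover have "0 \<le> a" "0 \<le> b" "0 \<le> c" by (auto simp: a_b_c_def)
  ultimately have "1 / (1 + a) * (1 / (1 + b)) * (1 + c) \<le> 1 / (1 + a) * (1 / (1 + b)) * ((1 + b) + (1 + a))"
    by (intro mult_left_mono) auto
  also have "\<dots> = 1 / (1 + a) + 1 / (1 + b)"
    using \<open>0 \<le> a\<close> \<open>0 \<le> b\<close> by (simp add: field_simps)
  finally have "1 / (1 + a) * (1 / (1 + b)) * (1 + c) \<le> 1 / (1 + a) + 1 / (1 + b)" .
  then have "1 / (1 + a) * (1 / (1 + b)) \<le> (1 / (1 + a) + 1 / (1 + b)) / (1 + c)"
    using \<open>0 \<le> c\<close> by (subst pos_le_divide_eq) auto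
  then show ?thesis using False assms by (simp add: edge_weight_def a_b_c_def)
qed

section \<open>Sums of the weight and of its square over a square of lattice points\<close>

lemma sum_reciprocal_square_le: "(\<Sum>i\<le>M. \<Sum>j\<le>M. 1 / (1 + real (i + j))) \<le> 2 * (real M + 1)"
proof (induction M)
  case (Suc M)
  \<comment> \<open>The new row and the new column contribute at most \<open>1 - 1 / (M + 2)\<close>
    each and the new corner at most \<open>1 / (M + 2)\<close>, so each step costs at most
    2.\<close>
  have "(\<Sum>i\<le>Suc M. \<Sum>j\<le>Suc M. 1 / (1 + real (i + j))) =
      (\<Sum>i\<le>M. \<Sum>j\<le>M. 1 / (1 + real (i + j))) + 2 * (\<Sum>i\<le>M. 1 / (2 + real M + real i)) + 1 / (3 + 2 * real M)"
    by (simp add: sum.distrib algebra_simps)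
  moreover have "(\<Sum>i\<le>M. 1 / (2 + real M + real i)) \<le> (\<Sum>i\<le>M. 1 / (2 + real M))"
    by (intro sum_mono divide_left_mono) auto
  moreover have "(\<Sum>i\<le>M. 1 / (2 + real M)) = 1 - 1 / (real M + 2)"
    by (simp add: field_simps)
  moreover have "1 / (3 + 2 * real M) \<le> 1 / (real M + 2)"
    by (intro frac_le) auto
  moreover have "0 \<le> 1 / (real M + 2)" by simp
  moreover have "X \<le> 2 * (m + 1 + 1)"
    if "X = S + 2 * P + x" "P \<le> Q" "Q = 1 - y" "x \<le> y" "0 \<le> y" "S \<le> 2 * (m + 1)" for X S P Q x y m :: real
    using that by argo
  ultimately show ?case using Suc unfolding of_nat_Suc add.commute[of 1 "real M"] by blast
qed simp

text \<open>Telescoping with \<open>1 / (a + 1)\<^sup>2 \<le> 1 / a - 1 / (a + 1)\<close>; the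
  subtracted remainder is what the induction needs.\<close>

lemma sum_inverse_square_le:
  "n \<ge> 1 \<Longrightarrow> (\<Sum>j\<le>M. 1 / (real n + real j)\<^sup>2) \<le> 2 / real n - 1 / (real n + real M)"
proof (induction M)
  case 0
  have "real n * 1 \<le> real n * real n" using 0 by (intro mult_left_mono) auto
  then show ?case using 0 by (simp add: divide_simps power2_eq_square)
next
  case (Suc M)
  define a where "a = real n + real M"
  have a: "a \<ge> 1" using Suc.prems by (simp add: a_def)
  have "1 / (a + 1)\<^sup>2 \<le> 1 / a - 1 / (a + 1)"
    using a by (simp add: divide_simps power2_eq_square)
  then show ?case using Suc by (simp add: a_def add.commute add.left_commute)
qed

lemma sum_reciprocal_square2_le: "(\<Sum>i\<le>M. \<Sum>j\<le>M. 1 / (1 + real (i + j))\<^sup>2) \<le> 2 * harm (Suc M)"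
proof -
  have "(\<Sum>j\<le>M. 1 / (1 + real (i + j))\<^sup>2) \<le> 2 * inverse (real (Suc i))" for i
  proof -
    have "(\<Sum>j\<le>M. 1 / (1 + real (i + j))\<^sup>2) = (\<Sum>j\<le>M. 1 / (real (Suc i) + real j)\<^sup>2)"
      by (simp add: add_ac)
    also have "\<dots> \<le> 2 / real (Suc i) - 1 / (real (Suc i) + real M)"
      by (rule sum_inverse_square_le) simp
    also have "\<dots> \<le> 2 * inverse (real (Suc i))" by (simp add: divide_inverse)
    finally show ?thesis .
  qed
  then have "(\<Sum>i\<le>M. \<Sum>j\<le>M. 1 / (1 + real (i + j))\<^sup>2) \<le> (\<Sum>i\<le>M. 2 * inverse (real (Suc i)))"
    by (rule sum_mono)
  also have "\<dots> = 2 * harm (Suc M)"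
    unfolding sum_distrib_left[symmetric]
    by (induction M) (simp_all add: harm_Suc harm_expand(1))
  finally show ?thesis .
qed

text \<open>The two half-lines overlap in 0, which is harmless because \<open>g\<close> is
  nonnegative.\<close>

lemma sum_abs_int_le:
  fixes g :: "nat \<Rightarrow> real"
  assumes "\<And>i. 0 \<le> g i"
  shows "(\<Sum>a\<in>{- int M..int M}. g (nat \<bar>a\<bar>)) \<le> 2 * (\<Sum>i\<le>M. g i)"
proof -
  have "{- int M..int M} \<subseteq> int ` {..M} \<union> (\<lambda>i. - int i) ` {..M}"
  proof
    fix a assume a: "a \<in> {- int M..int M}"
    show "a \<in> int ` {..M} \<union> (\<lambda>i. - int i) ` {..M}"
    proof (cases "a \<ge> 0")
      case True
      then show ?thesis using a by (intro UnI1 image_eqI[of _ _ "nat a"]) auto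
    next
      case False
      then show ?thesis using a by (intro UnI2 image_eqI[of _ _ "nat (- a)"]) auto
    qed
  qed
  then have "(\<Sum>a\<in>{- int M..int M}. g (nat \<bar>a\<bar>)) \<le> (\<Sum>a\<in>int ` {..M} \<union> (\<lambda>i. - int i) ` {..M}. g (nat \<bar>a\<bar>))"
    using assms by (intro sum_mono2) auto
  also have "\<dots> \<le> (\<Sum>a\<in>int ` {..M}. g (nat \<bar>a\<bar>)) + (\<Sum>a\<in>(\<lambda>i. - int i) ` {..M}. g (nat \<bar>a\<bar>))"
    using assms by (subst sum_Un) (auto intro!: sum_nonneg)
  also have "\<dots> = 2 * (\<Sum>i\<le>M. g i)"
    by (subst (1 2) sum.reindex) (auto simp: inj_on_def)
  finally show ?thesis .
qed

text \<open>As \<open>vsum\<close> is injective, each difference vector occurs for at most one edge;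
  folding the square of vectors onto one quadrant gives the factor 4.\<close>

lemma sum_edges_le:
  fixes g :: "nat \<Rightarrow> real"
  assumes g: "\<And>i. 0 \<le> g i" and J: "J \<subseteq> E2"
    and M: "\<And>e'. e' \<in> J \<Longrightarrow> \<bar>fst (vsum e) - fst (vsum e')\<bar> \<le> int M \<and> \<bar>snd (vsum e) - snd (vsum e')\<bar> \<le> int M"
  shows "(\<Sum>e'\<in>J. g (edge_dist e e')) \<le> 4 * (\<Sum>i\<le>M. \<Sum>j\<le>M. g (i + j))"
proof -
  let ?h = "\<lambda>e'. (fst (vsum e) - fst (vsum e'), snd (vsum e) - snd (vsum e'))"
  let ?I = "{- int M..int M}"
  have inj: "inj_on ?h J"
    using inj_on_vsum J by (auto simp: inj_on_def prod_eq_iff)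
  have "(\<Sum>e'\<in>J. g (edge_dist e e')) = (\<Sum>z\<in>?h ` J. g (nat \<bar>fst z\<bar> + nat \<bar>snd z\<bar>))"
    using inj by (simp add: sum.reindex edge_dist_def)
  also have "\<dots> \<le> (\<Sum>z\<in>?I \<times> ?I. g (nat \<bar>fst z\<bar> + nat \<bar>snd z\<bar>))"
  proof (rule sum_mono2)
    show "?h ` J \<subseteq> ?I \<times> ?I"
    proof
      fix z assume "z \<in> ?h ` J"
      then obtain e' where "e' \<in> J" "z = ?h e'" by auto
      then show "z \<in> ?I \<times> ?I" using M[of e'] by auto
    qed
  qed (use g in auto)
  also have "\<dots> = (\<Sum>a\<in>?I. \<Sum>b\<in>?I. g (nat \<bar>a\<bar> + nat \<bar>b\<bar>))"
    by (simp add: sum.cartesian_product case_prod_unfold)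
  also have "\<dots> \<le> (\<Sum>a\<in>?I. 2 * (\<Sum>j\<le>M. g (nat \<bar>a\<bar> + j)))"
    using g by (intro sum_mono sum_abs_int_le)
  also have "\<dots> = 2 * (\<Sum>a\<in>?I. \<Sum>j\<le>M. g (nat \<bar>a\<bar> + j))" by (simp add: sum_distrib_left)
  also have "\<dots> \<le> 2 * (2 * (\<Sum>i\<le>M. \<Sum>j\<le>M. g (i + j)))"
    using g by (intro mult_left_mono sum_abs_int_le[where g = "\<lambda>i. \<Sum>j\<le>M. g (i + j)"] sum_nonneg) auto
  finally show ?thesis by simp
qed

text \<open>The box of side \<open>L\<close> with index \<open>b\<close> together with its eight
  neighbours. A walk of \<open>L\<close> steps that starts in the central box cannot leave
  it.\<close>

definition block :: "nat \<Rightarrow> int \<times> int \<Rightarrow> vertex set" where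
  "block L b = {(fst b - 1) * int L..<(fst b + 2) * int L} \<times> {(snd b - 1) * int L..<(snd b + 2) * int L}"

definition block_edges :: "nat \<Rightarrow> int \<times> int \<Rightarrow> edge set" where
  "block_edges L b = {e \<in> E2. e \<subseteq> block L b}"

lemma finite_block_edges: "finite (block_edges L b)"
  by (rule finite_subset[of _ "Pow (block L b)"]) (auto simp: block_edges_def block_def)

lemma block_edges_vsum:
  assumes "e \<in> block_edges L b"
  shows "vsum e \<in> {2 * (fst b - 1) * int L..2 * (fst b + 2) * int L} \<times>
    {2 * (snd b - 1) * int L..2 * (snd b + 2) * int L}"
proof -
  have "e \<in> E2" "e \<subseteq> block L b" using assms by (auto simp: block_edges_def)
  then show ?thesis
    by (elim E2_cases) (auto simp: vsum_pair block_def algebra_simps)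
qed

text \<open>The side is \<open>3 * L\<close>, and \<open>vsum\<close> doubles coordinates.\<close>

lemma block_edges_dist:
  assumes "e \<in> block_edges L b" "e' \<in> block_edges L b"
  shows "\<bar>fst (vsum e) - fst (vsum e')\<bar> \<le> int (6 * L) \<and> \<bar>snd (vsum e) - snd (vsum e')\<bar> \<le> int (6 * L)"
proof -
  have *: "2 * (c - 1) * int L = 2 * (c * int L) - 2 * int L" "2 * (c + 2) * int L = 2 * (c * int L) + 4 * int L" for c
    by (simp_all add: algebra_simps)
  have "\<bar>x - y\<bar> \<le> int (6 * L)" if "x \<in> {2 * (c - 1) * int L..2 * (c + 2) * int L}"
    "y \<in> {2 * (c - 1) * int L..2 * (c + 2) * int L}" for x y c
    using that unfolding * by auto
  then show ?thesis
    using block_edges_vsum[OF assms(1)] block_edges_vsum[OF assms(2)]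
    unfolding mem_Times_iff fst_conv snd_conv by blast
qed

lemma card_block_edges: "card (block_edges L b) \<le> (6 * L + 1)\<^sup>2"
proof -
  let ?S = "{2 * (fst b - 1) * int L..2 * (fst b + 2) * int L} \<times>
    {2 * (snd b - 1) * int L..2 * (snd b + 2) * int L}"
  have "card (block_edges L b) = card (vsum ` block_edges L b)"
    using inj_on_vsum by (intro card_image[symmetric]) (auto simp: block_edges_def inj_on_def)
  also have "\<dots> \<le> card ?S" using block_edges_vsum[of _ L b] by (intro card_mono finite_cartesian_product) blast+
  also have "\<dots> = (6 * L + 1)\<^sup>2"
    by (simp add: card_cartesian_product power2_eq_square algebra_simps nat_add_distrib nat_mult_distrib)
  finally show ?thesis .
qed

lemma edge_weight_row_sum:
  assumes "e \<in> block_edges L b"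
  shows "(\<Sum>e'\<in>block_edges L b. edge_weight e' e) \<le> 8 * (6 * real L + 1)"
proof -
  have "(\<Sum>e'\<in>block_edges L b. edge_weight e' e) \<le> (\<Sum>e'\<in>block_edges L b. 1 / (1 + real (edge_dist e e')))"
    by (intro sum_mono) (simp add: edge_weight_def edge_dist_commute)
  also have "\<dots> \<le> 4 * (\<Sum>i\<le>6*L. \<Sum>j\<le>6*L. 1 / (1 + real (i + j)))"
    using block_edges_dist[OF assms] by (intro sum_edges_le) (auto simp: block_edges_def)
  also have "\<dots> \<le> 4 * (2 * (real (6 * L) + 1))"
    by (intro mult_left_mono sum_reciprocal_square_le) auto
  finally show ?thesis by simp
qed

lemma edge_weight_square_sum:
  "(\<Sum>e\<in>block_edges L b. \<Sum>e'\<in>block_edges L b. (edge_weight e e')\<^sup>2) \<le>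
    (6 * real L + 1)\<^sup>2 * (8 * harm (Suc (6 * L)))"
proof -
  have "(\<Sum>e'\<in>block_edges L b. (edge_weight e e')\<^sup>2) \<le> 8 * harm (Suc (6 * L))"
    if "e \<in> block_edges L b" for e
  proof -
    have "(\<Sum>e'\<in>block_edges L b. (edge_weight e e')\<^sup>2) \<le> (\<Sum>e'\<in>block_edges L b. 1 / (1 + real (edge_dist e e'))\<^sup>2)"
      by (intro sum_mono) (simp add: edge_weight_def power_divide)
    also have "\<dots> \<le> 4 * (\<Sum>i\<le>6*L. \<Sum>j\<le>6*L. 1 / (1 + real (i + j))\<^sup>2)"
      using block_edges_dist[OF that] by (intro sum_edges_le) (auto simp: block_edges_def)
    also have "\<dots> \<le> 4 * (2 * harm (Suc (6 * L)))"
      by (intro mult_left_mono sum_reciprocal_square2_le) auto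
    finally show ?thesis by simp
  qed
  then have "(\<Sum>e\<in>block_edges L b. \<Sum>e'\<in>block_edges L b. (edge_weight e e')\<^sup>2) \<le>
      real (card (block_edges L b)) * (8 * harm (Suc (6 * L)))"
    using sum_bounded_above[of "block_edges L b" "\<lambda>e. \<Sum>e'\<in>block_edges L b. (edge_weight e e')\<^sup>2"]
    by blast
  also have "\<dots> \<le> real ((6 * L + 1)\<^sup>2) * (8 * harm (Suc (6 * L)))"
    by (intro mult_right_mono of_nat_mono card_block_edges mult_nonneg_nonneg harm_nonneg) simp
  finally show ?thesis by (simp add: add.commute)
qed

lemma harm_add_le: "n \<ge> 1 \<Longrightarrow> harm (n + m) \<le> harm n + real m / real n"
proof (induction m)
  case (Suc m)
  have "inverse (real (Suc (n + m))) \<le> 1 / real n"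
    using Suc.prems by (simp add: divide_simps)
  then show ?case using Suc by (simp add: harm_Suc add_divide_distrib)
qed simp

lemma harm_ge_one: "n \<ge> 1 \<Longrightarrow> (1::real) \<le> harm n"
  using harm_mono[of 1 n] by (simp add: harm_def)

text \<open>All that the block test knows of a path: \<open>L\<close> consecutive self-avoiding
  steps somewhere in \<open>G\<close>. The direction of travel is left free.\<close>

definition has_run :: "nat \<Rightarrow> edge set \<Rightarrow> bool" where
  "has_run L G \<longleftrightarrow> (\<exists>\<gamma>. inj_on \<gamma> {..L} \<and> (\<forall>t<L. {\<gamma> t, \<gamma> (Suc t)} \<in> E2 \<inter> G))"

lemma E2_iff: "{x, y} \<in> E2 \<longleftrightarrow> \<bar>fst x - fst y\<bar> + \<bar>snd x - snd y\<bar> = 1"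
proof
  assume "\<bar>fst x - fst y\<bar> + \<bar>snd x - snd y\<bar> = 1"
  then show "{x, y} \<in> E2" unfolding E2_def by blast
next
  assume "{x, y} \<in> E2"
  then obtain u v where "{x, y} = {u, v}" "\<bar>fst u - fst v\<bar> + \<bar>snd u - snd v\<bar> = 1"
    unfolding E2_def by blast
  then show "\<bar>fst x - fst y\<bar> + \<bar>snd x - snd y\<bar> = 1"
    by (auto simp: doubleton_eq_iff)
qed

lemma inj_on_path_edges:
  assumes inj: "inj_on \<gamma> {..N}"
  shows "inj_on (\<lambda>t. {\<gamma> t, \<gamma> (Suc t)}) {..<N}"
proof (rule inj_onI)
  fix s t assume st: "s \<in> {..<N}" "t \<in> {..<N}" "{\<gamma> s, \<gamma> (Suc s)} = {\<gamma> t, \<gamma> (Suc t)}"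
  have eq: "u = v" if "\<gamma> u = \<gamma> v" "u \<le> N" "v \<le> N" for u v
    using inj_onD[OF inj that(1)] that by auto
  from st consider "\<gamma> s = \<gamma> t" | "\<gamma> s = \<gamma> (Suc t)" "\<gamma> (Suc s) = \<gamma> t"
    by (auto simp: doubleton_eq_iff)
  then show "s = t"
  proof cases
    case 2
    then have "s = Suc t" "Suc s = t" using st eq[of s "Suc t"] eq[of "Suc s" t] by auto
    then show ?thesis by simp
  qed (use eq st in auto)
qed

lemma double_sum_mono_set:
  fixes f :: "'a \<Rightarrow> 'b \<Rightarrow> real"
  assumes "finite B" "finite D" "A \<subseteq> B" "\<And>s. s \<in> A \<Longrightarrow> C s \<subseteq> D" "\<And>s t. 0 \<le> f s t"
  shows "(\<Sum>s\<in>A. \<Sum>t\<in>C s. f s t) \<le> (\<Sum>s\<in>B. \<Sum>t\<in>D. f s t)"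
proof -
  have "(\<Sum>s\<in>A. \<Sum>t\<in>C s. f s t) \<le> (\<Sum>s\<in>A. \<Sum>t\<in>D. f s t)"
    using assms by (intro sum_mono sum_mono2) auto
  also have "\<dots> \<le> (\<Sum>s\<in>B. \<Sum>t\<in>D. f s t)"
    using assms by (intro sum_mono2 sum_nonneg) auto
  finally show ?thesis .
qed

text \<open>Starting times and time lags each range over \<open>l\<close> values, hence the run of
  length \<open>2 * l\<close>. Edges at lag \<open>d\<close> have doubled distance at most
  \<open>2 * d\<close>, and \<open>1 + 2 * d \<le> 3 * d\<close> explains the 3; the sum over lags
  is the harmonic number.\<close>

lemma run_weight:
  assumes G: "finite G" and l: "l \<ge> 1" and run: "has_run (2 * l) G"
  shows "real l * harm l / 3 \<le> (\<Sum>e\<in>G. \<Sum>e'\<in>G. edge_weight e e')"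
proof -
  obtain \<gamma> where inj: "inj_on \<gamma> {..2 * l}" and \<gamma>: "\<And>t. t < 2 * l \<Longrightarrow> {\<gamma> t, \<gamma> (Suc t)} \<in> E2 \<inter> G"
    using run by (auto simp: has_run_def)
  define ed where "ed t = {\<gamma> t, \<gamma> (Suc t)}" for t
  have nb: "\<bar>fst (\<gamma> t) - fst (\<gamma> (Suc t))\<bar> + \<bar>snd (\<gamma> t) - snd (\<gamma> (Suc t))\<bar> = 1" if "t < 2 * l" for t
    using \<gamma>[OF that] E2_iff by auto
  have neq: "\<gamma> t \<noteq> \<gamma> (Suc t)" if "t < 2 * l" for t
    using nb[OF that] by auto
  have vs: "vsum (ed t) = (fst (\<gamma> t) + fst (\<gamma> (Suc t)), snd (\<gamma> t) + snd (\<gamma> (Suc t)))" if "t < 2 * l" for t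
    using neq[OF that] by (simp add: ed_def vsum_pair)
  have dist: "edge_dist (ed t) (ed (t + d)) \<le> 2 * d" if "t + d < 2 * l" for t d
    using that
  proof (induction d)
    case (Suc d)
    have "edge_dist (ed (t + d)) (ed (t + Suc d)) \<le> 2"
      using Suc.prems nb[of "t + d"] nb[of "Suc (t + d)"] by (simp add: edge_dist_def vs)
    then show ?case using Suc edge_dist_triangle[of "ed t" "ed (t + Suc d)" "ed (t + d)"]
      by (simp add: edge_dist_commute)
  qed (simp add: edge_dist_def)
  have inj_ed: "inj_on ed {..<2 * l}"
    unfolding ed_def by (rule inj_on_path_edges[OF inj])
  have "real l * harm l / 3 = (\<Sum>s<l. \<Sum>d=1..l. 1 / (3 * real d))"
  proof -
    have "(\<Sum>d=1..l. 1 / (3 * real d)) = harm l / 3"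
      unfolding harm_def sum_divide_distrib by (intro sum.cong) (auto simp: field_simps)
    then show ?thesis by (simp only: sum_constant card_lessThan times_divide_eq_right)
  qed
  also have "\<dots> \<le> (\<Sum>s<l. \<Sum>d=1..l. edge_weight (ed s) (ed (s + d)))"
  proof (intro sum_mono)
    fix s d assume sd: "s \<in> {..<l}" "d \<in> {1..l}"
    then have "ed s \<noteq> ed (s + d)" using inj_onD[OF inj_ed, of s "s + d"] by auto
    moreover have "1 + real (edge_dist (ed s) (ed (s + d))) \<le> 3 * real d"
      using dist[of s d] sd by simp
    ultimately show "1 / (3 * real d) \<le> edge_weight (ed s) (ed (s + d))"
      by (simp add: edge_weight_def frac_le)
  qed
  also have "\<dots> = (\<Sum>s<l. \<Sum>t\<in>{s+1..s+l}. edge_weight (ed s) (ed t))"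
  proof (rule sum.cong[OF refl])
    fix s
    show "(\<Sum>d=1..l. edge_weight (ed s) (ed (s + d))) = (\<Sum>t\<in>{s+1..s+l}. edge_weight (ed s) (ed t))"
      using sum.shift_bounds_cl_nat_ivl[of "\<lambda>t. edge_weight (ed s) (ed t)" 1 s l]
      by (simp add: add.commute)
  qed
  also have "\<dots> \<le> (\<Sum>s<2*l. \<Sum>t<2*l. edge_weight (ed s) (ed t))"
    by (intro double_sum_mono_set edge_weight_nonneg) auto
  also have "\<dots> = (\<Sum>e\<in>ed ` {..<2*l}. \<Sum>e'\<in>ed ` {..<2*l}. edge_weight e e')"
    using inj_ed by (simp add: sum.reindex)
  also have "\<dots> \<le> (\<Sum>e\<in>G. \<Sum>e'\<in>G. edge_weight e e')"
  proof -
    have "ed ` {..<2*l} \<subseteq> G" using \<gamma> by (auto simp: ed_def)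
    then show ?thesis using G by (intro double_sum_mono_set edge_weight_nonneg) auto
  qed
  finally show ?thesis .
qed

text \<open>Up to constants the variances are of order \<open>l\<^sup>2 * H\<close> and the squared
  mean shift of order \<open>l\<^sup>2 * H\<^sup>2\<close>, with \<open>H\<close> the harmonic
  number of \<open>l\<close>. Both error probabilities are therefore of order \<open>1 / H\<close>,
  and \<open>H\<close> diverges.\<close>

lemma block_test:
  fixes r \<epsilon> :: real
  assumes r: "0 < r" "r < 1" and \<epsilon>: "0 < \<epsilon>"
  obtains L :: nat and T :: real where "L \<ge> 1"
    "\<And>b. bexp (block_edges L b) (\<lambda>_. r)
        (\<lambda>A. of_bool (T \<le> quad_form (block_edges L b) edge_weight r A)) \<le> \<epsilon>"
    "\<And>b G. G \<subseteq> block_edges L b \<Longrightarrow> has_run L G \<Longrightarrow>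
      bexp (block_edges L b) (\<lambda>e. if e \<in> G then 1 else r)
        (\<lambda>A. of_bool (quad_form (block_edges L b) edge_weight r A < T)) \<le> \<epsilon>"
proof -
  define s where "s = (1 - r)\<^sup>2"
  have s: "0 < s" "s \<le> 1" using r by (auto simp: s_def power_le_one)
  \<comment> \<open>The numerator exceeds both totals that arise below, namely 1584000 and 9984 +
    4752000.\<close>
  define C where "C = 5000000 / (s\<^sup>2 * \<epsilon>)"
  have "filterlim (harm :: nat \<Rightarrow> real) at_top sequentially" by (rule harm_at_top)
  then have "eventually (\<lambda>n. C \<le> harm n) sequentially" by (simp add: filterlim_at_top)
  then obtain l where l: "l \<ge> 1" "C \<le> harm l"
    by (metis eventually_sequentially le_add1 le_add2)
  define H :: real where "H = harm l"
  have H1: "H \<ge> 1" unfolding H_def by (rule harm_ge_one[OF l(1)])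
  have l0: "real l \<ge> 1" using l by simp
  have HC: "5000000 / (s\<^sup>2 * H) \<le> \<epsilon>"
  proof -
    have "5000000 \<le> H * (s\<^sup>2 * \<epsilon>)"
      using l(2) s \<epsilon> by (simp add: C_def H_def pos_divide_le_eq)
    then show ?thesis using s H1 by (simp add: pos_divide_le_eq mult_ac)
  qed
  let ?L = "2 * l"
  let ?J = "\<lambda>b. block_edges ?L b"
  \<comment> \<open>From \<open>6 * ?L + 1 \<le> 13 * l\<close> and a harmonic number of at most
    \<open>13 * H\<close>; the product of \<open>13\<^sup>2\<close>, 8 and 13 is 17576.\<close>
  define S where "S = 22000 * (real l)\<^sup>2 * H"
  have S: "(\<Sum>e\<in>?J b. \<Sum>e'\<in>?J b. (edge_weight e e')\<^sup>2) \<le> S" for b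
  proof -
    have "(\<Sum>e\<in>?J b. \<Sum>e'\<in>?J b. (edge_weight e e')\<^sup>2) \<le> (6 * real ?L + 1)\<^sup>2 * (8 * harm (Suc (6 * ?L)))"
      by (rule edge_weight_square_sum)
    also have "\<dots> \<le> (13 * real l)\<^sup>2 * (8 * (13 * H))"
    proof (intro mult_mono power_mono)
      have "harm (Suc (6 * ?L)) \<le> (harm (l + 12 * l) :: real)"
        using l by (intro harm_mono) auto
      also have "\<dots> \<le> harm l + real (12 * l) / real l" by (rule harm_add_le[OF l(1)])
      also have "\<dots> \<le> 13 * H" using H1 l0 by (simp add: H_def)
      finally show "harm (Suc (6 * ?L)) \<le> 13 * H" .
    qed (use l0 in \<open>auto simp: harm_nonneg\<close>)
    also have "\<dots> \<le> S" using H1 by (simp add: S_def power_mult_distrib)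
    finally show ?thesis .
  qed
  have S0: "0 \<le> S" using H1 by (simp add: S_def)
  \<comment> \<open>Half of the smallest mean shift that a run of length \<open>2 * l\<close> can
    cause.\<close>
  define T where "T = s * (real l * H / 6)"
  have T0: "0 < T" using s l0 H1 by (simp add: T_def)
  show thesis
  proof (rule that[of ?L T])
    show "?L \<ge> 1" using l by simp
    fix b
    have "bexp (?J b) (\<lambda>_. r) (\<lambda>A. of_bool (T \<le> quad_form (?J b) edge_weight r A)) \<le>
        2 * (\<Sum>e\<in>?J b. \<Sum>e'\<in>?J b. (edge_weight e e')\<^sup>2) / T\<^sup>2"
      using r T0 by (intro quad_form_null_bound finite_block_edges edge_weight_commute) auto
    also have "\<dots> \<le> 2 * S / T\<^sup>2" using S by (intro divide_right_mono mult_left_mono) auto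
    also have "\<dots> = 1584000 / (s\<^sup>2 * H)"
      using l0 H1 s by (simp add: S_def T_def field_simps power2_eq_square)
    also have "\<dots> \<le> 5000000 / (s\<^sup>2 * H)" using H1 s by (intro divide_right_mono) auto
    also note HC
    finally show "bexp (?J b) (\<lambda>_. r) (\<lambda>A. of_bool (T \<le> quad_form (?J b) edge_weight r A)) \<le> \<epsilon>" .
    fix G assume G: "G \<subseteq> ?J b" and run: "has_run ?L G"
    have finG: "finite G" using G finite_block_edges finite_subset by blast
    define m where "m = (1 - r)\<^sup>2 * (\<Sum>e\<in>G. \<Sum>e'\<in>G. edge_weight e e')"
    have m: "s * (real l * H / 3) \<le> m"
      unfolding m_def s_def[symmetric] H_def using s run_weight[OF finG l(1) run] by (intro mult_left_mono) auto
    have mT: "2 * T \<le> m" using m by (simp add: T_def mult_ac)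
    have "bexp (?J b) (\<lambda>e. if e \<in> G then 1 else r) (\<lambda>A. of_bool (quad_form (?J b) edge_weight r A < T)) \<le>
        32 * (8 * (6 * real ?L + 1)) / m + 24 * (\<Sum>e\<in>?J b. \<Sum>e'\<in>?J b. (edge_weight e e')\<^sup>2) / m\<^sup>2"
      by (rule quad_form_planted_bound[OF finite_block_edges G edge_weight_commute edge_weight_same
            edge_weight_nonneg edge_weight_convolution edge_weight_row_sum _ _ T0 mT m_def])
        (use r in auto)
    also have "\<dots> \<le> 32 * (104 * real l) / (s * (real l * H / 3)) + 24 * S / (s * (real l * H / 3))\<^sup>2"
      using S[of b] l0 H1 s m S0
      by (intro add_mono frac_le power_mono mult_left_mono) auto
    also have "\<dots> = 9984 / (s * H) + 4752000 / (s\<^sup>2 * H)"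
      using l0 H1 s by (simp add: S_def field_simps power2_eq_square)
    also have "\<dots> \<le> 9984 / (s\<^sup>2 * H) + 4752000 / (s\<^sup>2 * H)"
      using s H1 by (intro add_right_mono divide_left_mono mult_right_mono) (auto simp: power2_eq_square mult_le_one)
    also have "\<dots> \<le> 5000000 / (s\<^sup>2 * H)"
      unfolding add_divide_distrib[symmetric] using H1 s by (intro divide_right_mono) auto
    also note HC
    finally show "bexp (?J b) (\<lambda>e. if e \<in> G then 1 else r)
        (\<lambda>A. of_bool (quad_form (?J b) edge_weight r A < T)) \<le> \<epsilon>" .
  qed
qed

section \<open>Coarse graining of lattice paths\<close>

definition box_of :: "nat \<Rightarrow> vertex \<Rightarrow> int \<times> int" where
  "box_of L v = (fst v div int L, snd v div int L)"

abbreviation king_steps :: "(int \<times> int) set" where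
  "king_steps \<equiv> {-1, 0, 1} \<times> {-1, 0, 1}"

fun king_walk :: "int \<times> int \<Rightarrow> (int \<times> int) list \<Rightarrow> (int \<times> int) list" where
  "king_walk b [] = [b]"
| "king_walk b (d # ds) = b # king_walk (b + d) ds"

text \<open>On reaching \<open>u\<close>, step to \<open>u + d\<close> and straight back by
  \<open>- d\<close>. The rest of the walk is unchanged, so one more site costs two steps.\<close>

lemma king_walk_detour:
  assumes "u \<in> set (king_walk b ds)" "d \<in> king_steps" "set ds \<subseteq> king_steps"
  shows "\<exists>ds'. set ds' \<subseteq> king_steps \<and> length ds' = length ds + 2 \<and>
    set (king_walk b ds') = insert (u + d) (set (king_walk b ds))"
  using assms(1,3)
proof (induction ds arbitrary: b)
  case Nil
  then show ?case using assms(2) by (intro exI[of _ "[d, - d]"]) auto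
next
  case (Cons c ds)
  show ?case
  proof (cases "u = b")
    case True
    then show ?thesis using Cons.prems assms(2)
      by (intro exI[of _ "d # - d # c # ds"]) auto
  next
    case False
    then have "u \<in> set (king_walk (b + c) ds)" using Cons.prems by simp
    from Cons.IH[OF this] Cons.prems(2) obtain ds' where "set ds' \<subseteq> king_steps" "length ds' = length ds + 2"
      "set (king_walk (b + c) ds') = insert (u + d) (set (king_walk (b + c) ds))"
      by auto
    then show ?thesis using Cons.prems by (intro exI[of _ "c # ds'"]) auto
  qed
qed

text \<open>The walk around a spanning tree of \<open>K\<close> boxes has \<open>2 * (K - 1)\<close>
  steps. Encoding the set of boxes by such a walk, with nine choices per step, keeps the count
  exponential in \<open>K\<close>.\<close>

definition patterns :: "int \<times> int \<Rightarrow> nat \<Rightarrow> (int \<times> int) set set" where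
  "patterns b K = (\<lambda>ds. set (king_walk b ds)) ` {ds. set ds \<subseteq> king_steps \<and> length ds = 2 * (K - 1)}"

lemma finite_king_lists: "finite {ds. set ds \<subseteq> king_steps \<and> length ds = n}"
  by (rule finite_lists_length_eq) simp

lemma finite_patterns: "finite (patterns b K)"
  unfolding patterns_def by (intro finite_imageI finite_king_lists)

lemma finite_pattern: "A \<in> patterns b K \<Longrightarrow> finite A"
  by (auto simp: patterns_def)

lemma card_patterns: "card (patterns b K) \<le> 81 ^ K"
proof -
  have "card (patterns b K) \<le> card {ds. set ds \<subseteq> king_steps \<and> length ds = 2 * (K - 1)}"
    unfolding patterns_def by (rule card_image_le[OF finite_king_lists])
  also have "\<dots> = card king_steps ^ (2 * (K - 1))" by (rule card_lists_length_eq) simp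
  also have "card king_steps = 9" by (simp add: card_cartesian_product)
  also have "(9::nat) ^ (2 * (K - 1)) = 81 ^ (K - 1)" by (simp add: power_mult)
  also have "\<dots> \<le> 81 ^ K" by (intro power_increasing) auto
  finally show ?thesis .
qed

text \<open>Only a visit to a new site lengthens the encoding walk, by a detour from the previous
  site. Its length thus depends on the number of distinct sites and not on \<open>n\<close>.\<close>

lemma walk_pattern:
  assumes "\<And>t. t < n \<Longrightarrow> f (Suc t) - f t \<in> king_steps"
  shows "f ` {..n} \<in> patterns (f 0) (card (f ` {..n}))"
  using assms
proof (induction n)
  case 0
  show ?case unfolding patterns_def by (rule image_eqI[of _ _ "[]"]) simp_all
next
  case (Suc n)
  then have IH: "f ` {..n} \<in> patterns (f 0) (card (f ` {..n}))" by simp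
  have eq: "f ` {..Suc n} = insert (f (Suc n)) (f ` {..n})" by (simp add: atMost_Suc)
  show ?case
  proof (cases "f (Suc n) \<in> f ` {..n}")
    case True
    then show ?thesis using IH by (simp add: eq insert_absorb)
  next
    case False
    obtain ds where ds: "set ds \<subseteq> king_steps" "length ds = 2 * (card (f ` {..n}) - 1)"
        "set (king_walk (f 0) ds) = f ` {..n}"
      using IH by (auto simp: patterns_def)
    have "f n \<in> set (king_walk (f 0) ds)" using ds by auto
    from king_walk_detour[OF this Suc.prems[of n] ds(1)]
    obtain ds' where ds': "set ds' \<subseteq> king_steps" "length ds' = length ds + 2"
        "set (king_walk (f 0) ds') = insert (f (Suc n)) (f ` {..n})"
      using ds(3) by auto
    have "2 * (card (f ` {..n}) - 1) + 2 = 2 * (card (f ` {..Suc n}) - 1)"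
    proof -
      have "0 < card (f ` {..n})" by (simp add: card_gt_0_iff)
      then show ?thesis using False by (simp add: eq)
    qed
    then have "length ds' = 2 * (card (f ` {..Suc n}) - 1)" using ds(2) ds'(2) by simp
    then show ?thesis
      unfolding patterns_def using ds' eq by (intro image_eqI[of _ _ ds']) simp_all
  qed
qed

lemma div_step:
  fixes a b :: int
  assumes "\<bar>a - b\<bar> \<le> 1" "L \<ge> 1"
  shows "a div int L - b div int L \<in> {-1, 0, 1}"
proof -
  have "a div int L \<le> (b + int L) div int L" by (rule zdiv_mono1) (use assms in auto)
  moreover have "(b - int L) div int L \<le> a div int L" by (rule zdiv_mono1) (use assms in auto)
  moreover have "(b + int L) div int L = b div int L + 1"
    using assms by simp
  moreover have "(b - int L) div int L = b div int L - 1"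
    using assms div_mult_self1[of "int L" b "-1"] by simp
  ultimately show ?thesis by auto
qed

text \<open>Distinct indices congruent modulo 3 differ by at least 3 in some coordinate, which is
  the width of a block in boxes.\<close>

definition separated :: "(int \<times> int) set \<Rightarrow> bool" where
  "separated B \<longleftrightarrow> (\<forall>b\<in>B. \<forall>c\<in>B. fst b mod 3 = fst c mod 3 \<and> snd b mod 3 = snd c mod 3)"

text \<open>Pigeonhole over the nine pairs of residues modulo 3.\<close>

lemma exists_separated_subset:
  assumes "finite A"
  shows "\<exists>B\<subseteq>A. card A \<le> 9 * card B \<and> separated B"
proof (rule ccontr)
  assume *: "\<not> ?thesis"
  define cls where "cls c = {b \<in> A. (fst b mod 3, snd b mod 3) = c}" for c
  let ?C = "{0, 1, 2::int} \<times> {0, 1, 2::int}"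
  have "9 * card (cls c) < card A" for c
  proof -
    have "separated (cls c)" "cls c \<subseteq> A" by (auto simp: separated_def cls_def)
    then show ?thesis using * by (meson not_le)
  qed
  then have "(\<Sum>c\<in>?C. 9 * card (cls c)) < (\<Sum>c\<in>?C. card A)"
    by (intro sum_strict_mono) auto
  then have "(\<Sum>c\<in>?C. card (cls c)) < card A"
    by (simp add: card_cartesian_product sum_distrib_left[symmetric])
  moreover have "A = (\<Union>c\<in>?C. cls c)"
  proof -
    have "x mod 3 \<in> {0, 1, 2}" for x :: int by (simp, presburger)
    then show ?thesis unfolding cls_def by blast
  qed
  then have "card A \<le> (\<Sum>c\<in>?C. card (cls c))"
    by (metis card_UN_le finite.emptyI finite.insertI finite_cartesian_product)
  ultimately show False by simp
qed

text \<open>The choice depends on the set of boxes alone, not on the path that visits it; otherwise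
  the union bound over patterns would have to count paths.\<close>

definition thinning :: "(int \<times> int) set \<Rightarrow> (int \<times> int) set" where
  "thinning A = (SOME B. B \<subseteq> A \<and> card A \<le> 9 * card B \<and> separated B)"

lemma thinning:
  assumes "finite A"
  shows "thinning A \<subseteq> A" "card A \<le> 9 * card (thinning A)" "separated (thinning A)"
  using someI_ex[of "\<lambda>B. B \<subseteq> A \<and> card A \<le> 9 * card B \<and> separated B"] exists_separated_subset[OF assms]
  unfolding thinning_def by blast+

lemma separated_block_edges:
  assumes "separated B"
  shows "disjoint_family_on (block_edges L) B"
  unfolding disjoint_family_on_def
proof (intro ballI impI)
  have int_dist: "y \<ge> x + 3 \<or> x \<ge> y + 3" if "x mod 3 = y mod 3" "x \<noteq> y" for x y :: int
    using that by presburger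
  have disj: "{(x - 1) * int L..<(x + 2) * int L} \<inter> {(y - 1) * int L..<(y + 2) * int L} = {}"
    if "x mod 3 = y mod 3" "x \<noteq> y" for x y :: int
  proof -
    have "(x + 2) * int L \<le> (y - 1) * int L \<or> (y + 2) * int L \<le> (x - 1) * int L"
      using int_dist[OF that] by (auto intro!: mult_right_mono)
    then show ?thesis by auto
  qed
  fix b c assume bc: "b \<in> B" "c \<in> B" "b \<noteq> c"
  then have "fst b mod 3 = fst c mod 3" "snd b mod 3 = snd c mod 3"
    using assms unfolding separated_def by blast+
  note * = disj[OF this(1)] disj[OF this(2)]
  have "fst b \<noteq> fst c \<or> snd b \<noteq> snd c" using bc by (simp add: prod_eq_iff)
  then have "block L b \<inter> block L c = {}"
    unfolding block_def Times_Int_Times by (elim disjE) (simp_all only: * Times_empty simp_thms)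
  then show "block_edges L b \<inter> block_edges L c = {}"
    by (auto simp: block_edges_def E2_def)
qed

section \<open>Lattice paths and the boxes they visit\<close>

definition lattice_path :: "nat \<Rightarrow> (nat \<Rightarrow> vertex) \<Rightarrow> bool" where
  "lattice_path N \<gamma> \<longleftrightarrow> (\<forall>t<N. {\<gamma> t, \<gamma> (Suc t)} \<in> E2)"

definition path_edges :: "nat \<Rightarrow> (nat \<Rightarrow> vertex) \<Rightarrow> edge set" where
  "path_edges N \<gamma> = (\<lambda>t. {\<gamma> t, \<gamma> (Suc t)}) ` {..<N}"

lemma card_path_edges: "inj_on \<gamma> {..N} \<Longrightarrow> card (path_edges N \<gamma>) = N"
  unfolding path_edges_def using card_image[OF inj_on_path_edges] by simp

lemma lattice_path_step:
  assumes "lattice_path N \<gamma>" "t < N"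
  shows "\<bar>fst (\<gamma> t) - fst (\<gamma> (Suc t))\<bar> \<le> 1" "\<bar>snd (\<gamma> t) - snd (\<gamma> (Suc t))\<bar> \<le> 1"
proof -
  have "{\<gamma> t, \<gamma> (Suc t)} \<in> E2" using assms by (simp add: lattice_path_def)
  then show "\<bar>fst (\<gamma> t) - fst (\<gamma> (Suc t))\<bar> \<le> 1" "\<bar>snd (\<gamma> t) - snd (\<gamma> (Suc t))\<bar> \<le> 1"
    unfolding E2_iff by linarith+
qed

lemma lattice_path_dist:
  assumes "lattice_path N \<gamma>" "t + d \<le> N"
  shows "\<bar>fst (\<gamma> t) - fst (\<gamma> (t + d))\<bar> \<le> int d" "\<bar>snd (\<gamma> t) - snd (\<gamma> (t + d))\<bar> \<le> int d"
  using assms(2)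
proof (induction d)
  case (Suc d)
  { case 1 then show ?case using Suc.IH lattice_path_step[OF assms(1), of "t + d"] by simp }
  { case 2 then show ?case using Suc.IH lattice_path_step[OF assms(1), of "t + d"] by simp }
qed auto

lemma lattice_path_pattern:
  assumes "lattice_path N \<gamma>" "L \<ge> 1"
  shows "box_of L ` \<gamma> ` {..N} \<in> patterns (box_of L (\<gamma> 0)) (card (box_of L ` \<gamma> ` {..N}))"
proof -
  have "(\<lambda>t. box_of L (\<gamma> t)) ` {..N} \<in>
      patterns (box_of L (\<gamma> 0)) (card ((\<lambda>t. box_of L (\<gamma> t)) ` {..N}))"
  proof (rule walk_pattern)
    fix t assume t: "t < N"
    show "box_of L (\<gamma> (Suc t)) - box_of L (\<gamma> t) \<in> king_steps"
      using div_step[OF _ assms(2)] lattice_path_step[OF assms(1) t]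
      unfolding box_of_def diff_Pair mem_Times_iff fst_conv snd_conv by (simp add: abs_minus_commute)
  qed
  then show ?thesis by (simp add: image_image)
qed

lemma finite_box: "L \<ge> 1 \<Longrightarrow> {v. box_of L v = b} = {fst b * int L..<(fst b + 1) * int L} \<times> {snd b * int L..<(snd b + 1) * int L}"
proof -
  assume L: "L \<ge> 1"
  have "x div int L = c \<longleftrightarrow> c * int L \<le> x \<and> x < (c + 1) * int L" for x c
  proof
    assume "x div int L = c"
    moreover have "x = x div int L * int L + x mod int L" "0 \<le> x mod int L" "x mod int L < int L"
      using L by simp_all
    ultimately show "c * int L \<le> x \<and> x < (c + 1) * int L"
      by (simp add: distrib_right)
  next
    assume "c * int L \<le> x \<and> x < (c + 1) * int L"
    then show "x div int L = c"
      by (intro int_div_pos_eq[of _ _ _ "x - c * int L"]) (auto simp: algebra_simps)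
  qed
  then show ?thesis by (auto simp: box_of_def prod_eq_iff)
qed

text \<open>The \<open>N + 1\<close> vertices are distinct, and a box holds only
  \<open>L\<^sup>2\<close> of them.\<close>

lemma card_boxes:
  assumes inj: "inj_on \<gamma> {..N}" and L: "L \<ge> 1"
  shows "N + 1 \<le> card (box_of L ` \<gamma> ` {..N}) * L\<^sup>2"
proof -
  let ?A = "box_of L ` \<gamma> ` {..N}"
  have c: "card {v. box_of L v = b} = L\<^sup>2" "finite {v. box_of L v = b}" for b
    unfolding finite_box[OF L] by (simp_all add: card_cartesian_product algebra_simps power2_eq_square)
  have "N + 1 = card (\<gamma> ` {..N})" using card_image[OF inj] by simp
  also have "\<dots> \<le> card (\<Union>b\<in>?A. {v. box_of L v = b})"
    using c by (intro card_mono) auto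
  also have "\<dots> \<le> (\<Sum>b\<in>?A. card {v. box_of L v = b})" by (intro card_UN_le) auto
  also have "\<dots> = card ?A * L\<^sup>2" by (simp add: c)
  finally show ?thesis .
qed

text \<open>From a visit of the box at time \<open>i\<close>, the next \<open>L\<close> steps stay
  in the block. Near the end of the path the preceding \<open>L\<close> steps are taken instead, in
  reversed order.\<close>

lemma has_run_path:
  assumes path: "lattice_path N \<gamma>" and inj: "inj_on \<gamma> {..N}" and N: "2 * L \<le> N" and L: "L \<ge> 1"
    and b: "b \<in> box_of L ` \<gamma> ` {..N}"
  shows "has_run L (block_edges L b \<inter> path_edges N \<gamma>)"
proof -
  obtain i where i: "i \<le> N" "box_of L (\<gamma> i) = b" using b by auto
  then have \<gamma>i: "\<gamma> i \<in> {fst b * int L..<(fst b + 1) * int L} \<times> {snd b * int L..<(snd b + 1) * int L}"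
    using finite_box[OF L, of b] by auto
  have blk: "v \<in> block L b" if "\<bar>fst (\<gamma> i) - fst v\<bar> \<le> int L" "\<bar>snd (\<gamma> i) - snd v\<bar> \<le> int L" for v
    using that \<gamma>i by (auto simp: block_def mem_Times_iff algebra_simps)
  show ?thesis
  proof (cases "i + L \<le> N")
    case True
    have in_blk: "\<gamma> (i + t) \<in> block L b" if "t \<le> L" for t
      using lattice_path_dist[OF path, of i t] that True by (intro blk) auto
    show ?thesis unfolding has_run_def
    proof (intro exI[of _ "\<lambda>t. \<gamma> (i + t)"] conjI allI impI)
      show "inj_on (\<lambda>t. \<gamma> (i + t)) {..L}"
        by (rule inj_onI, drule inj_onD[OF inj]) (use True in auto)
      fix t assume t: "t < L"
      then show "{\<gamma> (i + t), \<gamma> (i + Suc t)} \<in> E2 \<inter> (block_edges L b \<inter> path_edges N \<gamma>)"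
        using True path in_blk[of t] in_blk[of "Suc t"]
        by (auto simp: block_edges_def lattice_path_def path_edges_def)
    qed
  next
    case False
    \<comment> \<open>This is where a length of at least \<open>2 * L\<close> is needed: there is
      room on at least one side of \<open>i\<close>.\<close>
    then have iL: "L \<le> i" using N by simp
    have in_blk: "\<gamma> (i - t) \<in> block L b" if "t \<le> L" for t
      using lattice_path_dist[OF path, of "i - t" t] that iL i by (intro blk) (auto simp: abs_minus_commute)
    show ?thesis unfolding has_run_def
    proof (intro exI[of _ "\<lambda>t. \<gamma> (i - t)"] conjI allI impI)
      show "inj_on (\<lambda>t. \<gamma> (i - t)) {..L}"
        by (rule inj_onI, drule inj_onD[OF inj]) (use iL i in auto)
      fix t assume t: "t < L"
      have s: "i - t = Suc (i - Suc t)" "i - Suc t < N" using t iL i by auto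
      then have "{\<gamma> (i - Suc t), \<gamma> (i - t)} \<in> E2 \<inter> path_edges N \<gamma>"
        using path unfolding s(1) by (auto simp: lattice_path_def path_edges_def)
      then show "{\<gamma> (i - t), \<gamma> (i - Suc t)} \<in> E2 \<inter> (block_edges L b \<inter> path_edges N \<gamma>)"
        using t in_blk[of t] in_blk[of "Suc t"]
        by (auto simp: block_edges_def insert_commute)
    qed
  qed
qed

section \<open>A test separating planted paths from noise\<close>

lemma quad_form_restrict: "quad_form J V r (A \<inter> J) = quad_form J V r A"
  unfolding quad_form_def by (intro sum.cong refl) auto

text \<open>\<open>Good\<close> is defined through patterns in a fixed finite region
  \<open>U\<close>, so its failure is estimated once for all paths, by Markov's inequality for the
  product \<open>F\<close> of rewards. On \<open>Good\<close>, the indicator is at most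
  \<open>324 ^ K\<close> times the product of \<open>1 / f\<close>, whose mean under the planted law
  is small for every single path. Disjoint blocks factorise both means.\<close>

lemma saw_test:
  fixes r :: real
  assumes r: "0 < r" "r < 1"
  obtains \<rho> :: real and N\<^sub>0 :: nat and U :: "nat \<Rightarrow> vertex \<Rightarrow> edge set"
    and Good :: "nat \<Rightarrow> vertex \<Rightarrow> edge set \<Rightarrow> bool"
  where "0 < \<rho>" "\<rho> < 1" "\<And>N x. finite (U N x)" "\<And>N x. U N x \<subseteq> E2"
    "\<And>N x A. Good N x (A \<inter> U N x) \<longleftrightarrow> Good N x A"
    "\<And>N x. bexp (U N x) (\<lambda>_. r) (\<lambda>A. of_bool (\<not> Good N x A)) \<le> real (N + 2) * \<rho> ^ N"
    "\<And>N x \<gamma>. N \<ge> N\<^sub>0 \<Longrightarrow> \<gamma> 0 = x \<Longrightarrow> inj_on \<gamma> {..N} \<Longrightarrow> lattice_path N \<gamma> \<Longrightarrow>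
      bexp (U N x \<union> path_edges N \<gamma>) (\<lambda>_. r) (\<lambda>A. of_bool (path_edges N \<gamma> \<subseteq> A \<and> Good N x A)) \<le> (r * \<rho>) ^ N"
proof -
  \<comment> \<open>There are at most \<open>81 ^ K\<close> patterns of \<open>K\<close> boxes and each box costs a factor at most \<open>2\<close>, so the
    threshold \<open>324 ^ K\<close> below is exceeded with probability at most \<open>2 powr -K\<close>; the thinning keeps one box
    in nine, so \<open>\<delta>\<close> beats this threshold by another factor \<open>2 powr -K\<close>.\<close>
  define \<delta> :: real where "\<delta> = (1 / 648) ^ 9"
  define \<Lambda> where "\<Lambda> = 2 / \<delta>"
  have \<delta>: "0 < \<delta>" "\<Lambda> > 0" "\<Lambda> * (\<delta> / 2) = 1" by (auto simp: \<delta>_def \<Lambda>_def)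
  obtain L T where L: "L \<ge> 1"
    and null: "\<And>b. bexp (block_edges L b) (\<lambda>_. r)
        (\<lambda>A. of_bool (T \<le> quad_form (block_edges L b) edge_weight r A)) \<le> \<delta> / 2"
    and planted: "\<And>b G. G \<subseteq> block_edges L b \<Longrightarrow> has_run L G \<Longrightarrow>
      bexp (block_edges L b) (\<lambda>e. if e \<in> G then 1 else r)
        (\<lambda>A. of_bool (quad_form (block_edges L b) edge_weight r A < T)) \<le> \<delta> / 2"
    using block_test[OF r, of "\<delta> / 2"] \<delta>(1) by (metis half_gt_zero)
  let ?J = "block_edges L"
  let ?X = "\<lambda>b. quad_form (?J b) edge_weight r"
  let ?w = "\<lambda>G e. if e \<in> G then 1 else r"
  \<comment> \<open>The reward is large when the block test fires: its mean is at most 2 under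
    noise, while its reciprocal has mean at most \<delta> once a run is planted.\<close>
  define f where "f b A = 1 + \<Lambda> * of_bool (T \<le> ?X b A)" for b A
  have f_pos: "f b A > 0" for b A using \<delta>(2) by (auto simp: f_def)
  have f_nonneg: "f b A \<ge> 0" for b A using f_pos by (rule less_imp_le)
  have f_restrict: "f b (A \<inter> ?J b) = f b A" for b A by (simp add: f_def quad_form_restrict)
  have f_null: "bexp (?J b) (\<lambda>_. r) (f b) \<le> 2" for b
  proof -
    have "bexp (?J b) (\<lambda>_. r) (f b) =
        1 + \<Lambda> * bexp (?J b) (\<lambda>_. r) (\<lambda>A. of_bool (T \<le> ?X b A))"
      unfolding f_def by (simp add: bexp_add bexp_cmult bexp_const finite_block_edges)
    also have "\<dots> \<le> 1 + \<Lambda> * (\<delta> / 2)" using null[of b] \<delta>(2) by (intro add_left_mono mult_left_mono) auto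
    finally show ?thesis using \<delta>(3) by simp
  qed
  have f_planted: "bexp (?J b) (?w G) (\<lambda>A. 1 / f b A) \<le> \<delta>"
    if "has_run L (?J b \<inter> G)" for b G
  proof -
    have "bexp (?J b) (?w G) (\<lambda>A. 1 / f b A) \<le>
      bexp (?J b) (?w G) (\<lambda>A. \<delta> / 2 + of_bool (?X b A < T))"
    proof (rule bexp_mono)
      fix A
      have "1 / (1 + \<Lambda>) \<le> 1 / \<Lambda>" using \<delta>(2) by (intro frac_le) auto
      also have "1 / \<Lambda> = \<delta> / 2" by (simp add: \<Lambda>_def)
      finally show "1 / f b A \<le> \<delta> / 2 + of_bool (?X b A < T)"
        using \<delta>(1) by (auto simp: f_def)
    qed (use r in auto)
    also have "\<dots> = \<delta> / 2 + bexp (?J b) (?w G)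
        (\<lambda>A. of_bool (?X b A < T))"
      by (simp add: bexp_add bexp_const finite_block_edges)
    also have "bexp (?J b) (?w G)
        (\<lambda>A. of_bool (?X b A < T)) =
      bexp (?J b) (?w (?J b \<inter> G))
        (\<lambda>A. of_bool (?X b A < T))"
      by (intro bexp_cong) auto
    also have "\<dots> \<le> \<delta> / 2" using planted[of "?J b \<inter> G" b] that by simp
    finally show ?thesis by simp
  qed
  \<comment> \<open>Chosen so that a factor 1/2 per visited box becomes a factor \<rho> per step: a
    path with \<open>N + 1\<close> vertices visits at least \<open>(N + 1) / L\<^sup>2\<close>
    boxes.\<close>
  define \<rho> where "\<rho> = root (L\<^sup>2) (1 / 2)"
  have L2: "L\<^sup>2 > 0" using L by simp
  have \<rho>: "0 < \<rho>" "\<rho> < 1" "\<rho> ^ L\<^sup>2 = 1 / 2"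
    using L2 by (auto simp: \<rho>_def real_root_gt_zero real_root_pow_pos2 real_root_lt_1_iff)
  have half_pow: "(1 / 2) ^ K \<le> \<rho> ^ N" if "N + 1 \<le> K * L\<^sup>2" for K N
  proof -
    have "(1 / 2) ^ K = \<rho> ^ (K * L\<^sup>2)" by (simp add: \<rho>(3)[symmetric] power_mult[symmetric] mult.commute)
    also have "\<dots> \<le> \<rho> ^ N" using that \<rho> by (intro power_decreasing) auto
    finally show ?thesis .
  qed
  define F where "F A S = (\<Prod>b\<in>thinning A. f b S)" for A S
  define Ks where "Ks N = {K. N + 1 \<le> K * L\<^sup>2 \<and> K \<le> N + 1}" for N
  \<comment> \<open>Members of \<open>patterns\<close> may consist of fewer than \<open>K\<close>
    boxes; the filter makes \<open>K\<close> the true number, as the powers of \<open>K\<close>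
    below require.\<close>
  define Ps where "Ps N x K = {A \<in> patterns (box_of L x) K. card A = K}" for N :: nat and x K
  define Good where "Good N x S \<longleftrightarrow> (\<forall>K\<in>Ks N. \<forall>A\<in>Ps N x K. F A S \<le> 324 ^ K)" for N x S
  define U where "U N x = (\<Union>K\<in>Ks N. \<Union>A\<in>Ps N x K. \<Union>b\<in>A. ?J b)" for N x
  have finKs: "finite (Ks N)" for N by (rule finite_subset[of _ "{..N+1}"]) (auto simp: Ks_def)
  have finPs: "finite (Ps N x K)" for N x K
    unfolding Ps_def using finite_patterns by simp
  have fin_pat: "finite A" if "A \<in> Ps N x K" for A N x K
    using that finite_pattern[of A "box_of L x" K] by (simp add: Ps_def)
  let ?E = "\<lambda>N x. bexp (U N x) (\<lambda>_. r)"
  have finU: "finite (U N x)" for N x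
    unfolding U_def using finKs finPs fin_pat finite_block_edges by blast
  have UE: "U N x \<subseteq> E2" for N x by (auto simp: U_def block_edges_def)
  have JU: "?J b \<subseteq> U N x" if "K \<in> Ks N" "A \<in> Ps N x K" "b \<in> thinning A" for K N A x b
  proof -
    have "b \<in> A" using thinning(1)[OF fin_pat[OF that(2)]] that(3) by auto
    then show ?thesis using that unfolding U_def by blast
  qed
  have F_restrict: "F A S = F A (S \<inter> U N x)" if "K \<in> Ks N" "A \<in> Ps N x K" for K N A x S
    unfolding F_def
  proof (rule prod.cong[OF refl])
    fix b assume "b \<in> thinning A"
    then have "S \<inter> U N x \<inter> ?J b = S \<inter> ?J b" using JU[OF that, of b] by blast
    then show "f b S = f b (S \<inter> U N x)" using f_restrict by metis
  qed
  have Good_restrict: "Good N x (S \<inter> U N x) \<longleftrightarrow> Good N x S" for N x S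
  proof -
    have "F A (S \<inter> U N x) = F A S" if "K \<in> Ks N" "A \<in> Ps N x K" for K A
      using F_restrict[OF that, of S] by simp
    then show ?thesis unfolding Good_def by simp
  qed
  have disj: "disjoint_family_on ?J (thinning A)" if "A \<in> Ps N x K" for A N x K
    by (rule separated_block_edges[OF thinning(3)[OF fin_pat[OF that]]])
  have fin_thin: "finite (thinning A)" if "A \<in> Ps N x K" for A N x K
    using thinning(1)[OF fin_pat[OF that]] fin_pat[OF that] finite_subset by blast
  have F_pos: "F A S > 0" for A S unfolding F_def by (intro prod_pos f_pos)
  have F_nonneg: "F A S \<ge> 0" for A S using F_pos by (rule less_imp_le)
  have bad: "?E N x (\<lambda>A. of_bool (\<not> Good N x A)) \<le> real (N + 2) * \<rho> ^ N" for N x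
  proof -
    have one: "?E N x (F A) / 324 ^ K \<le> (2 / 324) ^ K" if "K \<in> Ks N" "A \<in> Ps N x K" for K A
    proof -
      have "?E N x (F A) = ?E N x (\<lambda>S. \<Prod>b\<in>thinning A. f b (S \<inter> ?J b))"
        unfolding F_def f_restrict ..
      also have "\<dots> = (\<Prod>b\<in>thinning A. bexp (?J b) (\<lambda>_. r) (f b))"
        by (rule bexp_prod_indep_superset[OF finU fin_thin[OF that(2)] JU[OF that] disj[OF that(2)]])
      also have "\<dots> \<le> (\<Prod>b\<in>thinning A. 2)"
        using f_null f_nonneg r by (intro prod_mono conjI bexp_nonneg) auto
      also have "\<dots> \<le> 2 ^ K"
        using that card_mono[OF fin_pat[OF that(2)] thinning(1)[OF fin_pat[OF that(2)]]]
        by (auto simp: Ps_def intro!: power_increasing)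
      finally show ?thesis unfolding power_divide by (simp only: divide_right_mono zero_le_power zero_le_numeral)
    qed
    have "?E N x (\<lambda>A. of_bool (\<not> Good N x A)) \<le>
        ?E N x (\<lambda>S. \<Sum>K\<in>Ks N. \<Sum>A\<in>Ps N x K. F A S / 324 ^ K)"
    proof (rule bexp_mono)
      fix S
      show "of_bool (\<not> Good N x S) \<le> (\<Sum>K\<in>Ks N. \<Sum>A\<in>Ps N x K. F A S / 324 ^ K)"
      proof (cases "Good N x S")
        case True
        then show ?thesis using F_nonneg by (auto intro!: sum_nonneg)
      next
        case False
        then obtain K A where KA: "K \<in> Ks N" "A \<in> Ps N x K" "324 ^ K < F A S"
          by (auto simp: Good_def not_le)
        have "1 \<le> F A S / 324 ^ K" using KA(3) by simp
        also have "\<dots> \<le> (\<Sum>A\<in>Ps N x K. F A S / 324 ^ K)"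
          using KA finPs F_nonneg by (intro member_le_sum) auto
        also have "\<dots> \<le> (\<Sum>K\<in>Ks N. \<Sum>A\<in>Ps N x K. F A S / 324 ^ K)"
          using KA finKs F_nonneg by (intro member_le_sum[of K]) (auto intro!: sum_nonneg)
        finally show ?thesis using False by simp
      qed
    qed (use r in auto)
    also have "\<dots> = (\<Sum>K\<in>Ks N. \<Sum>A\<in>Ps N x K. ?E N x (F A) / 324 ^ K)"
      by (simp add: bexp_sum bexp_divide)
    also have "\<dots> \<le> (\<Sum>K\<in>Ks N. \<Sum>A\<in>Ps N x K. (2 / 324) ^ K)"
      by (intro sum_mono one)
    also have "\<dots> \<le> (\<Sum>K\<in>Ks N. \<rho> ^ N)"
    proof (rule sum_mono)
      fix K assume K: "K \<in> Ks N"
      have "card (Ps N x K) \<le> 81 ^ K"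
        using card_mono[OF finite_patterns, of "Ps N x K" "box_of L x" K] card_patterns[of "box_of L x" K]
        by (auto simp: Ps_def)
      then have "real (card (Ps N x K)) \<le> 81 ^ K"
        by (metis of_nat_le_iff of_nat_numeral of_nat_power)
      then have "(\<Sum>A\<in>Ps N x K. (2 / 324 :: real) ^ K) \<le> 81 ^ K * (2 / 324) ^ K"
        by (simp add: mult_right_mono)
      also have "\<dots> = (1 / 2) ^ K" by (simp flip: power_mult_distrib)
      also have "\<dots> \<le> \<rho> ^ N" using K by (intro half_pow) (simp add: Ks_def)
      finally show "(\<Sum>A\<in>Ps N x K. (2 / 324 :: real) ^ K) \<le> \<rho> ^ N" .
    qed
    also have "\<dots> = real (card (Ks N)) * \<rho> ^ N" by simp
    also have "\<dots> \<le> real (N + 2) * \<rho> ^ N"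
    proof (intro mult_right_mono of_nat_mono)
      show "card (Ks N) \<le> N + 2" using card_mono[of "{..N+1}" "Ks N"] by (auto simp: Ks_def)
    qed (use \<rho> in auto)
    finally show ?thesis .
  qed
  have good: "bexp (U N x \<union> path_edges N \<gamma>) (\<lambda>_. r)
      (\<lambda>A. of_bool (path_edges N \<gamma> \<subseteq> A \<and> Good N x A)) \<le> (r * \<rho>) ^ N"
    if N: "N \<ge> 2 * L" and \<gamma>: "\<gamma> 0 = x" "inj_on \<gamma> {..N}" "lattice_path N \<gamma>" for N x \<gamma>
  proof -
    let ?G = "path_edges N \<gamma>"
    define A where "A = box_of L ` \<gamma> ` {..N}"
    define K where "K = card A"
    have K: "K \<in> Ks N"
      using card_boxes[OF \<gamma>(2) L] card_image_le[of "{..N}" "\<lambda>t. box_of L (\<gamma> t)"]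
      by (simp add: Ks_def K_def A_def image_image)
    have A: "A \<in> Ps N x K"
      using lattice_path_pattern[OF \<gamma>(3) L] by (simp add: Ps_def K_def A_def \<gamma>(1))
    have finG: "finite ?G" by (simp add: path_edges_def)
    have finUG: "finite (U N x \<union> ?G)" using finU finG by simp
    have "bexp (U N x \<union> ?G) (\<lambda>_. r) (\<lambda>S. of_bool (?G \<subseteq> S \<and> Good N x S)) \<le>
       bexp (U N x \<union> ?G) (\<lambda>_. r) (\<lambda>S. if ?G \<subseteq> S then 324 ^ K * (\<Prod>b\<in>thinning A. 1 / f b S) else 0)"
    proof (rule bexp_mono)
      fix S
      have "1 \<le> 324 ^ K * (\<Prod>b\<in>thinning A. 1 / f b S)" if "Good N x S"
      proof -
        have "F A S \<le> 324 ^ K" using that K A by (auto simp: Good_def)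
        then show ?thesis using F_pos[of A S] by (simp add: F_def prod_dividef pos_le_divide_eq)
      qed
      then show "of_bool (?G \<subseteq> S \<and> Good N x S) \<le>
          (if ?G \<subseteq> S then 324 ^ K * (\<Prod>b\<in>thinning A. 1 / f b S) else 0)"
        using f_nonneg by (auto intro!: mult_nonneg_nonneg prod_nonneg)
    qed (use r in auto)
    \<comment> \<open>The path has \<open>N\<close> distinct edges, so being open costs
      \<open>r ^ N\<close>; what remains is an expectation under the planted product law.\<close>
    also have "\<dots> = r ^ N * (324 ^ K * bexp (U N x \<union> ?G) (?w ?G) (\<lambda>S. \<Prod>b\<in>thinning A. 1 / f b S))"
      using finUG by (subst bexp_condition) (auto simp: bexp_cmult card_path_edges[OF \<gamma>(2)])
    also have "bexp (U N x \<union> ?G) (?w ?G) (\<lambda>S. \<Prod>b\<in>thinning A. 1 / f b S) =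
        bexp (U N x \<union> ?G) (?w ?G) (\<lambda>S. \<Prod>b\<in>thinning A. 1 / f b (S \<inter> ?J b))"
      by (simp add: f_restrict)
    also have "\<dots> = (\<Prod>b\<in>thinning A. bexp (?J b) (?w ?G) (\<lambda>S. 1 / f b S))"
      using JU[OF K A]
      by (intro bexp_prod_indep_superset[where f = "\<lambda>b S. 1 / f b S"] finUG fin_thin[OF A] disj[OF A]) blast
    also have "\<dots> \<le> (\<Prod>b\<in>thinning A. \<delta>)"
    proof (rule prod_mono)
      fix b assume "b \<in> thinning A"
      then have "b \<in> A" using thinning(1)[OF fin_pat[OF A]] by auto
      then have "has_run L (?J b \<inter> ?G)"
        using has_run_path[OF \<gamma>(3,2) N L] by (simp add: A_def)
      then show "0 \<le> bexp (?J b) (?w ?G) (\<lambda>S. 1 / f b S) \<and> bexp (?J b) (?w ?G) (\<lambda>S. 1 / f b S) \<le> \<delta>"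
        using f_planted[of b ?G] r by (intro conjI bexp_nonneg divide_nonneg_nonneg f_nonneg) auto
    qed
    also have "(\<Prod>b\<in>thinning A. \<delta>) = (1 / 648) ^ (9 * card (thinning A))"
      by (simp add: \<delta>_def power_mult)
    also have "\<dots> \<le> (1 / 648) ^ K"
      using thinning(2)[OF fin_pat[OF A]] by (intro power_decreasing) (auto simp: K_def)
    also have "324 ^ K * (1 / 648 :: real) ^ K = (1 / 2) ^ K" by (simp flip: power_mult_distrib)
    also have "(1 / 2) ^ K \<le> \<rho> ^ N" using K by (intro half_pow) (simp add: Ks_def)
    finally show ?thesis using r by (simp add: power_mult_distrib)
  qed
  show thesis
    by (rule that[OF \<rho>(1,2) finU UE Good_restrict bad good]) auto
qed

section \<open>Percolation measures\<close>

lemma prob_space_perc: "prob_space (perc p)"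
  unfolding perc_def by (intro prob_space_PiM measure_pmf.prob_space_axioms)

lemma space_perc: "space (perc p) = E2 \<rightarrow>\<^sub>E UNIV"
  by (simp add: perc_def space_PiM)

lemma measurable_perc_edge [measurable]: "e \<in> E2 \<Longrightarrow> (\<lambda>\<omega>. \<omega> e) \<in> measurable (perc p) (count_space UNIV)"
  unfolding perc_def using measurable_component_singleton[of e E2 "\<lambda>_. measure_pmf (bernoulli_pmf p)"] by simp

abbreviation opens :: "edge set \<Rightarrow> (edge \<Rightarrow> bool) \<Rightarrow> edge set" where
  "opens J \<omega> \<equiv> {e \<in> J. \<omega> e}"

lemma cylinder_iff: "A \<subseteq> J \<Longrightarrow> opens J \<omega> = A \<longleftrightarrow> (\<forall>e\<in>J. \<omega> e \<in> {e \<in> A})"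
  by auto

lemma sets_cylinder [measurable]:
  assumes "finite J" "J \<subseteq> E2"
  shows "{\<omega> \<in> space (perc p). opens J \<omega> = A} \<in> sets (perc p)"
proof (cases "A \<subseteq> J")
  case True
  have *: "{\<omega> \<in> space (perc p). \<omega> e \<in> {e \<in> A}} \<in> sets (perc p)" if "e \<in> J" for e
  proof -
    have "(\<lambda>\<omega>. \<omega> e) -` {e \<in> A} \<inter> space (perc p) \<in> sets (perc p)"
      by (rule measurable_sets[OF measurable_perc_edge]) (use assms that in auto)
    moreover have "(\<lambda>\<omega>. \<omega> e) -` {e \<in> A} \<inter> space (perc p) = {\<omega> \<in> space (perc p). \<omega> e \<in> {e \<in> A}}"
      by blast
    ultimately show ?thesis by metis
  qed
  have "{\<omega> \<in> space (perc p). \<forall>e\<in>J. \<omega> e \<in> {e \<in> A}} \<in> sets (perc p)"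
    by (rule sets.sets_Collect_finite_All[OF * assms(1)])
  then show ?thesis by (simp add: cylinder_iff[OF True])
next
  case False
  then have "{\<omega> \<in> space (perc p). opens J \<omega> = A} = {}" by blast
  then show ?thesis by (metis sets.empty_sets)
qed

lemma prod_emb_perc:
  assumes "J \<subseteq> E2"
  shows "prod_emb E2 (\<lambda>_. measure_pmf (bernoulli_pmf p)) J (Pi\<^sub>E J X) = {\<omega> \<in> space (perc p). \<forall>e\<in>J. \<omega> e \<in> X e}"
  by (auto simp: prod_emb_def space_perc restrict_PiE_iff)

lemma measure_cylinder:
  assumes J: "finite J" "J \<subseteq> E2" and A: "A \<subseteq> J" and p: "0 \<le> p" "p \<le> 1"
  shows "measure (perc p) {\<omega> \<in> space (perc p). opens J \<omega> = A} = (\<Prod>e\<in>A. p) * (\<Prod>e\<in>J - A. 1 - p)"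
proof -
  interpret product_prob_space "\<lambda>_. measure_pmf (bernoulli_pmf p)" E2 ..
  have set_eq: "{\<omega> \<in> space (perc p). opens J \<omega> = A} =
      prod_emb E2 (\<lambda>_. measure_pmf (bernoulli_pmf p)) J (\<Pi>\<^sub>E e\<in>J. {e \<in> A})"
    unfolding cylinder_iff[OF A] prod_emb_perc[OF J(2)] ..
  have "measure (perc p) {\<omega> \<in> space (perc p). opens J \<omega> = A} =
      (\<Prod>e\<in>J. measure (measure_pmf (bernoulli_pmf p)) {e \<in> A})"
    unfolding set_eq unfolding perc_def by (rule measure_PiM_emb[OF J(2,1)]) simp
  also have "\<dots> = (\<Prod>e\<in>J. if e \<in> A then p else 1 - p)"
    using p by (intro prod.cong) (auto simp: measure_pmf_single)
  also have "\<dots> = (\<Prod>e\<in>A. if e \<in> A then p else 1 - p) * (\<Prod>e\<in>J - A. if e \<in> A then p else 1 - p)"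
    by (subst prod.subset_diff[OF A J(1)]) (rule mult.commute)
  also have "(\<Prod>e\<in>A. if e \<in> A then p else 1 - p) = (\<Prod>e\<in>A. p)" by (intro prod.cong) auto
  also have "(\<Prod>e\<in>J - A. if e \<in> A then p else 1 - p) = (\<Prod>e\<in>J - A. 1 - p)" by (intro prod.cong) auto
  finally show ?thesis .
qed

lemma integral_indicator_sets:
  "A \<in> sets M \<Longrightarrow> (\<integral>x. indicator A x \<partial>M) = (measure M A :: real)"
  using sets.sets_into_space[of A M] by (simp add: Int_absorb2)

lemma local_sum_indicator:
  assumes "finite J" "\<omega> \<in> X"
  shows "(f (opens J \<omega>) :: real) = (\<Sum>A\<in>Pow J. f A * indicator {\<omega> \<in> X. opens J \<omega> = A} \<omega>)"
proof -
  have "(\<Sum>A\<in>Pow J. f A * indicator {\<omega> \<in> X. opens J \<omega> = A} \<omega>) =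
      (\<Sum>A\<in>Pow J. if A = opens J \<omega> then f A else 0)"
    using assms(2) by (intro sum.cong) auto
  also have "\<dots> = f (opens J \<omega>)" using assms(1) by (subst sum.delta) auto
  finally show ?thesis by simp
qed

text \<open>The bridge from the infinite product measure to finite sums: a function of finitely many
  edges is a finite combination of cylinder indicators.\<close>

lemma perc_local_expectation:
  assumes J: "finite J" "J \<subseteq> E2" and p: "0 \<le> p" "p \<le> 1"
  shows "integrable (perc p) (\<lambda>\<omega>. f (opens J \<omega>) :: real)"
    and "(\<integral>\<omega>. f (opens J \<omega>) \<partial>perc p) = bexp J (\<lambda>_. p) f"
proof -
  interpret prob_space "perc p" by (rule prob_space_perc)
  let ?C = "\<lambda>A. {\<omega> \<in> space (perc p). opens J \<omega> = A}"
  let ?g = "\<lambda>\<omega>. \<Sum>A\<in>Pow J. f A * indicator (?C A) \<omega>"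
  have C: "?C A \<in> sets (perc p)" for A by (rule sets_cylinder[OF J])
  have I: "integrable (perc p) (\<lambda>\<omega>. f A * indicator (?C A) \<omega>)" for A
    by (intro integrable_mult_right integrable_real_indicator C) (simp add: emeasure_eq_measure)
  have "integrable (perc p) ?g" by (rule Bochner_Integration.integrable_sum) (rule I)
  moreover have f_eq: "f (opens J \<omega>) = ?g \<omega>" if "\<omega> \<in> space (perc p)" for \<omega>
    by (rule local_sum_indicator[OF J(1) that])
  ultimately show "integrable (perc p) (\<lambda>\<omega>. f (opens J \<omega>))"
    by (subst Bochner_Integration.integrable_cong[OF refl f_eq]) auto
  have "(\<integral>\<omega>. f (opens J \<omega>) \<partial>perc p) = (\<integral>\<omega>. ?g \<omega> \<partial>perc p)"
    by (rule Bochner_Integration.integral_cong[OF refl f_eq])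
  also have "\<dots> = (\<Sum>A\<in>Pow J. \<integral>\<omega>. f A * indicator (?C A) \<omega> \<partial>perc p)"
    by (rule Bochner_Integration.integral_sum) (rule I)
  also have "\<dots> = (\<Sum>A\<in>Pow J. f A * measure (perc p) (?C A))"
    unfolding integral_mult_right_zero integral_indicator_sets[OF C] ..
  also have "\<dots> = bexp J (\<lambda>_. p) f"
    unfolding bexp_def using J p by (intro sum.cong refl) (simp add: measure_cylinder)
  finally show "(\<integral>\<omega>. f (opens J \<omega>) \<partial>perc p) = bexp J (\<lambda>_. p) f" .
qed

lemma sets_local:
  assumes J: "finite J" "J \<subseteq> E2"
  shows "{\<omega> \<in> space (perc p). Q (opens J \<omega>)} \<in> sets (perc p)"
proof -
  have "{\<omega> \<in> space (perc p). Q (opens J \<omega>)} =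
      (\<Union>A\<in>{A \<in> Pow J. Q A}. {\<omega> \<in> space (perc p). opens J \<omega> = A})"
    by auto
  also have "\<dots> \<in> sets (perc p)" using J sets_cylinder[OF J] by (intro sets.finite_UN) auto
  finally show ?thesis .
qed

lemma perc_local_prob:
  assumes J: "finite J" "J \<subseteq> E2" and p: "0 \<le> p" "p \<le> 1"
  shows "measure (perc p) {\<omega> \<in> space (perc p). Q (opens J \<omega>)} = bexp J (\<lambda>_. p) (\<lambda>A. of_bool (Q A))"
proof -
  have "measure (perc p) {\<omega> \<in> space (perc p). Q (opens J \<omega>)} =
      (\<integral>\<omega>. indicator {\<omega> \<in> space (perc p). Q (opens J \<omega>)} \<omega> \<partial>perc p)"
    by (rule integral_indicator_sets[symmetric, OF sets_local[OF J]])
  also have "\<dots> = (\<integral>\<omega>. of_bool (Q (opens J \<omega>)) \<partial>perc p)"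
    by (intro Bochner_Integration.integral_cong) auto
  also have "\<dots> = bexp J (\<lambda>_. p) (\<lambda>A. of_bool (Q A))"
    by (rule perc_local_expectation(2)[OF assms])
  finally show ?thesis .
qed

text \<open>An edge survives in the intersection of two independent random sets with the product of
  its weights. This is the finite form of the coupling of two densities.\<close>

lemma bexp_inter:
  assumes "finite J"
  shows "bexp J v (\<lambda>S. bexp J w (\<lambda>R. f (S \<inter> R))) = bexp J (\<lambda>e. v e * w e) f"
  using assms
proof (induction J arbitrary: f rule: finite_induct)
  case (insert k J)
  note k = insert.hyps
  let ?E = "\<lambda>f. bexp J v (\<lambda>S. bexp J w (\<lambda>R. f (S \<inter> R)))"
  have 1: "bexp J v (\<lambda>S. bexp J w (\<lambda>R. f (insert k S \<inter> insert k R))) = ?E (\<lambda>A. f (insert k A))"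
    by simp
  have 2: "bexp J v (\<lambda>S. bexp J w (\<lambda>R. f (insert k S \<inter> R))) = ?E f"
    using k by (intro bexp_cong refl arg_cong[of _ _ f]) auto
  have 3: "bexp J v (\<lambda>S. bexp J w (\<lambda>R. f (S \<inter> insert k R))) = ?E f"
    using k by (intro bexp_cong refl arg_cong[of _ _ f]) auto
  have "bexp (insert k J) v (\<lambda>S. bexp (insert k J) w (\<lambda>R. f (S \<inter> R))) =
    v k * (w k * ?E (\<lambda>A. f (insert k A)) + (1 - w k) * ?E f) +
    (1 - v k) * (w k * ?E f + (1 - w k) * ?E f)"
    unfolding bexp_insert[OF k] bexp_add bexp_cmult 1 2 3 by (simp add: algebra_simps)
  also have "\<dots> = bexp (insert k J) (\<lambda>e. v e * w e) f"
    unfolding bexp_insert[OF k] insert.IH[of f] insert.IH[of "\<lambda>A. f (insert k A)"]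
    by (simp add: algebra_simps)
  finally show ?case .
qed simp

text \<open>Each basic set of the product is a disjoint union of cylinders fixing the states of
  finitely many edges, and the basic sets determine the measure.\<close>

lemma perc_eqI:
  assumes N: "sets N = sets (perc p)" "prob_space N"
    and eq: "\<And>J A. finite J \<Longrightarrow> J \<subseteq> E2 \<Longrightarrow> A \<subseteq> J \<Longrightarrow>
      measure N {\<omega> \<in> space (perc p). opens J \<omega> = A} = measure (perc p) {\<omega> \<in> space (perc p). opens J \<omega> = A}"
  shows "N = perc p"
proof (rule measure_eqI_PiM_infinite)
  interpret N: prob_space N by fact
  interpret P: prob_space "perc p" by (rule prob_space_perc)
  let ?M = "\<lambda>_. measure_pmf (bernoulli_pmf p)"
  show "sets N = sets (PiM E2 ?M)" "sets (perc p) = sets (PiM E2 ?M)"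
    using N by (simp_all add: perc_def)
  show "finite_measure N" by (rule N.finite_measure_axioms)
  fix X and J :: "edge set" assume J: "finite J" "J \<subseteq> E2"
  let ?C = "\<lambda>A. {\<omega> \<in> space (perc p). opens J \<omega> = A}"
  let ?\<A> = "{A \<in> Pow J. \<forall>e\<in>J. (e \<in> A) \<in> X e}"
  have emb: "prod_emb E2 ?M J (Pi\<^sub>E J X) = (\<Union>A\<in>?\<A>. ?C A)"
  proof (rule set_eqI)
    fix \<omega>
    have "\<omega> \<in> prod_emb E2 ?M J (Pi\<^sub>E J X) \<longleftrightarrow> \<omega> \<in> space (perc p) \<and> (\<forall>e\<in>J. \<omega> e \<in> X e)"
      unfolding prod_emb_perc[OF J(2)] by blast
    also have "\<dots> \<longleftrightarrow> \<omega> \<in> (\<Union>A\<in>?\<A>. ?C A)" by auto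
    finally show "\<omega> \<in> prod_emb E2 ?M J (Pi\<^sub>E J X) \<longleftrightarrow> \<omega> \<in> (\<Union>A\<in>?\<A>. ?C A)" .
  qed
  have C: "?C A \<in> sets (perc p)" for A by (rule sets_cylinder[OF J])
  have disj: "disjoint_family_on ?C ?\<A>" by (auto simp: disjoint_family_on_def)
  have fin: "finite ?\<A>" using J by simp
  have "measure N (\<Union>A\<in>?\<A>. ?C A) = (\<Sum>A\<in>?\<A>. measure N (?C A))"
    using C N by (intro N.finite_measure_finite_Union fin disj) auto
  also have "\<dots> = (\<Sum>A\<in>?\<A>. measure (perc p) (?C A))" using eq[OF J] by (intro sum.cong) auto
  also have "\<dots> = measure (perc p) (\<Union>A\<in>?\<A>. ?C A)"
    using C by (intro P.finite_measure_finite_Union[symmetric] fin disj) auto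
  finally show "emeasure N (prod_emb E2 ?M J (Pi\<^sub>E J X)) = emeasure (perc p) (prod_emb E2 ?M J (Pi\<^sub>E J X))"
    unfolding emb by (simp add: N.emeasure_eq_measure P.emeasure_eq_measure)
qed

section \<open>Intersecting, modifying and translating configurations\<close>

definition meet :: "(edge \<Rightarrow> bool) \<times> (edge \<Rightarrow> bool) \<Rightarrow> edge \<Rightarrow> bool" where
  "meet z = (\<lambda>e\<in>E2. fst z e \<and> snd z e)"

lemma measurable_meet [measurable]: "meet \<in> measurable (perc q \<Otimes>\<^sub>M perc r) (perc p)"
proof -
  have "meet \<in> measurable (perc q \<Otimes>\<^sub>M perc r) (PiM E2 (\<lambda>_. measure_pmf (bernoulli_pmf p)))"
    unfolding meet_def
  proof (rule measurable_restrict)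
    fix e assume [measurable]: "e \<in> E2"
    show "(\<lambda>z. fst z e \<and> snd z e) \<in> measurable (perc q \<Otimes>\<^sub>M perc r) (measure_pmf (bernoulli_pmf p))"
      by (simp, measurable)
  qed
  then show ?thesis by (simp add: perc_def)
qed

lemma distr_meet:
  assumes q: "0 \<le> q" "q \<le> 1" and r: "0 \<le> r" "r \<le> 1"
  shows "distr (perc q \<Otimes>\<^sub>M perc r) (perc (q * r)) meet = perc (q * r)"
proof (rule perc_eqI)
  interpret Q: prob_space "perc q" by (rule prob_space_perc)
  interpret R: prob_space "perc r" by (rule prob_space_perc)
  interpret QR: pair_prob_space "perc q" "perc r" ..
  let ?M = "perc q \<Otimes>\<^sub>M perc r"
  let ?D = "distr ?M (perc (q * r)) meet"
  show "sets ?D = sets (perc (q * r))" by simp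
  show "prob_space ?D"
    by (rule QR.prob_space_distr) simp
  fix J A assume J: "finite J" "J \<subseteq> E2" and A: "A \<subseteq> J"
  let ?C = "\<lambda>p A. {\<omega> \<in> space (perc p). opens J \<omega> = A}"
  have C: "?C p A \<in> sets (perc p)" for p A by (rule sets_cylinder[OF J])
  let ?I = "{(S, R) \<in> Pow J \<times> Pow J. S \<inter> R = A}"
  have qr: "0 \<le> q * r" "q * r \<le> 1" using q r by (auto simp: mult_le_one)
  \<comment> \<open>The preimage of a cylinder is a finite disjoint union of rectangles, on which
    the product measure factorises.\<close>
  have pre: "meet -` ?C (q * r) A \<inter> space ?M = (\<Union>(S, R)\<in>?I. ?C q S \<times> ?C r R)"
    (is "?P = ?U")
  proof (rule set_eqI)
    fix z :: "(edge \<Rightarrow> bool) \<times> (edge \<Rightarrow> bool)"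
    obtain \<omega> \<eta> where z: "z = (\<omega>, \<eta>)" by (cases z) blast
    have op: "opens J (meet (\<omega>, \<eta>)) = opens J \<omega> \<inter> opens J \<eta>" using J(2) by (auto simp: meet_def)
    have sp: "meet (\<omega>, \<eta>) \<in> space (perc (q * r))" by (auto simp: meet_def space_perc)
    have "z \<in> ?P \<longleftrightarrow> \<omega> \<in> space (perc q) \<and> \<eta> \<in> space (perc r) \<and> opens J \<omega> \<inter> opens J \<eta> = A"
      by (simp only: vimage_eq Int_iff mem_Collect_eq z op sp simp_thms space_pair_measure mem_Sigma_iff) blast
    also have "\<dots> \<longleftrightarrow> z \<in> ?U"
    proof
      assume "\<omega> \<in> space (perc q) \<and> \<eta> \<in> space (perc r) \<and> opens J \<omega> \<inter> opens J \<eta> = A"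
      then show "z \<in> ?U" unfolding z by (intro UN_I[of "(opens J \<omega>, opens J \<eta>)"]) simp_all
    qed (auto simp: z)
    finally show "z \<in> ?P \<longleftrightarrow> z \<in> ?U" .
  qed
  have "measure ?D (?C (q * r) A) =
      measure ?M ?P"
    by (rule measure_distr) (simp_all only: C measurable_meet)
  also note pre
  also have "measure ?M (\<Union>(S, R)\<in>?I. ?C q S \<times> ?C r R) =
      (\<Sum>(S, R)\<in>?I. measure ?M (?C q S \<times> ?C r R))"
    unfolding case_prod_unfold
    using J C by (intro QR.finite_measure_finite_Union) (auto simp: disjoint_family_on_def)
  also have "\<dots> = (\<Sum>(S, R)\<in>?I. measure (perc q) (?C q S) * measure (perc r) (?C r R))"
  proof (intro sum.cong refl, clarify)
    fix S R
    have "emeasure ?M (?C q S \<times> ?C r R) = emeasure (perc q) (?C q S) * emeasure (perc r) (?C r R)"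
      by (rule R.emeasure_pair_measure_Times[OF C C])
    then show "measure ?M (?C q S \<times> ?C r R) = measure (perc q) (?C q S) * measure (perc r) (?C r R)"
      by (simp add: measure_def enn2real_mult)
  qed
  also have "\<dots> = (\<Sum>(S, R)\<in>?I. ((\<Prod>e\<in>S. q) * (\<Prod>e\<in>J - S. 1 - q)) * ((\<Prod>e\<in>R. r) * (\<Prod>e\<in>J - R. 1 - r)))"
    using measure_cylinder[OF J _ q] measure_cylinder[OF J _ r] by (intro sum.cong refl) auto
  also have "\<dots> = (\<Sum>(S, R)\<in>Pow J \<times> Pow J. ((\<Prod>e\<in>S. q) * (\<Prod>e\<in>J - S. 1 - q)) * ((\<Prod>e\<in>R. r) * (\<Prod>e\<in>J - R. 1 - r)) * of_bool (S \<inter> R = A))"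
    using J by (intro sum.mono_neutral_cong_left) auto
  also have "\<dots> = bexp J (\<lambda>_. q) (\<lambda>S. bexp J (\<lambda>_. r) (\<lambda>R. of_bool (S \<inter> R = A)))"
    unfolding bexp_def sum_distrib_left by (simp add: sum.cartesian_product mult.assoc)
  also have "\<dots> = bexp J (\<lambda>_. q * r) (\<lambda>S. of_bool (S = A))"
    by (rule bexp_inter[OF J(1)])
  also have "\<dots> = measure (perc (q * r)) (?C (q * r) A)"
    by (rule perc_local_prob[OF J qr, symmetric])
  finally show "measure ?D (?C (q * r) A) =
    measure (perc (q * r)) (?C (q * r) A)" .
qed

lemma AE_perc_meet:
  assumes "0 \<le> q" "q \<le> 1" "0 \<le> r" "r \<le> 1" "AE \<omega> in perc (q * r). P \<omega>"
  shows "AE z in perc q \<Otimes>\<^sub>M perc r. P (meet z)"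
proof (rule AE_distrD[OF measurable_meet])
  show "AE \<omega> in distr (perc q \<Otimes>\<^sub>M perc r) (perc (q * r)) meet. P \<omega>"
    unfolding distr_meet[OF assms(1-4)] by (rule assms(5))
qed

text \<open>Finite energy: resampling the state of \<open>e\<close> by an independent coin preserves
  the law, and the coin shows \<open>True\<close> with positive probability.\<close>

lemma AE_perc_open_edge:
  assumes p: "0 < p" "p \<le> 1" and e: "e \<in> E2" and ae: "AE \<omega> in perc p. P \<omega>"
  shows "AE \<omega> in perc p. P (fun_upd \<omega> e True)"
proof -
  let ?B = "measure_pmf (bernoulli_pmf p)"
  interpret pp: prob_space "perc p" by (rule prob_space_perc)
  interpret BP: pair_prob_space ?B "perc p" ..
  have ins: "insert e E2 = E2" using e by auto
  have d: "distr (?B \<Otimes>\<^sub>M perc p) (perc p) (\<lambda>(x, X). fun_upd X e x) = perc p"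
    using distr_pair_PiM_eq_PiM[of E2 "\<lambda>_. ?B" e, OF measure_pmf.prob_space_axioms measure_pmf.prob_space_axioms]
    unfolding ins perc_def .
  have m: "(\<lambda>(x, X). fun_upd X e x) \<in> measurable (?B \<Otimes>\<^sub>M perc p) (perc p)"
  proof (rule ccontr)
    assume n: "(\<lambda>(x, X). fun_upd X e x) \<notin> measurable (?B \<Otimes>\<^sub>M perc p) (perc p)"
    have "(\<lambda>(x, X). fun_upd X e x) \<in> measurable (?B \<Otimes>\<^sub>M PiM E2 (\<lambda>_. ?B)) (PiM (insert e E2) (\<lambda>_. ?B))"
      by measurable
    then show False using n unfolding ins perc_def by simp
  qed
  have "AE z in ?B \<Otimes>\<^sub>M perc p. P ((\<lambda>(x, X). fun_upd X e x) z)"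
    by (rule AE_distrD[OF m]) (simp only: d ae)
  from BP.AE_pair[OF this] have "AE x in ?B. AE \<omega> in perc p. P (fun_upd \<omega> e x)" by simp
  then have "\<forall>x\<in>set_pmf (bernoulli_pmf p). AE \<omega> in perc p. P (fun_upd \<omega> e x)"
    by (simp add: AE_measure_pmf_iff)
  moreover have "True \<in> set_pmf (bernoulli_pmf p)" using p by (simp add: set_pmf_iff)
  ultimately show ?thesis by blast
qed

definition translate :: "int \<times> int \<Rightarrow> (edge \<Rightarrow> bool) \<Rightarrow> edge \<Rightarrow> bool" where
  "translate a \<omega> = (\<lambda>e\<in>E2. \<omega> ((+) a ` e))"

lemma shift_edge: "(+) a ` e \<in> E2 \<longleftrightarrow> e \<in> E2"
proof -
  have *: "(+) a ` e \<in> E2" if "e \<in> E2" for a e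
    using that by (elim E2_cases) (auto simp: E2_iff plus_prod_def)
  have "(+) (- a) ` (+) a ` e = e" by (simp add: image_image)
  then show ?thesis using *[of e a] *[of "(+) a ` e" "- a"] by auto
qed

lemma distr_translate: "distr (perc p) (perc p) (translate a) = perc p"
proof -
  have inj: "inj_on (\<lambda>e. (+) a ` e) E2" by (rule inj_onI) (metis add_left_cancel inj_image_eq_iff injI)
  show ?thesis
    using distr_PiM_reindex[OF measure_pmf.prob_space_axioms inj, of E2 "\<lambda>_. bernoulli_pmf p"]
    unfolding perc_def translate_def[abs_def] by (auto simp: shift_edge)
qed

lemma measurable_translate [measurable]: "translate a \<in> measurable (perc p) (perc q)"
proof -
  have "translate a \<in> measurable (perc p) (PiM E2 (\<lambda>_. measure_pmf (bernoulli_pmf q)))"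
    unfolding translate_def[abs_def]
  proof (rule measurable_restrict)
    fix e assume "e \<in> E2"
    then have [measurable]: "(+) a ` e \<in> E2" by (simp add: shift_edge)
    show "(\<lambda>\<omega>. \<omega> ((+) a ` e)) \<in> measurable (perc p) (measure_pmf (bernoulli_pmf q))"
      by (simp, measurable)
  qed
  then show ?thesis by (simp add: perc_def)
qed

section \<open>Growth rates of open clusters\<close>

lemma open_adj_commute: "open_adj \<omega> x y \<longleftrightarrow> open_adj \<omega> y x"
  by (simp add: open_adj_def insert_commute)

lemma open_saws_0: "open_saws \<omega> 0 x = {[x]}"
  by (auto simp: open_saws_def length_Suc_conv)

lemma open_saws_take:
  assumes "S \<in> open_saws \<omega> N x" "k \<le> N"
  shows "take (Suc k) S \<in> open_saws \<omega> k x"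
  using assms by (auto simp: open_saws_def)

lemma open_saws_drop:
  assumes "S \<in> open_saws \<omega> N x" "k \<le> N"
  shows "drop k S \<in> open_saws \<omega> (N - k) (S ! k)"
  using assms by (auto simp: open_saws_def)

lemma open_saws_rev:
  assumes "S \<in> open_saws \<omega> N x"
  shows "rev S \<in> open_saws \<omega> N (S ! N)"
proof -
  have S: "length S = Suc N" "distinct S" "\<And>n. n < N \<Longrightarrow> open_adj \<omega> (S ! n) (S ! Suc n)"
    using assms by (auto simp: open_saws_def)
  have "open_adj \<omega> (rev S ! n) (rev S ! Suc n)" if "n < N" for n
    using S(3)[of "N - Suc n"] that S(1) open_adj_commute by (simp add: rev_nth Suc_diff_Suc)
  then show ?thesis using S by (auto simp: open_saws_def rev_nth)
qed

lemma open_saws_snoc: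
  assumes "S \<in> open_saws \<omega> N x" "open_adj \<omega> (S ! N) y" "y \<notin> set S"
  shows "S @ [y] \<in> open_saws \<omega> (Suc N) x"
  using assms by (auto simp: open_saws_def nth_append less_Suc_eq)

lemma open_saws_Cons:
  assumes "S \<in> open_saws \<omega> N x" "open_adj \<omega> y x" "y \<notin> set S"
  shows "y # S \<in> open_saws \<omega> (Suc N) y"
  using assms by (auto simp: open_saws_def nth_Cons split: nat.split)

definition nbrs :: "vertex \<Rightarrow> vertex set" where
  "nbrs x = {(fst x + 1, snd x), (fst x - 1, snd x), (fst x, snd x + 1), (fst x, snd x - 1)}"

lemma E2_pair_cases:
  assumes "{x, y} \<in> E2"
  shows "y = x + (1, 0) \<or> x = y + (1, 0) \<or> y = x + (0, 1) \<or> x = y + (0, 1)"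
  using assms by (cases rule: E2_cases) (auto simp: doubleton_eq_iff)

lemma open_adj_nbrs: "open_adj \<omega> x y \<Longrightarrow> y \<in> nbrs x"
  using E2_pair_cases[of x y] by (auto simp: open_adj_def nbrs_def prod_eq_iff)

lemma card_nbrs: "card (nbrs x) \<le> 4" "finite (nbrs x)"
  using card_length[of "[(fst x + 1, snd x), (fst x - 1, snd x), (fst x, snd x + 1), (fst x, snd x - 1)]"]
  by (simp_all add: nbrs_def)

lemma open_saws_Suc_subset:
  "open_saws \<omega> (Suc N) x \<subseteq> (\<lambda>(S, y). S @ [y]) ` (SIGMA S:open_saws \<omega> N x. nbrs (S ! N))"
proof
  fix S assume S: "S \<in> open_saws \<omega> (Suc N) x"
  then have len: "length S = Suc (Suc N)" and adj: "open_adj \<omega> (S ! N) (S ! Suc N)"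
    by (auto simp: open_saws_def)
  have "take (Suc N) S \<in> open_saws \<omega> N x" by (rule open_saws_take[OF S]) simp
  moreover have "S ! Suc N \<in> nbrs (take (Suc N) S ! N)" using open_adj_nbrs[OF adj] by simp
  moreover have "S = take (Suc N) S @ [S ! Suc N]"
    using len by (simp add: take_Suc_conv_app_nth[symmetric])
  ultimately show "S \<in> (\<lambda>(S, y). S @ [y]) ` (SIGMA S:open_saws \<omega> N x. nbrs (S ! N))"
    by (intro image_eqI[of _ _ "(take (Suc N) S, S ! Suc N)"]) auto
qed

lemma finite_open_saws: "finite (open_saws \<omega> N x)"
proof (induction N)
  case (Suc N)
  then have "finite (SIGMA S:open_saws \<omega> N x. nbrs (S ! N))" by (rule finite_SigmaI[OF _ card_nbrs(2)])
  then show ?case by (rule finite_subset[OF open_saws_Suc_subset finite_imageI])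
qed (simp add: open_saws_0)

lemma Z_nonneg: "0 \<le> Z \<omega> N x"
  by (simp add: Z_def)

lemma Z_le: "Z \<omega> N x \<le> 4 ^ N"
proof (induction N)
  case (Suc N)
  let ?D = "SIGMA S:open_saws \<omega> N x. nbrs (S ! N)"
  have fin: "finite ?D" by (rule finite_SigmaI[OF finite_open_saws card_nbrs(2)])
  have "card (open_saws \<omega> (Suc N) x) \<le> card ((\<lambda>(S, y). S @ [y]) ` ?D)"
    using fin open_saws_Suc_subset by (intro card_mono) auto
  also have "\<dots> \<le> card ?D" by (rule card_image_le[OF fin])
  also have "\<dots> = (\<Sum>S\<in>open_saws \<omega> N x. card (nbrs (S ! N)))"
    using finite_open_saws card_nbrs(2) by (intro card_SigmaI) auto
  also have "\<dots> \<le> (\<Sum>S\<in>open_saws \<omega> N x. 4)" by (intro sum_mono card_nbrs(1))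
  finally have "Z \<omega> (Suc N) x \<le> 4 * Z \<omega> N x" by (simp add: Z_def)
  then show ?case using Suc by simp
qed (simp add: Z_def open_saws_0)

lemma open_saws_mono:
  assumes "\<And>e. e \<in> E2 \<Longrightarrow> \<omega> e \<Longrightarrow> \<omega>' e"
  shows "open_saws \<omega> N x \<subseteq> open_saws \<omega>' N x"
  using assms by (auto simp: open_saws_def open_adj_def)

lemma Z_mono:
  assumes "\<And>e. e \<in> E2 \<Longrightarrow> \<omega> e \<Longrightarrow> \<omega>' e"
  shows "Z \<omega> N x \<le> Z \<omega>' N x"
  unfolding Z_def by (intro of_nat_mono card_mono finite_open_saws open_saws_mono assms)

lemma Z_adjacent:
  assumes "open_adj \<omega> x y"
  shows "Z \<omega> N x \<le> Z \<omega> (Suc N) y + (\<Sum>k\<le>N. Z \<omega> k y * Z \<omega> (N - k) y)"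
proof -
  let ?P = "\<lambda>k. open_saws \<omega> k y \<times> open_saws \<omega> (N - k) y"
  have fin: "finite (?P k)" for k using finite_open_saws by auto
  \<comment> \<open>If the path meets \<open>y\<close> at time \<open>k\<close>, then
    \<open>A\<close> is its initial part read backwards from \<open>y\<close> and \<open>B\<close>
    its remainder; both contain \<open>y\<close>, so \<open>tl\<close> drops one copy.\<close>
  have "open_saws \<omega> N x \<subseteq> tl ` open_saws \<omega> (Suc N) y \<union> (\<Union>k\<le>N. (\<lambda>(A, B). rev A @ tl B) ` ?P k)"
  proof
    fix S assume S: "S \<in> open_saws \<omega> N x"
    show "S \<in> tl ` open_saws \<omega> (Suc N) y \<union> (\<Union>k\<le>N. (\<lambda>(A, B). rev A @ tl B) ` ?P k)"
    proof (cases "y \<in> set S")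
      case False
      then have "y # S \<in> open_saws \<omega> (Suc N) y"
        using S assms open_adj_commute by (intro open_saws_Cons[OF S]) auto
      then show ?thesis by (intro UnI1 image_eqI[of _ _ "y # S"]) auto
    next
      case True
      then obtain k where k: "k < length S" "S ! k = y" by (auto simp: in_set_conv_nth)
      have len: "length S = Suc N" using S by (simp add: open_saws_def)
      then have kN: "k \<le> N" using k by simp
      have "rev (take (Suc k) S) \<in> open_saws \<omega> k (take (Suc k) S ! k)"
        by (rule open_saws_rev[OF open_saws_take[OF S kN]])
      then have "rev (take (Suc k) S) \<in> open_saws \<omega> k y" using k by simp
      moreover have "drop k S \<in> open_saws \<omega> (N - k) y" using open_saws_drop[OF S kN] k by simp
      moreover have "tl (drop k S) = drop (Suc k) S" by (simp add: tl_drop drop_Suc)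
      then have "S = rev (rev (take (Suc k) S)) @ tl (drop k S)" by (simp only: rev_rev_ident append_take_drop_id)
      ultimately show ?thesis using kN
        by (intro UnI2 UN_I[of k] image_eqI[of _ _ "(rev (take (Suc k) S), drop k S)"]) auto
    qed
  qed
  then have "card (open_saws \<omega> N x) \<le>
      card (tl ` open_saws \<omega> (Suc N) y \<union> (\<Union>k\<le>N. (\<lambda>(A, B). rev A @ tl B) ` ?P k))"
    using finite_open_saws fin by (intro card_mono) auto
  also have "\<dots> \<le> card (tl ` open_saws \<omega> (Suc N) y) + card (\<Union>k\<le>N. (\<lambda>(A, B). rev A @ tl B) ` ?P k)"
    by (rule card_Un_le)
  also have "\<dots> \<le> card (open_saws \<omega> (Suc N) y) + (\<Sum>k\<le>N. card (?P k))"
    by (intro add_mono card_image_le finite_open_saws order_trans[OF card_UN_le] sum_mono fin) auto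
  finally have "real (card (open_saws \<omega> N x)) \<le> real (card (open_saws \<omega> (Suc N) y) + (\<Sum>k\<le>N. card (?P k)))"
    by (rule of_nat_mono)
  then show ?thesis by (simp add: Z_def card_cartesian_product)
qed

text \<open>A self-avoiding path crosses the edge at most once. Removing this crossing leaves two
  paths of total length \<open>N - 1\<close> that do not use the edge, the second of which starts at
  \<open>u\<close> or \<open>v\<close>.\<close>

lemma Z_close_edge:
  fixes \<omega> u v
  defines "\<omega>' \<equiv> fun_upd \<omega> {u, v} False"
  shows "Z \<omega> N x \<le> Z \<omega>' N x + (\<Sum>k<N. Z \<omega>' k x * (Z \<omega>' (N - Suc k) u + Z \<omega>' (N - Suc k) v))"
proof -
  let ?P = "\<lambda>k. open_saws \<omega>' k x \<times> (open_saws \<omega>' (N - Suc k) u \<union> open_saws \<omega>' (N - Suc k) v)"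
  have fin: "finite (?P k)" for k using finite_open_saws by auto
  have "open_saws \<omega> N x \<subseteq> open_saws \<omega>' N x \<union> (\<Union>k<N. (\<lambda>(A, B). A @ B) ` ?P k)"
  proof
    fix S assume S: "S \<in> open_saws \<omega> N x"
    then have len: "length S = Suc N" and dist: "distinct S" and x: "S ! 0 = x"
      and adj: "\<And>n. n < N \<Longrightarrow> open_adj \<omega> (S ! n) (S ! Suc n)"
      by (auto simp: open_saws_def)
    show "S \<in> open_saws \<omega>' N x \<union> (\<Union>k<N. (\<lambda>(A, B). A @ B) ` ?P k)"
    proof (cases "\<exists>k<N. {S ! k, S ! Suc k} = {u, v}")
      case False
      then have "open_adj \<omega>' (S ! n) (S ! Suc n)" if "n < N" for n
        using adj[OF that] that by (auto simp: open_adj_def \<omega>'_def)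
      then show ?thesis using len dist x by (auto simp: open_saws_def)
    next
      case True
      then obtain k where k: "k < N" "{S ! k, S ! Suc k} = {u, v}" by blast
      have inj: "inj_on ((!) S) {..N}"
        using dist len by (auto simp: inj_on_def nth_eq_iff_index_eq)
      have "{S ! n, S ! Suc n} \<noteq> {u, v}" if "n < N" "n \<noteq> k" for n
        using inj_onD[OF inj_on_path_edges[OF inj], of n k] k that by auto
      then have adj': "open_adj \<omega>' (S ! n) (S ! Suc n)" if "n < N" "n \<noteq> k" for n
        using adj[OF that(1)] that by (auto simp: open_adj_def \<omega>'_def)
      have "take (Suc k) S \<in> open_saws \<omega>' k x"
        using len dist x k adj' by (auto simp: open_saws_def)
      moreover have "drop (Suc k) S \<in> open_saws \<omega>' (N - Suc k) (S ! Suc k)"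
        using len dist k adj' by (auto simp: open_saws_def)
      moreover have "S ! Suc k = u \<or> S ! Suc k = v" using k by (auto simp: doubleton_eq_iff)
      ultimately show ?thesis using k
        by (intro UnI2 UN_I[of k] image_eqI[of _ _ "(take (Suc k) S, drop (Suc k) S)"]) auto
    qed
  qed
  then have "card (open_saws \<omega> N x) \<le> card (open_saws \<omega>' N x \<union> (\<Union>k<N. (\<lambda>(A, B). A @ B) ` ?P k))"
    using finite_open_saws fin by (intro card_mono) auto
  also have "\<dots> \<le> card (open_saws \<omega>' N x) + card (\<Union>k<N. (\<lambda>(A, B). A @ B) ` ?P k)"
    by (rule card_Un_le)
  also have "\<dots> \<le> card (open_saws \<omega>' N x) + (\<Sum>k<N. card (?P k))"
    by (intro add_mono order_refl order_trans[OF card_UN_le] sum_mono card_image_le fin) auto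
  also have "\<dots> \<le> card (open_saws \<omega>' N x) +
      (\<Sum>k<N. card (open_saws \<omega>' k x) * (card (open_saws \<omega>' (N - Suc k) u) + card (open_saws \<omega>' (N - Suc k) v)))"
    by (intro add_mono order_refl sum_mono) (simp add: card_cartesian_product card_Un_le)
  finally have "real (card (open_saws \<omega> N x)) \<le> real (card (open_saws \<omega>' N x) +
      (\<Sum>k<N. card (open_saws \<omega>' k x) * (card (open_saws \<omega>' (N - Suc k) u) + card (open_saws \<omega>' (N - Suc k) v))))"
    by (rule of_nat_mono)
  then show ?thesis by (simp add: Z_def)
qed

section \<open>Exponential growth rate of the number of paths from a vertex\<close>

definition growth :: "(edge \<Rightarrow> bool) \<Rightarrow> vertex \<Rightarrow> ereal" where
  "growth \<omega> x = limsup (\<lambda>N. ereal (root N (Z \<omega> N x)))"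

text \<open>Constants and powers of \<open>N\<close> disappear under the N-th root. All polynomial
  losses in the counting and probability estimates are absorbed here.\<close>

lemma limsup_root_le:
  fixes a :: "nat \<Rightarrow> real"
  assumes b: "0 \<le> b" and C: "0 < C" and a: "\<forall>\<^sub>F N in sequentially. a N \<le> C * real N ^ k * b ^ N"
  shows "limsup (\<lambda>N. ereal (root N (a N))) \<le> ereal b"
proof -
  have "(\<lambda>N. root N C * root N (real N) ^ k * b) \<longlonglongrightarrow> 1 * 1 ^ k * b"
    by (intro tendsto_intros LIMSEQ_root_const LIMSEQ_root C)
  then have lim: "(\<lambda>N. ereal (root N C * root N (real N) ^ k * b)) \<longlonglongrightarrow> ereal b" by simp
  have "\<forall>\<^sub>F N in sequentially. ereal (root N (a N)) \<le> ereal (root N C * root N (real N) ^ k * b)"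
    using a eventually_gt_at_top[of 0]
  proof eventually_elim
    case (elim N)
    have "root N (a N) \<le> root N (C * real N ^ k * b ^ N)" using elim by simp
    also have "\<dots> = root N C * root N (real N) ^ k * b"
      using elim b by (simp add: real_root_mult real_root_power real_root_power_cancel flip: real_root_power)
    finally show ?case by simp
  qed
  then have "limsup (\<lambda>N. ereal (root N (a N))) \<le> limsup (\<lambda>N. ereal (root N C * root N (real N) ^ k * b))"
    by (rule Limsup_mono)
  also have "\<dots> = ereal b" using lim by (intro lim_imp_Limsup) auto
  finally show ?thesis .
qed

lemma growth_nonneg: "0 \<le> growth \<omega> x"
proof -
  have "0 \<le> liminf (\<lambda>N. ereal (root N (Z \<omega> N x)))"
    by (rule Liminf_bounded) (simp add: real_root_ge_zero Z_nonneg)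
  also have "\<dots> \<le> growth \<omega> x" unfolding growth_def by (rule Liminf_le_Limsup) simp
  finally show ?thesis .
qed

lemma growth_less_imp_bound:
  assumes "growth \<omega> x < ereal b"
  obtains C where "0 < C" "\<And>N. Z \<omega> N x \<le> C * b ^ N"
proof -
  have b: "0 < b" using assms growth_nonneg[of \<omega> x] by (metis ereal_less(2) le_less_trans)
  have "\<forall>\<^sub>F N in sequentially. ereal (root N (Z \<omega> N x)) < ereal b"
    using assms unfolding growth_def by (rule Limsup_lessD)
  then obtain N0 where N0: "\<And>N. N \<ge> N0 \<Longrightarrow> root N (Z \<omega> N x) < b"
    by (auto simp: eventually_sequentially)
  \<comment> \<open>The finitely many lengths up to \<open>N0\<close> are absorbed into the
    constant, so that the bound holds for every \<open>N\<close> and can be used inside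
    convolutions.\<close>
  define C where "C = 1 + (\<Sum>N\<le>N0. Z \<omega> N x / b ^ N)"
  have nn: "0 \<le> Z \<omega> N x / b ^ N" for N using b Z_nonneg by simp
  have C1: "1 \<le> C" unfolding C_def using nn by (simp add: sum_nonneg)
  have "Z \<omega> N x \<le> C * b ^ N" for N
  proof (cases "N \<le> N0")
    case True
    have "Z \<omega> N x / b ^ N \<le> (\<Sum>N\<le>N0. Z \<omega> N x / b ^ N)"
      using True nn by (intro member_le_sum) auto
    then have "Z \<omega> N x / b ^ N \<le> C" by (simp add: C_def)
    then show ?thesis using b by (simp add: pos_divide_le_eq)
  next
    case False
    then have "Z \<omega> N x = root N (Z \<omega> N x) ^ N" using Z_nonneg by simp
    also have "\<dots> \<le> b ^ N" using N0[of N] False Z_nonneg by (intro power_mono) (auto simp: real_root_ge_zero)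
    also have "\<dots> \<le> C * b ^ N" using C1 b by simp
    finally show ?thesis .
  qed
  then show thesis using that[of C] C1 by simp
qed

lemma growth_le_I:
  assumes "\<And>b. t < ereal b \<Longrightarrow> growth \<omega> x \<le> ereal b"
  shows "growth \<omega> x \<le> t"
proof (rule dense_ge)
  fix s assume s: "t < s"
  then show "growth \<omega> x \<le> s" using assms by (cases s) auto
qed

text \<open>A convolution of two geometric bounds with the same base costs only a factor
  \<open>N + 1\<close>.\<close>

lemma growth_adjacent:
  assumes "open_adj \<omega> x y"
  shows "growth \<omega> x \<le> growth \<omega> y"
proof (rule growth_le_I)
  fix b assume b: "growth \<omega> y < ereal b"
  then obtain C where C: "0 < C" "\<And>N. Z \<omega> N y \<le> C * b ^ N" using growth_less_imp_bound by blast
  have b0: "0 < b" using b growth_nonneg[of \<omega> y] by (metis ereal_less(2) le_less_trans)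
  have "Z \<omega> N x \<le> (C * b + 2 * C\<^sup>2) * real N ^ 1 * b ^ N" if "N \<ge> 1" for N
  proof -
    have "Z \<omega> N x \<le> Z \<omega> (Suc N) y + (\<Sum>k\<le>N. Z \<omega> k y * Z \<omega> (N - k) y)" by (rule Z_adjacent[OF assms])
    also have "\<dots> \<le> C * b ^ Suc N + (\<Sum>k\<le>N. (C * b ^ k) * (C * b ^ (N - k)))"
      using C b0 by (intro add_mono sum_mono mult_mono Z_nonneg C(2)) auto
    also have "(\<Sum>k\<le>N. (C * b ^ k) * (C * b ^ (N - k))) = (\<Sum>k\<le>N. C\<^sup>2 * b ^ N)"
      by (intro sum.cong refl) (simp add: power2_eq_square flip: power_add)
    also have "C * b ^ Suc N + (\<Sum>k\<le>N. C\<^sup>2 * b ^ N) = (C * b * 1 + C\<^sup>2 * (real N + 1)) * b ^ N"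
      by (simp add: algebra_simps)
    also have "\<dots> \<le> (C * b * real N + C\<^sup>2 * (2 * real N)) * b ^ N"
      using that C(1) b0 by (intro mult_right_mono add_mono mult_left_mono) auto
    finally show ?thesis by (simp add: algebra_simps)
  qed
  then have "\<forall>\<^sub>F N in sequentially. Z \<omega> N x \<le> (C * b + 2 * C\<^sup>2) * real N ^ 1 * b ^ N"
    by (auto simp: eventually_sequentially)
  then show "growth \<omega> x \<le> ereal b"
    unfolding growth_def using b0 C by (intro limsup_root_le[where C = "C * b + 2 * C\<^sup>2" and k = 1] add_pos_pos) auto
qed

lemma growth_cluster: "y \<in> cluster \<omega> x \<Longrightarrow> growth \<omega> y = growth \<omega> x"
  unfolding cluster_def mem_Collect_eq
proof (induction rule: rtranclp_induct)
  case (step y z)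
  then have "growth \<omega> y = growth \<omega> z"
    using growth_adjacent open_adj_commute by (metis order_antisym)
  then show ?case using step by simp
qed simp

text \<open>The growth at a fixed vertex is not a tail function, since closing the edges around the
  vertex makes it 0. The supremum over all vertices repairs this.\<close>

definition max_growth :: "(edge \<Rightarrow> bool) \<Rightarrow> ereal" where
  "max_growth \<omega> = (SUP x. growth \<omega> x)"

lemma growth_mono:
  assumes "\<And>e. e \<in> E2 \<Longrightarrow> \<omega> e \<Longrightarrow> \<omega>' e"
  shows "growth \<omega> x \<le> growth \<omega>' x"
  unfolding growth_def
proof (rule Limsup_mono)
  show "\<forall>\<^sub>F N in sequentially. ereal (root N (Z \<omega> N x)) \<le> ereal (root N (Z \<omega>' N x))"
    using eventually_gt_at_top[of 0]
    by eventually_elim (use Z_mono[of \<omega> \<omega>', OF assms] in auto)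
qed

lemma max_growth_close_edge:
  assumes "e \<in> E2"
  shows "max_growth (fun_upd \<omega> e False) = max_growth \<omega>"
proof (rule antisym)
  show "max_growth (fun_upd \<omega> e False) \<le> max_growth \<omega>"
    unfolding max_growth_def by (intro SUP_mono' growth_mono) (auto split: if_splits)
  obtain u v where e: "e = {u, v}" using assms by (auto simp: E2_def)
  let ?\<omega> = "fun_upd \<omega> {u, v} False"
  have "growth \<omega> x \<le> max_growth ?\<omega>" for x
  proof (rule growth_le_I)
    fix b assume b: "max_growth ?\<omega> < ereal b"
    \<comment> \<open>A path from \<open>x\<close> may continue from either end of the closed edge,
      so the bound is needed at \<open>x\<close>, \<open>u\<close> and \<open>v\<close>
      simultaneously; the supremum provides it.\<close>
    have lt: "growth ?\<omega> z < ereal b" for z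
      using b by (auto simp: max_growth_def intro: le_less_trans[OF SUP_upper])
    have b0: "0 < b" using lt[of x] growth_nonneg[of ?\<omega> x] by (metis ereal_less(2) le_less_trans)
    obtain C1 where C1: "0 < C1" "\<And>N. Z ?\<omega> N x \<le> C1 * b ^ N" using growth_less_imp_bound[OF lt] by blast
    obtain C2 where C2: "0 < C2" "\<And>N. Z ?\<omega> N u \<le> C2 * b ^ N" using growth_less_imp_bound[OF lt] by blast
    obtain C3 where C3: "0 < C3" "\<And>N. Z ?\<omega> N v \<le> C3 * b ^ N" using growth_less_imp_bound[OF lt] by blast
    have "Z \<omega> N x \<le> (C1 + C1 * (C2 + C3) / b) * real N ^ 1 * b ^ N" if "N \<ge> 1" for N
    proof -
      have "Z \<omega> N x \<le> Z ?\<omega> N x + (\<Sum>k<N. Z ?\<omega> k x * (Z ?\<omega> (N - Suc k) u + Z ?\<omega> (N - Suc k) v))"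
        by (rule Z_close_edge)
      also have "\<dots> \<le> C1 * b ^ N + (\<Sum>k<N. (C1 * b ^ k) * (C2 * b ^ (N - Suc k) + C3 * b ^ (N - Suc k)))"
        using C1 C2 C3 b0 by (intro add_mono sum_mono mult_mono Z_nonneg add_nonneg_nonneg) auto
      also have "(\<Sum>k<N. (C1 * b ^ k) * (C2 * b ^ (N - Suc k) + C3 * b ^ (N - Suc k))) =
          (\<Sum>k<N. C1 * (C2 + C3) * b ^ (N - 1))"
      proof (rule sum.cong[OF refl])
        fix k assume "k \<in> {..<N}"
        then have "b ^ k * b ^ (N - Suc k) = b ^ (N - 1)" by (simp flip: power_add)
        then show "(C1 * b ^ k) * (C2 * b ^ (N - Suc k) + C3 * b ^ (N - Suc k)) = C1 * (C2 + C3) * b ^ (N - 1)"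
          by (simp add: algebra_simps)
      qed
      also have "\<dots> = real N * (C1 * (C2 + C3) / b) * b ^ N"
        using that b0 by (simp add: power_eq_if)
      also have "C1 * b ^ N \<le> (C1 * real N) * b ^ N" using that C1 b0 by (intro mult_right_mono) auto
      finally show ?thesis by (simp add: algebra_simps)
    qed
    then have "\<forall>\<^sub>F N in sequentially. Z \<omega> N x \<le> (C1 + C1 * (C2 + C3) / b) * real N ^ 1 * b ^ N"
      by (auto simp: eventually_sequentially)
    then show "growth \<omega> x \<le> ereal b"
      unfolding growth_def using b0 C1 C2 C3
      by (intro limsup_root_le[where C = "C1 + C1 * (C2 + C3) / b" and k = 1] add_pos_nonneg) auto
  qed
  then show "max_growth \<omega> \<le> max_growth (fun_upd \<omega> e False)"
    unfolding e max_growth_def[of \<omega>] by (intro SUP_least) auto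
qed

lemma max_growth_close_edges:
  assumes "finite F" "F \<subseteq> E2"
  shows "max_growth (\<lambda>e. \<omega> e \<and> e \<notin> F) = max_growth \<omega>"
  using assms
proof (induction F rule: finite_induct)
  case (insert e F)
  have "(\<lambda>e'. \<omega> e' \<and> e' \<notin> insert e F) = fun_upd (\<lambda>e. \<omega> e \<and> e \<notin> F) e False" by (auto simp: fun_eq_iff)
  then show ?case using insert max_growth_close_edge[of e] by simp
qed simp

section \<open>Self-avoiding paths in finite and infinite clusters\<close>

lemma open_saws_cluster:
  assumes "S \<in> open_saws \<omega> N x"
  shows "set S \<subseteq> cluster \<omega> x"
proof -
  have "S ! n \<in> cluster \<omega> x" if "n \<le> N" for n
    using that
  proof (induction n)
    case 0
    then show ?case using assms by (simp add: open_saws_def cluster_def)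
  next
    case (Suc n)
    then have "open_adj \<omega> (S ! n) (S ! Suc n)" using assms by (simp add: open_saws_def)
    then show ?case using Suc by (auto simp: cluster_def intro: rtranclp.rtrancl_into_rtrancl)
  qed
  moreover have "length S = Suc N" using assms by (simp add: open_saws_def)
  ultimately show ?thesis by (metis in_set_conv_nth less_Suc_eq_le subsetI)
qed

text \<open>Loop erasure: if the next vertex has been visited already, the path is cut back to that
  visit.\<close>

lemma cluster_open_saw:
  assumes "y \<in> cluster \<omega> x"
  shows "\<exists>N S. S \<in> open_saws \<omega> N x \<and> S ! N = y"
  using assms unfolding cluster_def mem_Collect_eq
proof (induction rule: rtranclp_induct)
  case base
  show ?case by (intro exI[of _ 0] exI[of _ "[x]"]) (simp add: open_saws_0)
next
  case (step y z)
  then obtain N S where S: "S \<in> open_saws \<omega> N x" "S ! N = y" by blast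
  have len: "length S = Suc N" using S by (simp add: open_saws_def)
  show ?case
  proof (cases "z \<in> set S")
    case True
    then obtain k where k: "k < length S" "S ! k = z" by (auto simp: in_set_conv_nth)
    then show ?thesis using open_saws_take[OF S(1), of k] len
      by (intro exI[of _ k] exI[of _ "take (Suc k) S"]) auto
  next
    case False
    then show ?thesis using open_saws_snoc[OF S(1), of z] S(2) step len
      by (intro exI[of _ "Suc N"] exI[of _ "S @ [z]"]) (auto simp: nth_append)
  qed
qed

text \<open>Without a path of length \<open>N\<close> there is none of any greater length either,
  and the finitely many shorter ones reach only finitely many vertices.\<close>

lemma infinite_cluster_open_saw:
  assumes "x \<in> infinite_cluster \<omega>"
  shows "open_saws \<omega> N x \<noteq> {}"
proof
  assume empty: "open_saws \<omega> N x = {}"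
  have "cluster \<omega> x \<subseteq> (\<Union>k<N. (\<lambda>S. S ! k) ` open_saws \<omega> k x)"
  proof
    fix y assume "y \<in> cluster \<omega> x"
    then obtain k S where S: "S \<in> open_saws \<omega> k x" "S ! k = y" using cluster_open_saw by blast
    then have "k < N" using open_saws_take[OF S(1), of N] empty by (cases "k < N") auto
    then show "y \<in> (\<Union>k<N. (\<lambda>S. S ! k) ` open_saws \<omega> k x)" using S by auto
  qed
  then have "finite (cluster \<omega> x)" by (rule finite_subset) (simp add: finite_open_saws)
  then show False using assms by (simp add: infinite_cluster_def)
qed

lemma growth_ge_one:
  assumes "x \<in> infinite_cluster \<omega>"
  shows "1 \<le> growth \<omega> x"
proof -
  have "1 \<le> Z \<omega> N x" for N
    using infinite_cluster_open_saw[OF assms, of N] finite_open_saws[of \<omega> N x]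
    by (simp add: Z_def Suc_le_eq card_gt_0_iff)
  then have "\<forall>\<^sub>F N in sequentially. 1 \<le> ereal (root N (Z \<omega> N x))"
    by (intro eventually_mono[OF eventually_gt_at_top[of 0]]) (simp add: real_root_ge_1_iff)
  then have "1 \<le> liminf (\<lambda>N. ereal (root N (Z \<omega> N x)))" by (rule Liminf_bounded)
  also have "\<dots> \<le> growth \<omega> x" unfolding growth_def by (rule Liminf_le_Limsup) simp
  finally show ?thesis .
qed

lemma Z_finite_cluster:
  assumes "x \<notin> infinite_cluster \<omega>"
  shows "\<forall>\<^sub>F N in sequentially. Z \<omega> N x = 0"
  unfolding eventually_sequentially
proof (intro exI allI impI)
  have fin: "finite (cluster \<omega> x)" using assms by (simp add: infinite_cluster_def)
  fix N assume N: "card (cluster \<omega> x) \<le> N"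
  have "open_saws \<omega> N x = {}"
  proof (rule ccontr)
    assume "open_saws \<omega> N x \<noteq> {}"
    then obtain S where S: "S \<in> open_saws \<omega> N x" by blast
    then have "card (set S) = Suc N" by (simp add: open_saws_def distinct_card)
    then show False using card_mono[OF fin open_saws_cluster[OF S]] N by simp
  qed
  then show "Z \<omega> N x = 0" by (simp add: Z_def)
qed

lemma growth_finite_cluster:
  assumes "x \<notin> infinite_cluster \<omega>"
  shows "growth \<omega> x = 0"
proof -
  have "limsup (\<lambda>N. ereal (root N (Z \<omega> N x))) \<le> ereal 0"
    using Z_finite_cluster[OF assms] by (intro limsup_root_le[where C = 1 and k = 0]) (auto elim!: eventually_mono)
  then show ?thesis using growth_nonneg[of \<omega> x] by (simp add: growth_def zero_ereal_def)
qed

lemma growth_le_4: "growth \<omega> x \<le> 4"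
proof -
  have "limsup (\<lambda>N. ereal (root N (Z \<omega> N x))) \<le> ereal 4"
    using Z_le by (intro limsup_root_le[where C = 1 and k = 0]) auto
  then show ?thesis by (simp add: growth_def)
qed

text \<open>Finite clusters have growth 0 and growth is constant along the only infinite cluster, so
  the supremum is attained at each of its vertices.\<close>

lemma max_growth_unique_cluster:
  assumes uniq: "\<And>x y. x \<in> infinite_cluster \<omega> \<Longrightarrow> y \<in> infinite_cluster \<omega> \<Longrightarrow> y \<in> cluster \<omega> x"
    and x: "x \<in> infinite_cluster \<omega>"
  shows "growth \<omega> x = max_growth \<omega>"
proof (rule antisym)
  show "growth \<omega> x \<le> max_growth \<omega>" unfolding max_growth_def by (intro SUP_upper) simp
  have "growth \<omega> y \<le> growth \<omega> x" for y
  proof (cases "y \<in> infinite_cluster \<omega>")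
    case True
    then show ?thesis using growth_cluster[OF uniq[OF x True]] by simp
  next
    case False
    then show ?thesis using growth_finite_cluster[OF False] growth_nonneg by simp
  qed
  then show "max_growth \<omega> \<le> growth \<omega> x" unfolding max_growth_def by (rule SUP_least)
qed

section \<open>Edges joining two clusters in a box\<close>

lemma cluster_self [simp]: "x \<in> cluster \<omega> x"
  by (simp add: cluster_def)

lemma cluster_step: "y \<in> cluster \<omega> x \<Longrightarrow> open_adj \<omega> y z \<Longrightarrow> z \<in> cluster \<omega> x"
  by (auto simp: cluster_def intro: rtranclp.rtrancl_into_rtrancl)

lemma cluster_subset_closed:
  assumes "x \<in> C" "\<And>y z. y \<in> C \<Longrightarrow> open_adj \<omega> y z \<Longrightarrow> z \<in> C"
  shows "cluster \<omega> x \<subseteq> C"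
proof
  fix y assume "y \<in> cluster \<omega> x"
  then have "(open_adj \<omega>)\<^sup>*\<^sup>* x y" by (simp add: cluster_def)
  then show "y \<in> C" by (induction rule: rtranclp_induct) (use assms in auto)
qed

lemma cluster_commute: "y \<in> cluster \<omega> x \<longleftrightarrow> x \<in> cluster \<omega> y"
proof -
  have "symp (open_adj \<omega>)" by (rule sympI) (simp add: open_adj_commute)
  then show ?thesis unfolding cluster_def using symp_rtranclp[of "open_adj \<omega>"]
    by (auto dest: sympD)
qed

lemma cluster_eq: "y \<in> cluster \<omega> x \<Longrightarrow> cluster \<omega> y = cluster \<omega> x"
proof -
  have *: "cluster \<omega> b \<subseteq> cluster \<omega> a" if "b \<in> cluster \<omega> a" for a b
    by (rule cluster_subset_closed[OF that]) (rule cluster_step)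
  assume "y \<in> cluster \<omega> x"
  then show ?thesis using *[of y x] *[of x y] cluster_commute by blast
qed

lemma cluster_mono:
  assumes "\<And>e. e \<in> E2 \<Longrightarrow> \<omega> e \<Longrightarrow> \<omega>' e"
  shows "cluster \<omega> x \<subseteq> cluster \<omega>' x"
proof (rule cluster_subset_closed)
  fix y z assume y: "y \<in> cluster \<omega>' x" and "open_adj \<omega> y z"
  then have "open_adj \<omega>' y z" using assms by (auto simp: open_adj_def)
  then show "z \<in> cluster \<omega>' x" by (rule cluster_step[OF y])
qed simp

lemma infinite_cluster_mono:
  assumes "\<And>e. e \<in> E2 \<Longrightarrow> \<omega> e \<Longrightarrow> \<omega>' e"
  shows "infinite_cluster \<omega> \<subseteq> infinite_cluster \<omega>'"
proof
  fix x assume "x \<in> infinite_cluster \<omega>"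
  then show "x \<in> infinite_cluster \<omega>'"
    using finite_subset[OF cluster_mono[of \<omega> \<omega>' x, OF assms]] by (auto simp: infinite_cluster_def)
qed

abbreviation conf :: "edge set \<Rightarrow> edge \<Rightarrow> bool" where
  "conf A \<equiv> (\<lambda>e. e \<in> A)"

text \<open>This makes the event that an edge touches a given cluster independent of the state of the edge.\<close>

lemma cluster_insert_touch:
  assumes "u \<in> cluster (conf (insert {u, v} A)) b \<or> v \<in> cluster (conf (insert {u, v} A)) b"
  shows "u \<in> cluster (conf A) b \<or> v \<in> cluster (conf A) b"
proof (rule ccontr)
  assume *: "\<not> ?thesis"
  have "cluster (conf (insert {u, v} A)) b \<subseteq> cluster (conf A) b"
  proof (rule cluster_subset_closed)
    fix y z assume y: "y \<in> cluster (conf A) b" and yz: "open_adj (conf (insert {u, v} A)) y z"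
    have "{y, z} \<noteq> {u, v}" using * y by (auto simp: doubleton_eq_iff)
    then have "open_adj (conf A) y z" using yz by (simp add: open_adj_def)
    then show "z \<in> cluster (conf A) b" by (rule cluster_step[OF y])
  qed simp
  then show False using assms * by auto
qed

definition sq_box :: "nat \<Rightarrow> vertex set" where
  "sq_box n = {0..int n} \<times> {0..int n}"

definition sq_edges :: "nat \<Rightarrow> edge set" where
  "sq_edges n = {e \<in> E2. e \<subseteq> sq_box n}"

definition sq_bdry :: "nat \<Rightarrow> vertex set" where
  "sq_bdry n = {v \<in> sq_box n. fst v \<in> {0, int n} \<or> snd v \<in> {0, int n}}"

definition touching :: "nat \<Rightarrow> vertex set \<Rightarrow> edge set" where
  "touching n C = {e \<in> sq_edges n. e \<inter> C \<noteq> {}}"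

lemma finite_sq_box: "finite (sq_box n)"
  by (simp add: sq_box_def)

lemma finite_sq_edges: "finite (sq_edges n)"
  by (rule finite_subset[of _ "Pow (sq_box n)"]) (auto simp: sq_edges_def finite_sq_box)

lemma finite_sq_bdry: "finite (sq_bdry n)"
  by (rule finite_subset[OF _ finite_sq_box[of n]]) (auto simp: sq_bdry_def)

lemma sq_edges_subset: "sq_edges n \<subseteq> E2"
  by (auto simp: sq_edges_def)

lemma touching_subset: "touching n C \<subseteq> sq_edges n"
  by (auto simp: touching_def)

lemma finite_touching: "finite (touching n C)"
  by (rule finite_subset[OF touching_subset finite_sq_edges])

lemma card_sq_bdry: "card (sq_bdry n) \<le> 4 * (n + 1)"
proof -
  have c: "card {0..int n} = n + 1" by (simp add: nat_eq_iff)
  have "sq_bdry n \<subseteq> ({0, int n} \<times> {0..int n}) \<union> ({0..int n} \<times> {0, int n})"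
    by (auto simp: sq_bdry_def sq_box_def)
  then have "card (sq_bdry n) \<le> card (({0, int n} \<times> {0..int n}) \<union> ({0..int n} \<times> {0, int n}))"
    by (intro card_mono) auto
  also have "\<dots> \<le> card ({0, int n} \<times> {0..int n}) + card ({0..int n} \<times> {0, int n})"
    by (rule card_Un_le)
  also have "\<dots> = 2 * (card {0, int n} * (n + 1))"
    unfolding card_cartesian_product c by simp
  also have "\<dots> \<le> 2 * (2 * (n + 1))"
    by (intro mult_left_mono mult_right_mono) (auto simp: card_insert_if)
  finally show ?thesis by simp
qed

lemma card_sq_edges: "card (sq_edges n) \<le> 2 * (n + 1)\<^sup>2"
proof -
  have "sq_edges n \<subseteq> (\<lambda>v. {v, v + (1, 0)}) ` sq_box n \<union> (\<lambda>v. {v, v + (0, 1)}) ` sq_box n"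
  proof
    fix e assume "e \<in> sq_edges n"
    then have e: "e \<in> E2" "e \<subseteq> sq_box n" by (auto simp: sq_edges_def)
    from e(1) show "e \<in> (\<lambda>v. {v, v + (1, 0)}) ` sq_box n \<union> (\<lambda>v. {v, v + (0, 1)}) ` sq_box n"
    proof (cases rule: E2_cases)
      case (1 a b)
      then show ?thesis using e(2) by (intro UnI1 image_eqI[of _ _ "(a, b)"]) auto
    next
      case (2 a b)
      then show ?thesis using e(2) by (intro UnI2 image_eqI[of _ _ "(a, b)"]) auto
    qed
  qed
  then have "card (sq_edges n) \<le> card ((\<lambda>v. {v, v + (1, 0)}) ` sq_box n \<union> (\<lambda>v. {v, v + (0, 1)}) ` sq_box n)"
    by (intro card_mono) (auto simp: finite_sq_box)
  also have "\<dots> \<le> card (sq_box n) + card (sq_box n)"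
    by (intro order_trans[OF card_Un_le] add_mono card_image_le finite_sq_box)
  also have "\<dots> = 2 * (n + 1)\<^sup>2"
    by (simp add: sq_box_def card_cartesian_product power2_eq_square nat_add_distrib)
  finally show ?thesis .
qed

lemma cluster_sq_box:
  assumes "x \<in> sq_box n" "A \<subseteq> sq_edges n"
  shows "cluster (conf A) x \<subseteq> sq_box n"
  by (rule cluster_subset_closed[OF assms(1)]) (use assms(2) in \<open>auto simp: open_adj_def sq_edges_def\<close>)

text \<open>Exploring a cluster inspects only the edges that touch it. The event that the cluster
  equals \<open>C\<close> is therefore determined by \<open>touching n C\<close>.\<close>

lemma cluster_local:
  assumes A: "A \<subseteq> sq_edges n"
  shows "cluster (conf (A \<inter> touching n C)) b = C \<longleftrightarrow> cluster (conf A) b = C"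
proof -
  let ?\<omega> = "conf (A \<inter> touching n C)"
  have adj: "open_adj ?\<omega> y z" if "y \<in> C" "open_adj (conf A) y z" for y z
    using that A unfolding open_adj_def touching_def by blast
  show ?thesis
  proof
    assume C: "cluster ?\<omega> b = C"
    have "cluster (conf A) b \<subseteq> C"
    proof (rule cluster_subset_closed)
      show "b \<in> C" by (metis C cluster_self)
      fix y z assume y: "y \<in> C" and yz: "open_adj (conf A) y z"
      from adj[OF this] show "z \<in> C" using y C cluster_step by blast
    qed
    moreover have "C \<subseteq> cluster (conf A) b" using C cluster_mono[of ?\<omega> "conf A" b] by auto
    ultimately show "cluster (conf A) b = C" by auto
  next
    assume C: "cluster (conf A) b = C"
    have "C \<subseteq> cluster ?\<omega> b"
    proof -
      have "cluster (conf A) b \<subseteq> C \<inter> cluster ?\<omega> b"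
      proof (rule cluster_subset_closed)
        show "b \<in> C \<inter> cluster ?\<omega> b" using C by auto
        fix y z assume y: "y \<in> C \<inter> cluster ?\<omega> b" and yz: "open_adj (conf A) y z"
        then have "open_adj ?\<omega> y z" using adj by blast
        then have "z \<in> cluster ?\<omega> b" using y cluster_step by blast
        moreover have "z \<in> C" using y yz C cluster_step by blast
        ultimately show "z \<in> C \<inter> cluster ?\<omega> b" by simp
      qed
      then show ?thesis using C by auto
    qed
    moreover have "cluster ?\<omega> b \<subseteq> C"
      using C cluster_mono[of ?\<omega> "conf A" b] by auto
    ultimately show "cluster ?\<omega> b = C" by auto
  qed
qed

text \<open>The density of parameter \<open>p'\<close> relative to \<open>p\<close> on the edges
  inspected while exploring the cluster \<open>C\<close>.\<close>

definition likelihood :: "nat \<Rightarrow> real \<Rightarrow> real \<Rightarrow> edge set \<Rightarrow> vertex set \<Rightarrow> real" where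
  "likelihood n p p' A C =
    (\<Prod>e\<in>A \<inter> touching n C. p' / p) * (\<Prod>e\<in>touching n C - A. (1 - p') / (1 - p))"

text \<open>The law of the explored cluster under \<open>p'\<close> has total mass one, whatever \<open>p'\<close>; this
  replaces a martingale along the exploration of the cluster.\<close>

lemma bexp_likelihood:
  assumes p: "0 < p" "p < 1" and b: "b \<in> sq_box n"
  shows "bexp (sq_edges n) (\<lambda>_. p) (\<lambda>A. likelihood n p p' A (cluster (conf A) b)) = 1"
proof -
  let ?J = "sq_edges n" and ?T = "touching n" and ?\<C> = "Pow (sq_box n)"
  let ?E = "bexp ?J (\<lambda>_. p)" and ?E' = "bexp ?J (\<lambda>_. p')" and ?cl = "\<lambda>A. cluster (conf A) b"
  have fin: "finite ?\<C>" using finite_sq_box by simp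
  have "?E (\<lambda>A. likelihood n p p' A (?cl A)) =
      ?E (\<lambda>A. \<Sum>C\<in>?\<C>. likelihood n p p' A C * of_bool (?cl A = C))"
  proof (rule bexp_cong)
    fix A assume "A \<subseteq> ?J"
    then have "?cl A \<in> ?\<C>" using cluster_sq_box[OF b] by auto
    then show "likelihood n p p' A (?cl A) =
        (\<Sum>C\<in>?\<C>. likelihood n p p' A C * of_bool (?cl A = C))"
      using fin by (subst sum.remove[of _ "?cl A"]) auto
  qed simp
  also have "\<dots> = (\<Sum>C\<in>?\<C>. ?E (\<lambda>A. likelihood n p p' A C * of_bool (?cl A = C)))"
    by (rule bexp_sum)
  also have "\<dots> = (\<Sum>C\<in>?\<C>. ?E' (\<lambda>A. of_bool (?cl A = C)))"
  proof (rule sum.cong[OF refl])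
    fix C
    let ?g = "\<lambda>B. of_bool (cluster (conf B) b = C) :: real"
    let ?G = "\<lambda>B. (\<Prod>e\<in>B. p' / p) * (\<Prod>e\<in>?T C - B. (1 - p') / (1 - p)) * ?g B"
    have "?E (\<lambda>A. likelihood n p p' A C * of_bool (?cl A = C)) =
        ?E (\<lambda>A. ?G (A \<inter> ?T C))"
    proof (rule bexp_cong)
      fix A assume A: "A \<subseteq> ?J"
      have "?T C - A \<inter> ?T C = ?T C - A" by auto
      then show "likelihood n p p' A C * of_bool (?cl A = C) = ?G (A \<inter> ?T C)"
        unfolding cluster_local[OF A] likelihood_def by simp
    qed simp
    also have "\<dots> = bexp (?T C) (\<lambda>_. p) ?G"
      by (rule bexp_restrict[OF finite_sq_edges touching_subset])
    also have "\<dots> = bexp (?T C) (\<lambda>_. p') ?g"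
      using p by (intro bexp_change_parameter) auto
    also have "\<dots> = ?E' (\<lambda>A. ?g (A \<inter> ?T C))"
      by (rule bexp_restrict[OF finite_sq_edges touching_subset, symmetric])
    also have "\<dots> = ?E' ?g"
      by (intro bexp_cong refl) (simp only: cluster_local)
    finally show "?E (\<lambda>A. likelihood n p p' A C * of_bool (?cl A = C)) =
      ?E' (\<lambda>A. of_bool (?cl A = C))" .
  qed
  also have "\<dots> = ?E' (\<lambda>A. \<Sum>C\<in>?\<C>. of_bool (?cl A = C))"
    by (rule bexp_sum[symmetric])
  also have "\<dots> = ?E' (\<lambda>_. 1)"
  proof (rule bexp_cong)
    fix A assume "A \<subseteq> ?J"
    then have "?cl A \<in> ?\<C>" using cluster_sq_box[OF b] by auto
    then show "(\<Sum>C\<in>?\<C>. of_bool (?cl A = C)) = (1::real)"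
      using fin by (subst sum.remove[of _ "?cl A"]) auto
  qed simp
  also have "\<dots> = 1" by (rule bexp_const[OF finite_sq_edges])
  finally show ?thesis .
qed

text \<open>The inequality \<open>x \<le> exp x\<close>, applied to the log-likelihood expanded to
  second order in \<tau>. \<open>K\<close> dominates both second-order coefficients,
  \<open>2 / p\<^sup>2\<close> and \<open>2 / (1 - p)\<^sup>2\<close>. The parameter is lowered so
  that closed edges contribute positively.\<close>

lemma likelihood_lower_bound:
  assumes p: "0 < p" "p < 1" and \<tau>: "0 < \<tau>" "\<tau> \<le> p / 2" "\<tau> \<le> (1 - p) / 2"
  defines "K \<equiv> 2 / (p * (1 - p))\<^sup>2"
  shows "likelihood n p (p - \<tau>) A C \<ge>
    (\<Sum>e\<in>touching n C. if e \<in> A then - \<tau> / p - K * \<tau>\<^sup>2 else \<tau> / (1 - p) - K * \<tau>\<^sup>2)"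
proof -
  let ?T = "touching n C"
  have r1: "(p - \<tau>) / p = 1 - \<tau> / p" and r2: "(1 - (p - \<tau>)) / (1 - p) = 1 + \<tau> / (1 - p)"
    using p by (auto simp: field_simps)
  have pq: "(p * (1 - p))\<^sup>2 \<le> p\<^sup>2" "(p * (1 - p))\<^sup>2 \<le> (1 - p)\<^sup>2" "0 < (p * (1 - p))\<^sup>2"
    using p by (auto simp: power_mult_distrib power_le_one mult_left_le mult_left_le_one_le)
  have pos: "0 < 1 - \<tau> / p" "0 < 1 + \<tau> / (1 - p)"
    using p \<tau> by (auto simp: field_simps intro: add_pos_pos)
  have "- (\<tau> / p) - 2 * (\<tau> / p)\<^sup>2 \<le> ln (1 - \<tau> / p)"
    using p \<tau> by (intro ln_one_minus_pos_lower_bound) (auto simp: field_simps)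
  moreover have "2 * (\<tau> / p)\<^sup>2 \<le> K * \<tau>\<^sup>2"
  proof -
    have "2 / p\<^sup>2 \<le> K" unfolding K_def using pq p by (intro divide_left_mono mult_pos_pos) auto
    from mult_right_mono[OF this, of "\<tau>\<^sup>2"] show ?thesis by (simp add: power_divide)
  qed
  ultimately have l1: "- \<tau> / p - K * \<tau>\<^sup>2 \<le> ln (1 - \<tau> / p)" by simp
  have "\<tau> / (1 - p) - (\<tau> / (1 - p))\<^sup>2 \<le> ln (1 + \<tau> / (1 - p))"
    using p \<tau> by (intro ln_one_plus_pos_lower_bound) (auto simp: field_simps)
  moreover have "(\<tau> / (1 - p))\<^sup>2 \<le> 2 * (\<tau> / (1 - p))\<^sup>2" by simp
  moreover have "2 * (\<tau> / (1 - p))\<^sup>2 \<le> K * \<tau>\<^sup>2"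
  proof -
    have "2 / (1 - p)\<^sup>2 \<le> K" unfolding K_def using pq p by (intro divide_left_mono mult_pos_pos) auto
    from mult_right_mono[OF this, of "\<tau>\<^sup>2"] show ?thesis by (simp add: power_divide)
  qed
  ultimately have l2: "\<tau> / (1 - p) - K * \<tau>\<^sup>2 \<le> ln (1 + \<tau> / (1 - p))" by linarith
  have "(\<Sum>e\<in>?T. if e \<in> A then - \<tau> / p - K * \<tau>\<^sup>2 else \<tau> / (1 - p) - K * \<tau>\<^sup>2) \<le>
      (\<Sum>e\<in>?T. if e \<in> A then ln (1 - \<tau> / p) else ln (1 + \<tau> / (1 - p)))"
    using l1 l2 by (intro sum_mono) auto
  also have "\<dots> \<le> exp (\<Sum>e\<in>?T. if e \<in> A then ln (1 - \<tau> / p) else ln (1 + \<tau> / (1 - p)))"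
    using exp_ge_add_one_self by (meson add_increasing order_trans order_refl zero_le_one)
  also have "\<dots> = (\<Prod>e\<in>?T. if e \<in> A then 1 - \<tau> / p else 1 + \<tau> / (1 - p))"
    using pos by (subst exp_sum[OF finite_touching]) (auto intro!: prod.cong)
  also have "\<dots> = (\<Prod>e\<in>?T \<inter> {e. e \<in> A}. 1 - \<tau> / p) * (\<Prod>e\<in>?T \<inter> - {e. e \<in> A}. 1 + \<tau> / (1 - p))"
    by (rule prod.If_cases[OF finite_touching])
  also have "\<dots> = likelihood n p (p - \<tau>) A C"
    unfolding likelihood_def r1 r2 by (simp add: Int_commute Diff_eq)
  finally show ?thesis .
qed

definition bdry_clusters :: "nat \<Rightarrow> edge set \<Rightarrow> vertex set set" where
  "bdry_clusters n A = (\<lambda>b. cluster (conf A) b) ` sq_bdry n"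

definition splitting :: "nat \<Rightarrow> edge set \<Rightarrow> edge \<Rightarrow> bool" where
  "splitting n A e \<longleftrightarrow> e \<notin> A \<and> (\<exists>x y. e = {x, y} \<and> cluster (conf A) x \<noteq> cluster (conf A) y \<and>
     cluster (conf A) x \<in> bdry_clusters n A \<and> cluster (conf A) y \<in> bdry_clusters n A)"

lemma finite_bdry_clusters: "finite (bdry_clusters n A)"
  unfolding bdry_clusters_def using finite_sq_bdry by simp

lemma bdry_clusters_eq: "C \<in> bdry_clusters n A \<Longrightarrow> x \<in> C \<Longrightarrow> C = cluster (conf A) x"
  unfolding bdry_clusters_def using cluster_eq by blast

text \<open>The likelihood bound is summed over the distinct boundary clusters. Counting every
  touched edge once gives the first-order term \<open>h\<close>, of mean zero. Only a closed edge
  can be counted twice, and a splitting edge always is; its second count gains at least \<tau>. The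
  likelihoods have mean one each, so the total gain is at most the size of the boundary plus
  second-order errors.\<close>

lemma splitting_expectation:
  assumes p: "0 < p" "p < 1" and \<tau>: "0 < \<tau>" "\<tau> \<le> p / 2" "\<tau> \<le> (1 - p) / 2"
  shows "bexp (sq_edges n) (\<lambda>_. p) (\<lambda>A. \<Sum>e\<in>sq_edges n. of_bool (splitting n A e)) \<le>
    real (card (sq_bdry n)) / \<tau> + 4 / (p * (1 - p))\<^sup>2 * \<tau> * real (card (sq_edges n))"
proof -
  let ?J = "sq_edges n"
  let ?E = "bexp ?J (\<lambda>_. p)"
  define K where "K = 2 / (p * (1 - p))\<^sup>2"
  have K: "K \<ge> 0" by (simp add: K_def)
  define mult where "mult A e = card {C \<in> bdry_clusters n A. e \<inter> C \<noteq> {}}" for A and e :: edge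
  define touch where "touch A e \<longleftrightarrow> (\<exists>C\<in>bdry_clusters n A. e \<inter> C \<noteq> {})" for A and e :: edge
  \<comment> \<open>The score of the edge: minus the derivative of its log-likelihood in
    \<open>p'\<close> at \<open>p\<close>, restricted to the event that the edge is touched.\<close>
  define h where "h e A = (of_bool (touch A e) * (if e \<in> A then - 1 / p else 1 / (1 - p)) :: real)" for A e
  define w where "w e A = (if e \<in> A then - \<tau> / p - K * \<tau>\<^sup>2 else \<tau> / (1 - p) - K * \<tau>\<^sup>2)" for A and e :: edge
  have key: "\<tau> * (\<Sum>e\<in>?J. h e A) + \<tau> * (\<Sum>e\<in>?J. of_bool (splitting n A e)) - 2 * K * \<tau>\<^sup>2 * card ?J \<le>
      (\<Sum>b\<in>sq_bdry n. likelihood n p (p - \<tau>) A (cluster (conf A) b))" if A: "A \<subseteq> ?J" for A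
  proof -
    let ?B = "bdry_clusters n A"
    have edge: "\<tau> * h e A + \<tau> * of_bool (splitting n A e) - 2 * K * \<tau>\<^sup>2 \<le> real (mult A e) * w e A"
      if e: "e \<in> ?J" for e
    proof -
      obtain x y where xy: "e = {x, y}" using e by (auto simp: sq_edges_def E2_def)
      let ?M = "{C \<in> ?B. e \<inter> C \<noteq> {}}"
      have sub: "?M \<subseteq> {cluster (conf A) x, cluster (conf A) y}"
        using bdry_clusters_eq xy by blast
      have finM: "finite ?M" using finite_bdry_clusters by simp
      have m2: "mult A e \<le> 2"
        unfolding mult_def using card_mono[OF _ sub] by (simp add: card_insert_if split: if_splits)
      have m0: "mult A e = 0 \<longleftrightarrow> \<not> touch A e"
        unfolding mult_def touch_def using finM by auto
      have m1: "mult A e \<le> 1" if "e \<in> A"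
      proof -
        have "open_adj (conf A) x y" using that e xy by (auto simp: open_adj_def sq_edges_def)
        then have "cluster (conf A) x = cluster (conf A) y"
          using cluster_eq[OF cluster_step[OF cluster_self]] by auto
        then show ?thesis unfolding mult_def using card_mono[OF _ sub] by simp
      qed
      have ms: "mult A e \<ge> 2" if sp: "splitting n A e"
      proof -
        obtain u v where uv: "e = {u, v}" "cluster (conf A) u \<noteq> cluster (conf A) v"
            "cluster (conf A) u \<in> ?B" "cluster (conf A) v \<in> ?B"
          using sp unfolding splitting_def by blast
        have "{cluster (conf A) u, cluster (conf A) v} \<subseteq> ?M" using uv by auto
        from card_mono[OF finM this] show ?thesis using uv(2) by (simp add: mult_def)
      qed
      have split_touch: "touch A e" "e \<notin> A" if "splitting n A e"
        using that ms m0 by (auto simp: splitting_def)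
      show ?thesis
      proof (cases "e \<in> A")
        case True
        then have ns: "\<not> splitting n A e" using split_touch by blast
        have c: "mult A e = 0 \<or> mult A e = 1" using m1[OF True] by linarith
        then show ?thesis
          using True ns m0 K by (auto simp: h_def w_def)
      next
        case False
        consider "mult A e = 0" | "mult A e = 1" | "mult A e = 2" using m2 by linarith
        then show ?thesis
        proof cases
          case 1
          then have "\<not> touch A e" "\<not> splitting n A e" using m0 split_touch by auto
          then show ?thesis using 1 K by (simp add: h_def)
        next
          case 2
          then have "touch A e" "\<not> splitting n A e" using m0 ms by fastforce+
          then show ?thesis using 2 K False by (simp add: h_def w_def)
        next
          case 3
          then have t: "touch A e" using m0 by simp
          have "of_bool (splitting n A e) \<le> (1::real)" by simp
          also have "1 \<le> 1 / (1 - p)" using p by (simp add: field_simps)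
          finally have "\<tau> * of_bool (splitting n A e) \<le> \<tau> / (1 - p)"
            using \<tau> by (metis mult_left_mono less_imp_le mult.right_neutral times_divide_eq_right)
          then show ?thesis using 3 t False K by (simp add: h_def w_def)
        qed
      qed
    qed
    have "\<tau> * (\<Sum>e\<in>?J. h e A) + \<tau> * (\<Sum>e\<in>?J. of_bool (splitting n A e)) - 2 * K * \<tau>\<^sup>2 * card ?J =
        (\<Sum>e\<in>?J. \<tau> * h e A + \<tau> * of_bool (splitting n A e) - 2 * K * \<tau>\<^sup>2)"
      by (simp add: sum.distrib sum_subtractf sum_distrib_left)
    also have "\<dots> \<le> (\<Sum>e\<in>?J. real (mult A e) * w e A)" by (rule sum_mono) (rule edge)
    also have "\<dots> = (\<Sum>e\<in>?J. \<Sum>C\<in>?B. of_bool (e \<inter> C \<noteq> {}) * w e A)"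
    proof (rule sum.cong[OF refl])
      fix e
      have "real (mult A e) = (\<Sum>C\<in>?B. of_bool (e \<inter> C \<noteq> {}))"
        unfolding mult_def of_bool_def sum.inter_filter[OF finite_bdry_clusters, symmetric] by simp
      then show "real (mult A e) * w e A = (\<Sum>C\<in>?B. of_bool (e \<inter> C \<noteq> {}) * w e A)"
        by (simp add: sum_distrib_right)
    qed
    also have "\<dots> = (\<Sum>C\<in>?B. \<Sum>e\<in>?J. of_bool (e \<inter> C \<noteq> {}) * w e A)" by (rule sum.swap)
    also have "\<dots> = (\<Sum>C\<in>?B. \<Sum>e\<in>touching n C. w e A)"
    proof (rule sum.cong[OF refl])
      fix C
      show "(\<Sum>e\<in>?J. of_bool (e \<inter> C \<noteq> {}) * w e A) = (\<Sum>e\<in>touching n C. w e A)"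
        using finite_sq_edges by (intro sum.mono_neutral_cong_right) (auto simp: touching_def)
    qed
    also have "\<dots> \<le> (\<Sum>C\<in>?B. likelihood n p (p - \<tau>) A C)"
      unfolding w_def K_def by (intro sum_mono likelihood_lower_bound assms)
    \<comment> \<open>Several boundary vertices may lie in one cluster. Counting it once per vertex
      only increases the sum, as likelihoods are nonnegative.\<close>
    also have "\<dots> \<le> (\<Sum>b\<in>sq_bdry n. likelihood n p (p - \<tau>) A (cluster (conf A) b))"
      unfolding bdry_clusters_def
    proof (rule order_trans[OF sum_image_le[OF finite_sq_bdry]])
      show "0 \<le> likelihood n p (p - \<tau>) A (cluster (conf A) b)" for b
        unfolding likelihood_def using p \<tau> by (intro mult_nonneg_nonneg prod_nonneg) auto
    qed (simp add: o_def)
    finally show ?thesis .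
  qed
  \<comment> \<open>Being touched does not depend on the state of the edge itself, so the centred
    score averages to zero.\<close>
  have h0: "?E (h e) = 0" if e: "e \<in> ?J" for e
  proof -
    define I where "I = ?J - {e}"
    have I: "finite I" "e \<notin> I" "insert e I = ?J" using e finite_sq_edges by (auto simp: I_def)
    obtain x y where xy: "e = {x, y}" using e by (auto simp: sq_edges_def E2_def)
    have touch_iff: "touch A e \<longleftrightarrow> (\<exists>b\<in>sq_bdry n. x \<in> cluster (conf A) b \<or> y \<in> cluster (conf A) b)" for A
      by (auto simp: touch_def bdry_clusters_def xy)
    have t: "touch (insert e A) e \<longleftrightarrow> touch A e" for A
      unfolding touch_iff using cluster_insert_touch[of x y A, folded xy]
        cluster_mono[of "conf A" "conf (insert e A)"] by blast
    have "?E (h e) = p * bexp I (\<lambda>_. p) (\<lambda>A. h e (insert e A)) + (1 - p) * bexp I (\<lambda>_. p) (h e)"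
      unfolding I(3)[symmetric] by (rule bexp_insert[OF I(1,2)])
    also have "bexp I (\<lambda>_. p) (\<lambda>A. h e (insert e A)) = (- 1 / p) * bexp I (\<lambda>_. p) (\<lambda>A. of_bool (touch A e))"
      unfolding bexp_cmult[symmetric] by (intro bexp_cong) (auto simp: h_def t)
    also have "bexp I (\<lambda>_. p) (h e) = 1 / (1 - p) * bexp I (\<lambda>_. p) (\<lambda>A. of_bool (touch A e))"
      unfolding bexp_cmult[symmetric] using I(2) by (intro bexp_cong) (auto simp: h_def)
    finally show ?thesis using p by simp
  qed
  have "\<tau> * ?E (\<lambda>A. \<Sum>e\<in>?J. of_bool (splitting n A e)) - 2 * K * \<tau>\<^sup>2 * card ?J =
      ?E (\<lambda>A. \<tau> * (\<Sum>e\<in>?J. h e A) + \<tau> * (\<Sum>e\<in>?J. of_bool (splitting n A e)) - 2 * K * \<tau>\<^sup>2 * card ?J)"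
    by (simp add: bexp_add bexp_diff bexp_cmult bexp_const finite_sq_edges bexp_sum[of _ _ h] h0)
  also have "\<dots> \<le> ?E (\<lambda>A. \<Sum>b\<in>sq_bdry n. likelihood n p (p - \<tau>) A (cluster (conf A) b))"
    using key p by (intro bexp_mono) auto
  also have "\<dots> = (\<Sum>b\<in>sq_bdry n. 1)"
    unfolding bexp_sum using p by (intro sum.cong refl bexp_likelihood) (auto simp: sq_bdry_def)
  also have "\<dots> = real (card (sq_bdry n))" by simp
  finally have "\<tau> * ?E (\<lambda>A. \<Sum>e\<in>?J. of_bool (splitting n A e)) \<le> real (card (sq_bdry n)) + 2 * K * \<tau>\<^sup>2 * card ?J"
    by simp
  then have "?E (\<lambda>A. \<Sum>e\<in>?J. of_bool (splitting n A e)) \<le> (real (card (sq_bdry n)) + 2 * K * \<tau>\<^sup>2 * card ?J) / \<tau>"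
    using \<tau>(1) by (simp add: pos_le_divide_eq mult.commute)
  also have "\<dots> = real (card (sq_bdry n)) / \<tau> + 2 * K * \<tau> * card ?J"
    using \<tau>(1) by (simp add: add_divide_distrib power2_eq_square)
  finally show ?thesis by (simp add: K_def)
qed

section \<open>Uniqueness of the infinite cluster\<close>

lemma pred_open_adj [measurable]: "Measurable.pred (perc p) (\<lambda>\<omega>. open_adj \<omega> x y)"
proof (cases "{x, y} \<in> E2")
  case True
  then show ?thesis unfolding open_adj_def by (simp add: pred_def[symmetric])
qed (simp add: open_adj_def)

lemma pred_relpow_open_adj: "Measurable.pred (perc p) (\<lambda>\<omega>. (open_adj \<omega> ^^ n) x y)"
proof (induction n arbitrary: y)
  case (Suc n)
  have "(open_adj \<omega> ^^ Suc n) x y \<longleftrightarrow> (\<exists>z. (open_adj \<omega> ^^ n) x z \<and> open_adj \<omega> z y)" for \<omega>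
    by auto
  moreover have "Measurable.pred (perc p) (\<lambda>\<omega>. \<exists>z. (open_adj \<omega> ^^ n) x z \<and> open_adj \<omega> z y)"
    by (intro pred_intros_countable pred_intros_logic Suc pred_open_adj)
  ultimately show ?case by (simp only:)
qed simp

lemma pred_cluster [measurable]: "Measurable.pred (perc p) (\<lambda>\<omega>. y \<in> cluster \<omega> x)"
  unfolding cluster_def mem_Collect_eq rtranclp_power
  by (intro pred_intros_countable pred_relpow_open_adj)

text \<open>Expresses infinitude by countable quantifiers over vertices, from which measurability
  follows.\<close>

lemma infinite_vertex_set_iff:
  fixes C :: "vertex set"
  shows "infinite C \<longleftrightarrow> (\<forall>n::nat. \<exists>v. v \<in> C \<and> int n < \<bar>fst v\<bar> + \<bar>snd v\<bar>)"
proof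
  assume inf: "infinite C"
  show "\<forall>n::nat. \<exists>v. v \<in> C \<and> int n < \<bar>fst v\<bar> + \<bar>snd v\<bar>"
  proof (rule ccontr)
    assume "\<not> ?thesis"
    then obtain n :: nat where n: "\<And>v. v \<in> C \<Longrightarrow> \<bar>fst v\<bar> + \<bar>snd v\<bar> \<le> int n" by (meson not_less)
    have "C \<subseteq> {- int n..int n} \<times> {- int n..int n}"
    proof
      fix v assume "v \<in> C"
      from n[OF this] show "v \<in> {- int n..int n} \<times> {- int n..int n}"
        unfolding mem_Times_iff atLeastAtMost_iff by linarith
    qed
    then show False using inf finite_subset by blast
  qed
next
  assume *: "\<forall>n::nat. \<exists>v. v \<in> C \<and> int n < \<bar>fst v\<bar> + \<bar>snd v\<bar>"
  show "infinite C"
  proof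
    assume fin: "finite C"
    define m where "m = (\<Sum>v\<in>C. nat (\<bar>fst v\<bar> + \<bar>snd v\<bar>))"
    obtain v where v: "v \<in> C" "int m < \<bar>fst v\<bar> + \<bar>snd v\<bar>" using * by blast
    have "nat (\<bar>fst v\<bar> + \<bar>snd v\<bar>) \<le> m" unfolding m_def using fin v(1) by (intro member_le_sum) auto
    then show False using v(2) by linarith
  qed
qed

lemma pred_infinite_cluster [measurable]: "Measurable.pred (perc p) (\<lambda>\<omega>. x \<in> infinite_cluster \<omega>)"
  unfolding infinite_cluster_def mem_Collect_eq infinite_vertex_set_iff
  by (intro pred_intros_countable pred_intros_logic pred_cluster) simp

definition separating :: "(edge \<Rightarrow> bool) \<Rightarrow> vertex \<Rightarrow> vertex \<Rightarrow> bool" where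
  "separating \<omega> x y \<longleftrightarrow> x \<in> infinite_cluster \<omega> \<and> y \<in> infinite_cluster \<omega> \<and> y \<notin> cluster \<omega> x"

lemma pred_separating [measurable]: "Measurable.pred (perc p) (\<lambda>\<omega>. separating \<omega> x y)"
  unfolding separating_def by measurable

lemma sets_separating: "{\<omega> \<in> space (perc p). separating \<omega> x y} \<in> sets (perc p)"
  using pred_separating by (simp add: pred_def)

text \<open>If the cluster inside the box missed the boundary, no open edge could leave it, and it
  would be the whole cluster in the lattice.\<close>

lemma infinite_cluster_meets_bdry:
  assumes x: "x \<in> sq_box n" "x \<in> infinite_cluster \<omega>"
  shows "\<exists>b\<in>sq_bdry n. cluster (conf (opens (sq_edges n) \<omega>)) x = cluster (conf (opens (sq_edges n) \<omega>)) b"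
proof (rule ccontr)
  let ?A = "opens (sq_edges n) \<omega>"
  assume *: "\<not> ?thesis"
  have nb: "b \<notin> cluster (conf ?A) x" if "b \<in> sq_bdry n" for b
    using * that cluster_eq by blast
  have sub: "cluster (conf ?A) x \<subseteq> sq_box n" by (rule cluster_sq_box[OF x(1)]) auto
  have "cluster \<omega> x \<subseteq> cluster (conf ?A) x"
  proof (rule cluster_subset_closed)
    fix y z assume y: "y \<in> cluster (conf ?A) x" and yz: "open_adj \<omega> y z"
    have yb: "y \<in> sq_box n" "y \<notin> sq_bdry n" using sub nb[of y] y by blast+
    have "\<bar>fst y - fst z\<bar> + \<bar>snd y - snd z\<bar> = 1" using yz by (simp add: open_adj_def E2_iff)
    then have "\<bar>fst y - fst z\<bar> \<le> 1" "\<bar>snd y - snd z\<bar> \<le> 1" by linarith+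
    then have "z \<in> sq_box n"
      using yb unfolding sq_bdry_def sq_box_def mem_Times_iff by auto
    then have "open_adj (conf ?A) y z" using yz yb by (simp add: open_adj_def sq_edges_def)
    then show "z \<in> cluster (conf ?A) x" by (rule cluster_step[OF y])
  qed simp
  then have "finite (cluster \<omega> x)" by (rule finite_subset[OF subset_trans[OF _ sub] finite_sq_box])
  then show False using x(2) by (simp add: infinite_cluster_def)
qed

lemma separating_splitting:
  assumes e: "{x, y} \<in> sq_edges n" and sep: "separating \<omega> x y"
  shows "splitting n (opens (sq_edges n) \<omega>) {x, y}"
proof -
  let ?A = "opens (sq_edges n) \<omega>"
  have box: "x \<in> sq_box n" "y \<in> sq_box n" using e by (auto simp: sq_edges_def)
  have sub: "cluster (conf ?A) x \<subseteq> cluster \<omega> x" by (rule cluster_mono) auto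
  have y: "y \<notin> cluster \<omega> x" using sep by (simp add: separating_def)
  have "{x, y} \<notin> ?A"
  proof
    assume "{x, y} \<in> ?A"
    then have "open_adj \<omega> x y" using e by (auto simp: open_adj_def sq_edges_def)
    then show False using cluster_step[OF cluster_self] y by blast
  qed
  moreover have "cluster (conf ?A) x \<noteq> cluster (conf ?A) y"
    using sub y cluster_self[of y "conf ?A"] by blast
  moreover have "cluster (conf ?A) z \<in> bdry_clusters n ?A" if "z \<in> sq_box n" "z \<in> infinite_cluster \<omega>" for z
    using infinite_cluster_meets_bdry[OF that] unfolding bdry_clusters_def by auto
  then have "cluster (conf ?A) x \<in> bdry_clusters n ?A" "cluster (conf ?A) y \<in> bdry_clusters n ?A"
    using box sep by (auto simp: separating_def)
  ultimately show ?thesis unfolding splitting_def by blast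
qed

lemma open_adj_translate: "open_adj (translate a \<omega>) x y \<longleftrightarrow> open_adj \<omega> (a + x) (a + y)"
proof -
  have "(+) a ` {x, y} = {a + x, a + y}" by simp
  then show ?thesis using shift_edge[of a "{x, y}"] by (auto simp: open_adj_def translate_def)
qed

lemma cluster_translate: "cluster \<omega> (a + x) = (+) a ` cluster (translate a \<omega>) x"
proof
  show "cluster \<omega> (a + x) \<subseteq> (+) a ` cluster (translate a \<omega>) x"
  proof (rule cluster_subset_closed)
    fix y z assume "y \<in> (+) a ` cluster (translate a \<omega>) x" and yz: "open_adj \<omega> y z"
    then obtain v where v: "v \<in> cluster (translate a \<omega>) x" "y = a + v" by auto
    have "open_adj (translate a \<omega>) v (z - a)" using yz v by (simp add: open_adj_translate)
    then have "z - a \<in> cluster (translate a \<omega>) x" by (rule cluster_step[OF v(1)])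
    then show "z \<in> (+) a ` cluster (translate a \<omega>) x" by (intro image_eqI[of _ _ "z - a"]) auto
  qed simp
  have "cluster (translate a \<omega>) x \<subseteq> {v. a + v \<in> cluster \<omega> (a + x)}"
    by (rule cluster_subset_closed) (auto simp: open_adj_translate intro: cluster_step)
  then show "(+) a ` cluster (translate a \<omega>) x \<subseteq> cluster \<omega> (a + x)" by auto
qed

lemma separating_translate: "separating \<omega> (a + x) (a + y) \<longleftrightarrow> separating (translate a \<omega>) x y"
proof -
  have fin: "finite ((+) a ` C) \<longleftrightarrow> finite C" for C by (rule finite_image_iff) simp
  have "a + y \<in> (+) a ` C \<longleftrightarrow> y \<in> C" for C by (auto simp: image_iff)
  then show ?thesis unfolding separating_def infinite_cluster_def mem_Collect_eq cluster_translate fin by simp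
qed

lemma measure_separating_translate:
  "measure (perc p) {\<omega> \<in> space (perc p). separating \<omega> (a + x) (a + y)} =
   measure (perc p) {\<omega> \<in> space (perc p). separating \<omega> x y}"
proof -
  have "measure (perc p) {\<omega> \<in> space (perc p). separating \<omega> x y} =
      measure (distr (perc p) (perc p) (translate a)) {\<omega> \<in> space (perc p). separating \<omega> x y}"
    by (simp only: distr_translate)
  also have "\<dots> = measure (perc p) (translate a -` {\<omega> \<in> space (perc p). separating \<omega> x y} \<inter> space (perc p))"
    by (rule measure_distr[OF measurable_translate sets_separating])
  also have "translate a -` {\<omega> \<in> space (perc p). separating \<omega> x y} \<inter> space (perc p) =
      {\<omega> \<in> space (perc p). separating \<omega> (a + x) (a + y)}"
    by (auto simp: separating_translate space_perc translate_def)
  finally show ?thesis ..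
qed

text \<open>By translation invariance the expected number of separating edges of one direction in a
  box is \<open>q\<close> times the number of such edges. These edges are splitting in the box, and
  splitting edges are of lower order.\<close>

lemma separating_null:
  assumes p: "0 < p" "p \<le> 1" and d: "d \<in> {(1, 0), (0, 1)}"
  shows "AE \<omega> in perc p. \<not> separating \<omega> 0 d"
proof (cases "p = 1")
  case True
  have e: "{0, d} \<in> E2" using d by (auto simp: E2_iff)
  interpret prob_space "perc p" by (rule prob_space_perc)
  have "prob {\<omega> \<in> space (perc p). {0, d} \<in> opens {{0, d}} \<omega>} = bexp {{0, d}} (\<lambda>_. p) (\<lambda>A. of_bool ({0, d} \<in> A))"
    using p e by (intro perc_local_prob) auto
  also have "\<dots> = 1" using True by (simp add: bexp_insert)
  finally have "AE \<omega> in perc p. {0, d} \<in> opens {{0, d}} \<omega>"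
    using e by (subst (asm) prob_Collect_eq_1) (auto intro!: sets_local)
  then show ?thesis
  proof eventually_elim
    case (elim \<omega>)
    then have "open_adj \<omega> 0 d" using e by (simp add: open_adj_def)
    then have "d \<in> cluster \<omega> 0" using cluster_step[OF cluster_self] by blast
    then show ?case by (simp add: separating_def)
  qed
next
  case False
  \<comment> \<open>The case \<open>p = 1\<close> is separate because the likelihood divides by
    \<open>1 - p\<close>.\<close>
  then have p1: "p < 1" using p by simp
  interpret prob_space "perc p" by (rule prob_space_perc)
  define q where "q = prob {\<omega> \<in> space (perc p). separating \<omega> 0 d}"
  define K where "K = 4 / (p * (1 - p))\<^sup>2"
  have K: "0 \<le> K" by (simp add: K_def)
  \<comment> \<open>From here on, \<tau> chosen as \<open>1 / k\<close> satisfies both size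
    conditions of \<open>splitting_expectation\<close>.\<close>
  define k0 where "k0 = nat \<lceil>1 / min (p / 2) ((1 - p) / 2)\<rceil> + 1"
  have "q * real k \<le> 8 + 8 * K" if k: "k \<ge> k0" for k
  proof -
    have k1: "k \<ge> 1" using k by (simp add: k0_def)
    \<comment> \<open>With side n and \<tau> equal to \<open>1 / k\<close>, the boundary term n /
      \<tau> and the error term \<tau> n^2 are both of order k^3, while the box has k^4 edges of the
      given direction starting in \<open>?V\<close>.\<close>
    let ?n = "k\<^sup>2"
    let ?J = "sq_edges ?n"
    define mn where "mn = min (p / 2) ((1 - p) / 2)"
    have mpos: "0 < mn" using p p1 by (simp add: mn_def)
    have "1 / mn \<le> real k" using k unfolding k0_def mn_def by linarith
    then have "1 / real k \<le> mn" using mpos k1 by (simp add: field_simps)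
    then have "1 / real k \<le> p / 2" "1 / real k \<le> (1 - p) / 2" by (simp_all add: mn_def)
    then have \<tau>: "0 < 1 / real k" "1 / real k \<le> p / 2" "1 / real k \<le> (1 - p) / 2" using k1 by auto
    let ?V = "{0..<int ?n} \<times> {0..<int ?n}"
    let ?ed = "\<lambda>v. {v, v + d}"
    have edJ: "?ed v \<in> ?J" if "v \<in> ?V" for v
      using that d by (auto simp: sq_edges_def sq_box_def E2_iff)
    have inj: "inj_on ?ed ?V"
    proof (rule inj_onI)
      fix v w assume "{v, v + d} = {w, w + d}"
      then have "v = w \<or> (v = w + d \<and> v + d = w)" by (auto simp: doubleton_eq_iff)
      then show "v = w" using d by (auto simp: prod_eq_iff)
    qed
    have "real (?n * ?n) * q = (\<Sum>v\<in>?V. q)" by (simp add: card_cartesian_product)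
    also have "\<dots> \<le> (\<Sum>v\<in>?V. bexp ?J (\<lambda>_. p) (\<lambda>A. of_bool (splitting ?n A (?ed v))))"
    proof (rule sum_mono)
      fix v assume v: "v \<in> ?V"
      have "q = prob {\<omega> \<in> space (perc p). separating \<omega> v (v + d)}"
        unfolding q_def using measure_separating_translate[of p v 0 d] by simp
      also have "\<dots> \<le> prob {\<omega> \<in> space (perc p). splitting ?n (opens ?J \<omega>) (?ed v)}"
        using separating_splitting[OF edJ[OF v]]
        by (intro finite_measure_mono sets_local finite_sq_edges sq_edges_subset) auto
      also have "\<dots> = bexp ?J (\<lambda>_. p) (\<lambda>A. of_bool (splitting ?n A (?ed v)))"
        using p by (intro perc_local_prob finite_sq_edges sq_edges_subset) auto
      finally show "q \<le> bexp ?J (\<lambda>_. p) (\<lambda>A. of_bool (splitting ?n A (?ed v)))" .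
    qed
    also have "\<dots> = (\<Sum>e\<in>?ed ` ?V. bexp ?J (\<lambda>_. p) (\<lambda>A. of_bool (splitting ?n A e)))"
      using inj by (simp add: sum.reindex)
    also have "\<dots> \<le> (\<Sum>e\<in>?J. bexp ?J (\<lambda>_. p) (\<lambda>A. of_bool (splitting ?n A e)))"
      using edJ p finite_sq_edges by (intro sum_mono2) (auto intro!: bexp_nonneg)
    also have "\<dots> = bexp ?J (\<lambda>_. p) (\<lambda>A. \<Sum>e\<in>?J. of_bool (splitting ?n A e))"
      by (rule bexp_sum[symmetric])
    also have "\<dots> \<le> real (card (sq_bdry ?n)) / (1 / real k) + K * (1 / real k) * real (card ?J)"
      unfolding K_def by (rule splitting_expectation[OF p(1) p1 \<tau>])
    also have "\<dots> \<le> real (8 * k\<^sup>2) / (1 / real k) + K * (1 / real k) * real (8 * k ^ 4)"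
    proof (intro add_mono divide_right_mono mult_left_mono of_nat_mono)
      have kk: "1 \<le> k\<^sup>2" using k1 by simp
      show "card (sq_bdry ?n) \<le> 8 * k\<^sup>2" using kk by (intro order_trans[OF card_sq_bdry]) simp
      have "card ?J \<le> 2 * (?n + 1)\<^sup>2" by (rule card_sq_edges)
      also have "\<dots> \<le> 2 * (2 * k\<^sup>2)\<^sup>2" using kk by (intro mult_left_mono power_mono) auto
      also have "\<dots> = 8 * k ^ 4" by (simp add: power_mult_distrib flip: power_mult)
      finally show "card ?J \<le> 8 * k ^ 4" .
    qed (use K in auto)
    also have "\<dots> = (8 + 8 * K) * real k ^ 3"
      using k1 by (simp add: field_simps eval_nat_numeral)
    also have "real (?n * ?n) * q = (q * real k) * real k ^ 3" by (simp add: eval_nat_numeral)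
    finally show ?thesis using k1 by simp
  qed
  then have "q \<le> (8 + 8 * K) / real k" if "k \<ge> max 1 k0" for k
    using that by (simp add: pos_le_divide_eq)
  then have "q \<le> 0"
    by (intro tendsto_lowerbound[OF lim_const_over_n[of "8 + 8 * K"]] eventually_sequentiallyI[of "max 1 k0"]) auto
  then have "q = 0" using measure_nonneg[of "perc p"] unfolding q_def by (simp add: order_antisym)
  then show ?thesis
    using sets_separating[of p 0 d] unfolding q_def by (simp add: prob_Collect_eq_0)
qed

lemma AE_perc_translate:
  assumes "AE \<omega> in perc p. P \<omega>"
  shows "AE \<omega> in perc p. P (translate a \<omega>)"
  by (rule AE_distrD[OF measurable_translate[of a p p]]) (simp only: distr_translate assms)

lemma AE_not_separating:
  assumes p: "0 < p" "p \<le> 1"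
  shows "AE \<omega> in perc p. \<forall>x y. {x, y} \<in> E2 \<longrightarrow> \<not> separating \<omega> x y"
proof -
  have dir: "AE \<omega> in perc p. \<not> separating \<omega> x (x + d)" if "d \<in> {(1, 0), (0, 1)}" for x d
    using AE_perc_translate[OF separating_null[OF p that], of x]
    by (simp only: separating_translate[symmetric] add_0_right)
  have sym: "separating \<omega> x y \<longleftrightarrow> separating \<omega> y x" for \<omega> x y
    unfolding separating_def using cluster_commute by blast
  have "AE \<omega> in perc p. \<not> separating \<omega> x y" if e: "{x, y} \<in> E2" for x y
  proof -
    have "y = x + (1, 0) \<or> x = y + (1, 0) \<or> y = x + (0, 1) \<or> x = y + (0, 1)"
      by (rule E2_pair_cases[OF e])
    then consider "y = x + (1, 0)" | "x = y + (1, 0)" | "y = x + (0, 1)" | "x = y + (0, 1)" by blast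
    then show ?thesis
    proof cases
      case 1 then show ?thesis using dir[of "(1, 0)" x] by simp
    next
      case 2 then show ?thesis using dir[of "(1, 0)" y] sym by simp
    next
      case 3 then show ?thesis using dir[of "(0, 1)" x] by simp
    next
      case 4 then show ?thesis using dir[of "(0, 1)" y] sym by simp
    qed
  qed
  then show ?thesis by (simp add: AE_all_countable)
qed

section \<open>From separated neighbours to arbitrary pairs of vertices\<close>

primrec open_all :: "(vertex \<times> vertex) list \<Rightarrow> (edge \<Rightarrow> bool) \<Rightarrow> edge \<Rightarrow> bool" where
  "open_all [] \<omega> = \<omega>"
| "open_all (z # zs) \<omega> = open_all zs (if {fst z, snd z} \<in> E2 then fun_upd \<omega> {fst z, snd z} True else \<omega>)"

lemma AE_open_all:
  assumes p: "0 < p" "p \<le> 1" and "AE \<omega> in perc p. P \<omega>"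
  shows "AE \<omega> in perc p. P (open_all zs \<omega>)"
proof (induction zs)
  case (Cons z zs)
  show ?case
  proof (cases "{fst z, snd z} \<in> E2")
    case True
    then show ?thesis
      unfolding open_all.simps if_P[OF True] by (intro AE_perc_open_edge[OF p True Cons.IH])
  next
    case False
    then show ?thesis using Cons.IH by simp
  qed
qed (simp add: assms)

lemma open_edge_mono: "\<omega> e \<Longrightarrow> fun_upd \<omega> f True e"
  by simp

lemma open_all_mono: "\<omega> e \<Longrightarrow> open_all zs \<omega> e"
  by (induction zs arbitrary: \<omega>) auto

lemma open_all_append: "open_all (xs @ ys) \<omega> = open_all ys (open_all xs \<omega>)"
  by (induction xs arbitrary: \<omega>) auto

lemma cluster_full: "cluster (\<lambda>_. True) x = UNIV"
proof -
  let ?C = "cluster (\<lambda>_. True) x"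
  have st: "v + d \<in> ?C" "v - d \<in> ?C" if "v \<in> ?C" "d \<in> {(1, 0), (0, 1)}" for v d
    using that by (auto intro!: cluster_step[OF that(1)] simp: open_adj_def E2_iff)
  have it: "v + (int n * fst d, int n * snd d) \<in> ?C \<and> v - (int n * fst d, int n * snd d) \<in> ?C"
    if v: "v \<in> ?C" and d: "d \<in> {(1, 0), (0, 1)}" for v d n
  proof (induction n)
    case 0
    then show ?case using v by (simp flip: zero_prod_def)
  next
    case (Suc n)
    have "v + (int (Suc n) * fst d, int (Suc n) * snd d) = v + (int n * fst d, int n * snd d) + d"
      "v - (int (Suc n) * fst d, int (Suc n) * snd d) = v - (int n * fst d, int n * snd d) - d"
      by (auto simp: prod_eq_iff algebra_simps)
    then show ?case using st[OF _ d] Suc by metis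
  qed
  have it': "v + (i * fst d, i * snd d) \<in> ?C" if "v \<in> ?C" "d \<in> {(1, 0), (0, 1)}" for v d i
  proof (cases "i \<ge> 0")
    case True
    then show ?thesis using it[OF that, of "nat i"] by simp
  next
    case False
    then have eq: "v + (i * fst d, i * snd d) = v - (int (nat (- i)) * fst d, int (nat (- i)) * snd d)"
      by (simp add: prod_eq_iff)
    show ?thesis unfolding eq by (rule conjunct2[OF it[OF that]])
  qed
  have "y \<in> ?C" for y
  proof -
    have d: "(1, 0) \<in> {(1, 0), (0, 1 :: int)}" "(0, 1) \<in> {(1 :: int, 0), (0, 1)}" by auto
    have "x + ((fst y - fst x) * 1, (fst y - fst x) * 0) \<in> ?C"
      using it'[OF cluster_self d(1), of "fst y - fst x"] by (simp only: fst_conv snd_conv)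
    then have "x + ((fst y - fst x) * 1, (fst y - fst x) * 0) + ((snd y - snd x) * 0, (snd y - snd x) * 1) \<in> ?C"
      using it'[OF _ d(2), of _ "snd y - snd x"] by (simp only: fst_conv snd_conv)
    moreover have "x + ((fst y - fst x) * 1, (fst y - fst x) * 0) + ((snd y - snd x) * 0, (snd y - snd x) * 1) = y"
      by (simp add: prod_eq_iff)
    ultimately show ?thesis by simp
  qed
  then show ?thesis by blast
qed

text \<open>The list does not depend on the configuration. As there are countably many lists, null
  sets may be collected over all of them.\<close>

lemma exists_open_all_connecting: "\<exists>zs. \<forall>\<omega>. y \<in> cluster (open_all zs \<omega>) x"
proof -
  have "(open_adj (\<lambda>_. True))\<^sup>*\<^sup>* x y" using cluster_full[of x] by (auto simp: cluster_def)
  then show ?thesis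
  proof (induction rule: rtranclp_induct)
    case base
    show ?case by simp
  next
    case (step y z)
    then obtain zs where zs: "\<And>\<omega>. y \<in> cluster (open_all zs \<omega>) x" by blast
    have yz: "{y, z} \<in> E2" using step by (simp add: open_adj_def)
    have "z \<in> cluster (open_all (zs @ [(y, z)]) \<omega>) x" for \<omega>
    proof (rule cluster_step)
      show "y \<in> cluster (open_all (zs @ [(y, z)]) \<omega>) x"
        unfolding open_all_append by (rule subsetD[OF cluster_mono[OF open_all_mono] zs])
      show "open_adj (open_all (zs @ [(y, z)]) \<omega>) y z" using yz by (simp add: open_all_append open_adj_def)
    qed
    then show ?case by blast
  qed
qed

text \<open>If opening the edge merged two different infinite clusters, its ends would lie one in
  each of them, so it would have been separating.\<close>

lemma connected_open_edge:
  assumes e: "{u, v} \<in> E2" and ns: "\<not> separating \<omega> u v"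
    and inf: "x \<in> infinite_cluster \<omega>" "y \<in> infinite_cluster \<omega>"
    and conn: "y \<in> cluster (fun_upd \<omega> {u, v} True) x"
  shows "y \<in> cluster \<omega> x"
proof (rule ccontr)
  assume n: "y \<notin> cluster \<omega> x"
  let ?\<omega> = "fun_upd \<omega> {u, v} True"
  have meets: "u \<in> cluster \<omega> a \<or> v \<in> cluster \<omega> a" if "b \<in> cluster ?\<omega> a" "b \<notin> cluster \<omega> a" for a b
  proof (rule ccontr)
    assume *: "\<not> ?thesis"
    have "cluster ?\<omega> a \<subseteq> cluster \<omega> a"
    proof (rule cluster_subset_closed)
      fix s t assume s: "s \<in> cluster \<omega> a" and st: "open_adj ?\<omega> s t"
      have "{s, t} \<noteq> {u, v}" using * s by (auto simp: doubleton_eq_iff)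
      then have "open_adj \<omega> s t" using st by (simp add: open_adj_def)
      then show "t \<in> cluster \<omega> a" by (rule cluster_step[OF s])
    qed simp
    then show False using that by auto
  qed
  have 1: "u \<in> cluster \<omega> x \<or> v \<in> cluster \<omega> x" by (rule meets[OF conn n])
  have 2: "u \<in> cluster \<omega> y \<or> v \<in> cluster \<omega> y"
    by (rule meets[of x]) (use conn n cluster_commute in blast)+
  have disj: "cluster \<omega> x \<inter> cluster \<omega> y = {}"
    using n cluster_eq cluster_self by (metis disjoint_iff)
  have sep: "separating \<omega> a b" if "a \<in> cluster \<omega> x" "b \<in> cluster \<omega> y" for a b
  proof -
    have "cluster \<omega> a = cluster \<omega> x" "cluster \<omega> b = cluster \<omega> y" using that cluster_eq by auto
    then show ?thesis using inf disj that by (auto simp: separating_def infinite_cluster_def)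
  qed
  have "separating \<omega> u v \<or> separating \<omega> v u" using 1 2 disj sep by blast
  then show False using ns cluster_commute[of v \<omega> u] by (auto simp: separating_def)
qed

text \<open>The hypothesis ranges over all lists so that it passes to the configuration with the
  first edge opened; the edges are then closed again one at a time.\<close>

lemma connected_open_all:
  assumes "\<And>zs u v. {u, v} \<in> E2 \<Longrightarrow> \<not> separating (open_all zs \<omega>) u v"
    and "x \<in> infinite_cluster \<omega>" "y \<in> infinite_cluster \<omega>" "y \<in> cluster (open_all zs \<omega>) x"
  shows "y \<in> cluster \<omega> x"
  using assms
proof (induction zs arbitrary: \<omega>)
  case (Cons z zs)
  show ?case
  proof (cases "{fst z, snd z} \<in> E2")
    case True
    let ?\<omega> = "fun_upd \<omega> {fst z, snd z} True"
    have op: "open_all (z # zs') \<omega> = open_all zs' ?\<omega>" for zs' using True by simp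
    have conn: "y \<in> cluster ?\<omega> x"
    proof (rule Cons.IH)
      show "\<not> separating (open_all zs' ?\<omega>) u v" if "{u, v} \<in> E2" for zs' u v
        using Cons.prems(1)[OF that, of "z # zs'"] unfolding op .
      show "x \<in> infinite_cluster ?\<omega>"
        by (rule subsetD[OF infinite_cluster_mono[OF open_edge_mono] Cons.prems(2)])
      show "y \<in> infinite_cluster ?\<omega>"
        by (rule subsetD[OF infinite_cluster_mono[OF open_edge_mono] Cons.prems(3)])
      show "y \<in> cluster (open_all zs ?\<omega>) x" using Cons.prems(4) unfolding op .
    qed
    show ?thesis
      by (rule connected_open_edge[OF True _ Cons.prems(2,3) conn]) (use Cons.prems(1)[OF True, of "[]"] in simp)
  next
    case False
    then have op: "open_all (z # zs') \<omega> = open_all zs' \<omega>" for zs' by simp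
    show ?thesis by (rule Cons.IH) (use Cons.prems op in auto)
  qed
qed simp

text \<open>By finite energy, almost surely no modification by finitely many openings has a
  separating edge. Two infinite clusters could be merged by opening a path between them, and some
  edge of that path would be separating at its turn.\<close>

theorem AE_unique_infinite_cluster:
  assumes p: "0 < p" "p \<le> 1"
  shows "AE \<omega> in perc p. \<forall>x\<in>infinite_cluster \<omega>. \<forall>y\<in>infinite_cluster \<omega>. y \<in> cluster \<omega> x"
proof -
  have "AE \<omega> in perc p. \<forall>zs. \<forall>u v. {u, v} \<in> E2 \<longrightarrow> \<not> separating (open_all zs \<omega>) u v"
    unfolding AE_all_countable by (intro allI AE_open_all[OF p AE_not_separating[OF p], unfolded AE_all_countable, rule_format])
  then show ?thesis
  proof eventually_elim
    case (elim \<omega>)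
    show ?case
    proof (intro ballI)
      fix x y assume xy: "x \<in> infinite_cluster \<omega>" "y \<in> infinite_cluster \<omega>"
      obtain zs where "y \<in> cluster (open_all zs \<omega>) x" using exists_open_all_connecting by blast
      then show "y \<in> cluster \<omega> x" using connected_open_all[OF _ xy] elim by blast
    qed
  qed
qed

section \<open>Quenched constants\<close>

text \<open>A finite set of edges that determines \<open>Z \<omega> N x\<close>; it makes the count
  a local function.\<close>

definition saw_edges :: "nat \<Rightarrow> vertex \<Rightarrow> edge set" where
  "saw_edges N x = (\<Union>S\<in>open_saws (\<lambda>_. True) N x. path_edges N ((!) S))"

lemma open_saw_path:
  assumes "S \<in> open_saws \<omega> N x"
  shows "inj_on ((!) S) {..N}" "lattice_path N ((!) S)" "S ! 0 = x"
  using assms by (auto simp: open_saws_def lattice_path_def open_adj_def inj_on_def nth_eq_iff_index_eq)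

lemma finite_path_edges: "finite (path_edges N \<gamma>)"
  by (simp add: path_edges_def)

lemma path_edges_subset: "lattice_path N \<gamma> \<Longrightarrow> path_edges N \<gamma> \<subseteq> E2"
  by (auto simp: path_edges_def lattice_path_def)

lemma finite_saw_edges: "finite (saw_edges N x)"
  unfolding saw_edges_def using finite_open_saws finite_path_edges by blast

lemma saw_edges_subset: "saw_edges N x \<subseteq> E2"
  unfolding saw_edges_def using path_edges_subset open_saw_path(2) by blast

lemma open_saws_restrict:
  "open_saws (\<lambda>e. \<omega> e \<and> \<eta> e) N x = {S \<in> open_saws \<omega> N x. \<forall>e\<in>path_edges N ((!) S). \<eta> e}"
  by (auto simp: open_saws_def open_adj_def path_edges_def)

lemma Z_restrict:
  "Z (\<lambda>e. \<omega> e \<and> \<eta> e) N x = (\<Sum>S\<in>open_saws \<omega> N x. of_bool (\<forall>e\<in>path_edges N ((!) S). \<eta> e))"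
  unfolding Z_def open_saws_restrict of_bool_def sum.inter_filter[OF finite_open_saws, symmetric] by simp

lemma Z_local:
  assumes "saw_edges N x \<subseteq> J"
  shows "Z \<eta> N x = (\<Sum>S\<in>open_saws (\<lambda>_. True) N x. of_bool (path_edges N ((!) S) \<subseteq> opens J \<eta>))"
proof -
  have "Z \<eta> N x = Z (\<lambda>e. True \<and> \<eta> e) N x" by simp
  also have "\<dots> = (\<Sum>S\<in>open_saws (\<lambda>_. True) N x. of_bool (path_edges N ((!) S) \<subseteq> opens J \<eta>))"
    unfolding Z_restrict using assms by (intro sum.cong refl) (auto simp: saw_edges_def)
  finally show ?thesis .
qed

lemma borel_measurable_Z [measurable]:
  assumes "0 \<le> p" "p \<le> 1"
  shows "(\<lambda>\<omega>. Z \<omega> N x) \<in> borel_measurable (perc p)"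
  unfolding Z_local[OF order_refl]
  by (rule borel_measurable_integrable, rule perc_local_expectation(1)[OF finite_saw_edges saw_edges_subset assms])

lemma bexp_path_open:
  assumes "finite J" "path_edges N \<gamma> \<subseteq> J" "inj_on \<gamma> {..N}"
  shows "bexp J (\<lambda>_. p) (\<lambda>A. of_bool (path_edges N \<gamma> \<subseteq> A)) = p ^ N"
proof -
  have "bexp J (\<lambda>_. p) (\<lambda>A. of_bool (path_edges N \<gamma> \<subseteq> A)) =
      bexp J (\<lambda>_. p) (\<lambda>A. if path_edges N \<gamma> \<subseteq> A then 1 else 0)"
    by (simp add: of_bool_def)
  also have "\<dots> = p ^ N"
    using assms by (simp add: bexp_condition bexp_const card_path_edges)
  finally show ?thesis .
qed

lemma expectation_Z:
  assumes p: "0 \<le> p" "p \<le> 1"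
  shows "(\<integral>\<omega>. Z \<omega> N x \<partial>perc p) = p ^ N * Z (\<lambda>_. True) N x"
proof -
  let ?J = "saw_edges N x" and ?S = "open_saws (\<lambda>_. True) N x"
  have "(\<integral>\<omega>. Z \<omega> N x \<partial>perc p) = bexp ?J (\<lambda>_. p) (\<lambda>A. \<Sum>S\<in>?S. of_bool (path_edges N ((!) S) \<subseteq> A))"
    unfolding Z_local[OF order_refl]
    by (rule perc_local_expectation(2)[OF finite_saw_edges saw_edges_subset p])
  also have "\<dots> = (\<Sum>S\<in>?S. bexp ?J (\<lambda>_. p) (\<lambda>A. of_bool (path_edges N ((!) S) \<subseteq> A)))"
    by (rule bexp_sum)
  also have "\<dots> = (\<Sum>S\<in>?S. p ^ N)"
    by (intro sum.cong refl bexp_path_open finite_saw_edges open_saw_path) (auto simp: saw_edges_def)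
  finally show ?thesis by (simp add: Z_def mult.commute)
qed

lemma Z_meet: "Z (meet (\<omega>, \<eta>)) N x = Z (\<lambda>e. \<omega> e \<and> \<eta> e) N x"
  unfolding Z_def by (intro arg_cong[of _ _ "\<lambda>A. real (card A)"]) (auto simp: open_saws_def open_adj_def meet_def)

text \<open>The configuration \<omega> is fixed and arbitrary, and only \<eta> is random. The rate
  \<rho> depends on \<open>r\<close> alone, so it is available for random \<omega> as well as for
  the fully open lattice.\<close>

lemma quenched_bound:
  fixes r :: real
  assumes r: "0 < r" "r < 1"
  obtains \<rho> where "0 < \<rho>" "\<rho> < 1"
    "\<And>\<omega> x. AE \<eta> in perc r. \<forall>\<^sub>F N in sequentially.
       Z (meet (\<omega>, \<eta>)) N x \<le> (real N + 1)\<^sup>2 * (r * \<rho>) ^ N * Z \<omega> N x"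
proof -
  obtain \<rho> and N0 :: nat and U :: "nat \<Rightarrow> vertex \<Rightarrow> edge set" and Good
    where \<rho>: "0 < \<rho>" "\<rho> < 1" and U: "\<And>N x. finite (U N x)" "\<And>N x. U N x \<subseteq> E2"
    and Good: "\<And>N x A. Good N x (A \<inter> U N x) \<longleftrightarrow> Good N x A"
    and bad: "\<And>N x. bexp (U N x) (\<lambda>_. r) (\<lambda>A. of_bool (\<not> Good N x A)) \<le> real (N + 2) * \<rho> ^ N"
    and good: "\<And>N x \<gamma>. N \<ge> N0 \<Longrightarrow> \<gamma> 0 = x \<Longrightarrow> inj_on \<gamma> {..N} \<Longrightarrow> lattice_path N \<gamma> \<Longrightarrow>
      bexp (U N x \<union> path_edges N \<gamma>) (\<lambda>_. r) (\<lambda>A. of_bool (path_edges N \<gamma> \<subseteq> A \<and> Good N x A)) \<le> (r * \<rho>) ^ N"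
    by (rule saw_test[OF r]) (rule that, assumption+)
  have "AE \<eta> in perc r. \<forall>\<^sub>F N in sequentially.
       Z (meet (\<omega>, \<eta>)) N x \<le> (real N + 1)\<^sup>2 * (r * \<rho>) ^ N * Z \<omega> N x" for \<omega> x
  proof -
    interpret prob_space "perc r" by (rule prob_space_perc)
    define J where "J N = saw_edges N x \<union> U N x" for N
    have J: "finite (J N)" "J N \<subseteq> E2" for N
      using finite_saw_edges U saw_edges_subset by (auto simp: J_def)
    \<comment> \<open>A factor \<open>(N + 1)\<^sup>2\<close> above the bound for the mean on
      \<open>Good\<close>, which makes the Markov bound summable.\<close>
    define t where "t N = (real N + 1)\<^sup>2 * (r * \<rho>) ^ N * Z \<omega> N x" for N
    let ?S = "\<lambda>N. open_saws \<omega> N x"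
    define Y where "Y N A = (\<Sum>S\<in>?S N. of_bool (path_edges N ((!) S) \<subseteq> A) :: real)" for N A
    have SJ: "path_edges N ((!) S) \<subseteq> J N" if "S \<in> ?S N" for N S
    proof -
      have "S \<in> open_saws (\<lambda>_. True) N x" using that open_saws_mono[of \<omega> "\<lambda>_. True" N x] by auto
      then show ?thesis by (auto simp: J_def saw_edges_def)
    qed
    have ZY: "Z (meet (\<omega>, \<eta>)) N x = Y N (opens (J N) \<eta>)" for N \<eta>
      unfolding Z_meet Z_restrict Y_def using SJ by (intro sum.cong refl arg_cong[of _ _ of_bool]) blast
    define C where "C N = {\<eta> \<in> space (perc r). t N < Y N (opens (J N) \<eta>)}" for N
    have C_sets: "C N \<in> sets (perc r)" for N
      unfolding C_def by (rule sets_local[OF J])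
    have prob_C: "prob (C N) \<le> real (N + 2) * \<rho> ^ N + 1 / (real N + 1)\<^sup>2" if N: "N \<ge> N0" for N
    proof -
      have "prob (C N) = bexp (J N) (\<lambda>_. r) (\<lambda>A. of_bool (t N < Y N A))"
        unfolding C_def using r by (intro perc_local_prob J) auto
      also have "\<dots> \<le> bexp (J N) (\<lambda>_. r) (\<lambda>A. of_bool (\<not> Good N x A) + of_bool (Good N x A \<and> t N < Y N A))"
        using r by (intro bexp_mono) auto
      also have "\<dots> = bexp (J N) (\<lambda>_. r) (\<lambda>A. of_bool (\<not> Good N x A)) +
          bexp (J N) (\<lambda>_. r) (\<lambda>A. of_bool (Good N x A \<and> t N < Y N A))"
        by (rule bexp_add)
      also have "bexp (J N) (\<lambda>_. r) (\<lambda>A. of_bool (\<not> Good N x A)) =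
          bexp (J N) (\<lambda>_. r) (\<lambda>A. of_bool (\<not> Good N x (A \<inter> U N x)))"
        by (simp only: Good)
      also have "\<dots> = bexp (U N x) (\<lambda>_. r) (\<lambda>A. of_bool (\<not> Good N x A))"
        by (rule bexp_restrict[OF J(1)]) (simp add: J_def)
      also have "\<dots> \<le> real (N + 2) * \<rho> ^ N" by (rule bad)
      also have "bexp (J N) (\<lambda>_. r) (\<lambda>A. of_bool (Good N x A \<and> t N < Y N A)) \<le> 1 / (real N + 1)\<^sup>2"
      \<comment> \<open>With no path present, \<open>t N\<close> and \<open>Y N A\<close> are both 0
        and the strict inequality fails; Markov's inequality needs \<open>t N\<close>
        positive.\<close>
      proof (cases "Z \<omega> N x = 0")
        case True
        then have "?S N = {}" using finite_open_saws[of \<omega> N x] by (simp add: Z_def)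
        then have "bexp (J N) (\<lambda>_. r) (\<lambda>A. of_bool (Good N x A \<and> t N < Y N A)) = bexp (J N) (\<lambda>_. r) (\<lambda>_. 0)"
          by (simp add: Y_def t_def Z_def)
        then show ?thesis by (simp add: bexp_const[OF J(1)])
      next
        case False
        then have Zpos: "0 < Z \<omega> N x" using Z_nonneg[of \<omega> N x] by simp
        then have t: "0 < t N" using r \<rho> by (simp add: t_def)
        have "bexp (J N) (\<lambda>_. r) (\<lambda>A. of_bool (Good N x A \<and> t N < Y N A)) \<le>
            bexp (J N) (\<lambda>_. r) (\<lambda>A. (\<Sum>S\<in>?S N. of_bool (path_edges N ((!) S) \<subseteq> A \<and> Good N x A)) / t N)"
        proof (rule bexp_mono)
          fix A
          show "of_bool (Good N x A \<and> t N < Y N A) \<le>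
              (\<Sum>S\<in>?S N. of_bool (path_edges N ((!) S) \<subseteq> A \<and> Good N x A)) / t N"
            using t by (cases "Good N x A") (auto simp: Y_def intro!: divide_nonneg_nonneg sum_nonneg)
        qed (use r in auto)
        also have "\<dots> = (\<Sum>S\<in>?S N. bexp (J N) (\<lambda>_. r) (\<lambda>A. of_bool (path_edges N ((!) S) \<subseteq> A \<and> Good N x A))) / t N"
          by (simp only: bexp_divide bexp_sum)
        also have "\<dots> \<le> (\<Sum>S\<in>?S N. (r * \<rho>) ^ N) / t N"
        proof (intro divide_right_mono sum_mono)
          fix S assume S: "S \<in> ?S N"
          let ?G = "path_edges N ((!) S)"
          have "Good N x (A \<inter> (U N x \<union> ?G)) \<longleftrightarrow> Good N x A" for A
          proof -
            have "A \<inter> (U N x \<union> ?G) \<inter> U N x = A \<inter> U N x" by blast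
            then show ?thesis using Good by metis
          qed
          then have "bexp (J N) (\<lambda>_. r) (\<lambda>A. of_bool (?G \<subseteq> A \<and> Good N x A)) =
              bexp (J N) (\<lambda>_. r) (\<lambda>A. of_bool (?G \<subseteq> A \<inter> (U N x \<union> ?G) \<and> Good N x (A \<inter> (U N x \<union> ?G))))"
            by simp
          also have "\<dots> = bexp (U N x \<union> ?G) (\<lambda>_. r) (\<lambda>A. of_bool (?G \<subseteq> A \<and> Good N x A))"
            using SJ[OF S] by (intro bexp_restrict[OF J(1)]) (auto simp: J_def)
          also have "\<dots> \<le> (r * \<rho>) ^ N"
            using open_saw_path[OF S] by (intro good N) auto
          finally show "bexp (J N) (\<lambda>_. r) (\<lambda>A. of_bool (?G \<subseteq> A \<and> Good N x A)) \<le> (r * \<rho>) ^ N" .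
        qed (use t in auto)
        also have "\<dots> = 1 / (real N + 1)\<^sup>2"
          using Zpos r \<rho> by (simp add: t_def Z_def)
        finally show ?thesis .
      qed
      finally show ?thesis by simp
    qed
    have "summable (\<lambda>N. real (N + 2) * \<rho> ^ N + 1 / (real N + 1)\<^sup>2)"
    proof (rule summable_add)
      have "summable (\<lambda>N. real (Suc N) * \<rho> ^ N + \<rho> ^ N)"
        using \<rho> geometric_deriv_sums[of \<rho>] by (intro summable_add summable_geometric) (auto simp: sums_iff)
      then show "summable (\<lambda>N. real (N + 2) * \<rho> ^ N)" by (simp add: algebra_simps)
      have "summable (\<lambda>N. inverse (real (Suc N) ^ 2))"
        by (subst summable_Suc_iff) (rule inverse_power_summable, simp)
      then show "summable (\<lambda>N. 1 / (real N + 1)\<^sup>2)" by (simp add: inverse_eq_divide add.commute)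
    qed
    then have "summable (\<lambda>N. prob (C N))"
      by (rule summable_comparison_test'[where N = N0]) (use prob_C in simp)
    then have "AE \<eta> in perc r. \<forall>\<^sub>F N in sequentially. \<eta> \<in> space (perc r) - C N"
      using C_sets by (intro borel_cantelli_AE1) (auto simp: emeasure_eq_measure)
    then show ?thesis
    proof eventually_elim
      case (elim \<eta>)
      then show ?case
      proof eventually_elim
        case (elim N)
        then show ?case unfolding ZY C_def t_def[symmetric] by auto
      qed
    qed
  qed
  then show thesis using that \<rho> by blast
qed

text \<open>\<open>m\<close> is first replaced by any larger \<open>b\<close>, because an upper
  limit \<open>m\<close> gives the bound \<open>C * b ^ N\<close> only for \<open>b\<close> above
  \<open>m\<close>.\<close>

lemma growth_scale:
  assumes c: "0 < c" and ev: "\<forall>\<^sub>F N in sequentially. Z \<omega>' N x \<le> (real N + 1)\<^sup>2 * c ^ N * Z \<omega> N x"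
    and g: "growth \<omega> x = ereal m"
  shows "growth \<omega>' x \<le> ereal (c * m)"
proof -
  have m: "0 \<le> m" using growth_nonneg[of \<omega> x] g by simp
  have "growth \<omega>' x \<le> ereal (c * b)" if b: "m < b" for b
  proof -
    obtain C where C: "0 < C" "\<And>N. Z \<omega> N x \<le> C * b ^ N"
      using growth_less_imp_bound[of \<omega> x b] g b by auto
    have "\<forall>\<^sub>F N in sequentially. Z \<omega>' N x \<le> 4 * C * real N ^ 2 * (c * b) ^ N"
      using ev eventually_ge_at_top[of 1]
    proof eventually_elim
      case (elim N)
      have "Z \<omega>' N x \<le> (real N + 1)\<^sup>2 * c ^ N * Z \<omega> N x" by (rule elim(1))
      also have "\<dots> \<le> (2 * real N)\<^sup>2 * c ^ N * (C * b ^ N)"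
        using elim(2) c C Z_nonneg by (intro mult_mono power_mono) auto
      finally show ?case by (simp add: power_mult_distrib mult_ac)
    qed
    then show ?thesis unfolding growth_def
      using c C b m by (intro limsup_root_le[where C = "4 * C" and k = 2]) auto
  qed
  note * = this
  show ?thesis
  proof (rule growth_le_I)
    fix s assume "ereal (c * m) < ereal s"
    then have "m < s / c" using c by (simp add: pos_less_divide_eq mult.commute)
    from *[OF this] show "growth \<omega>' x \<le> ereal s" using c by simp
  qed
qed

section \<open>Zero-one law for the largest growth rate\<close>

lemma measurable_growth [measurable]:
  assumes "0 \<le> p" "p \<le> 1"
  shows "(\<lambda>\<omega>. growth \<omega> x) \<in> borel_measurable (perc p)"
  unfolding growth_def using assms
  by (intro borel_measurable_limsup borel_measurable_ereal) measurable

lemma measurable_max_growth [measurable]: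
  assumes "0 \<le> p" "p \<le> 1"
  shows "max_growth \<in> borel_measurable (perc p)"
  unfolding max_growth_def[abs_def] using assms by (intro borel_measurable_SUP) auto

lemma countable_E2: "countable E2"
proof -
  have "E2 \<subseteq> range (\<lambda>(x, y). {x, y})" by (auto simp: E2_def)
  then show ?thesis by (rule countable_subset) simp
qed

lemma infinite_E2: "infinite E2"
proof -
  let ?f = "\<lambda>n::nat. {(int n, 0), (int n + 1, 0)} :: edge"
  have "inj ?f" by (rule injI) (auto simp: doubleton_eq_iff)
  then have "infinite (range ?f)" by (rule range_inj_infinite)
  moreover have "range ?f \<subseteq> E2" by (auto simp: E2_iff)
  ultimately show ?thesis using infinite_super by blast
qed

lemma max_growth_cong:
  assumes "\<And>e. e \<in> E2 \<Longrightarrow> \<omega> e = \<omega>' e"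
  shows "max_growth \<omega> = max_growth \<omega>'"
proof -
  have "growth \<omega> x = growth \<omega>' x" for x
    using growth_mono[of \<omega> \<omega>' x] growth_mono[of \<omega>' \<omega> x] assms by (auto intro: antisym)
  then show ?thesis by (simp add: max_growth_def)
qed

text \<open>The edges are enumerated as a sequence so that Kolmogorov's law applies; insensitivity
  to closing finitely many edges puts the event in the tail.\<close>

lemma zero_one_law_max_growth:
  assumes p: "0 \<le> p" "p \<le> 1"
  shows "measure (perc p) {\<omega> \<in> space (perc p). max_growth \<omega> \<le> a} \<in> {0, 1}"
proof -
  interpret prob_space "perc p" by (rule prob_space_perc)
  let ?B = "measure_pmf (bernoulli_pmf p)"
  define en where "en = from_nat_into E2"
  have en: "bij_betw en UNIV E2"
    unfolding en_def by (rule bij_betw_from_nat_into[OF countable_E2 infinite_E2])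
  have enE: "en i \<in> E2" for i using en by (auto simp: bij_betw_def)
  define X where "X i \<omega> = \<omega> (en i)" for i and \<omega> :: "edge \<Rightarrow> bool"
  have rv: "X i \<in> measurable (perc p) ?B" for i
    using measurable_perc_edge[OF enE, of i p] by (simp add: X_def[abs_def])
  have ind: "indep_vars (\<lambda>_. ?B) X UNIV"
  proof (subst indep_vars_iff_distr_eq_PiM)
    interpret PP: product_prob_space "\<lambda>_. ?B" E2 ..
    have 1: "distr (perc p) ?B (X i) = ?B" for i
      using PP.PiM_component[OF enE[of i]] unfolding X_def[abs_def] perc_def .
    have "distr (perc p) (PiM UNIV (\<lambda>_. ?B)) (\<lambda>\<omega>. \<lambda>n\<in>UNIV. \<omega> (en n)) = PiM UNIV (\<lambda>_. ?B)"
      unfolding perc_def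
      by (rule distr_PiM_reindex) (use en in \<open>auto simp: bij_betw_def measure_pmf.prob_space_axioms\<close>)
    then show "distr (perc p) (PiM UNIV (\<lambda>_. ?B)) (\<lambda>\<omega>. \<lambda>i\<in>UNIV. X i \<omega>) = PiM UNIV (\<lambda>i. distr (perc p) ?B (X i))"
      unfolding 1 by (simp add: X_def)
  qed (use rv in auto)
  define A where "A i = sigma_sets (space (perc p)) {X i -` S \<inter> space (perc p) | S. S \<in> sets ?B}" for i
  define T where "T = {\<omega> \<in> space (perc p). max_growth \<omega> \<le> a}"
  have T_sets: "T \<in> sets (perc p)"
    unfolding T_def using measurable_max_growth[OF p] by measurable
  have tail: "T \<in> tail_events A"
    unfolding tail_events_def
  proof (rule InterI, clarify)
    fix n
    define F where "F = en ` {..<n}"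
    \<comment> \<open>\<open>\<phi>\<close> closes the first \<open>n\<close> edges. It is
      measurable with respect to the later ones, and the event is its own preimage under
      \<open>\<phi>\<close>.\<close>
    define \<phi> where "\<phi> \<omega> = (\<lambda>e\<in>E2. \<omega> e \<and> e \<notin> F)" for \<omega> :: "edge \<Rightarrow> bool"
    define M where "M = sigma (space (perc p)) (\<Union> (A ` {n..}))"
    have AP: "\<Union> (A ` {n..}) \<subseteq> Pow (space (perc p))"
      unfolding A_def by (auto dest: sigma_sets_into_sp[rotated])
    have sp: "space M = space (perc p)" unfolding M_def using AP by (rule space_measure_of)
    have XM: "X i \<in> measurable M (count_space UNIV)" if "i \<ge> n" for i
    proof (rule measurableI)
      fix S :: "bool set"
      have "X i -` S \<inter> space (perc p) \<in> A i" unfolding A_def by (rule sigma_sets.Basic) auto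
      then have "X i -` S \<inter> space (perc p) \<in> \<Union> (A ` {n..})" using that by auto
      then show "X i -` S \<inter> space M \<in> sets M"
        unfolding sp unfolding M_def using AP by (simp add: sigma_sets.Basic)
    qed simp
    have "\<phi> \<in> measurable M (PiM E2 (\<lambda>_. ?B))"
      unfolding \<phi>_def[abs_def]
    proof (rule measurable_restrict)
      fix e assume "e \<in> E2"
      then obtain i where i: "e = en i" using en by (auto simp: bij_betw_def)
      show "(\<lambda>\<omega>. \<omega> e \<and> e \<notin> F) \<in> measurable M ?B"
      proof (cases "i < n")
        case True
        then have "e \<in> F" using i by (auto simp: F_def)
        then show ?thesis by simp
      next
        case False
        then have "e \<notin> F" using i en by (auto simp: F_def bij_betw_def dest: injD)
        then show ?thesis using XM[of i] False i by (simp add: X_def[abs_def])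
      qed
    qed
    then have \<phi>: "\<phi> \<in> measurable M (perc p)" by (simp add: perc_def)
    have "max_growth (\<phi> \<omega>) = max_growth \<omega>" for \<omega>
    proof -
      have "max_growth (\<phi> \<omega>) = max_growth (\<lambda>e. \<omega> e \<and> e \<notin> F)"
        by (rule max_growth_cong) (simp add: \<phi>_def)
      also have "\<dots> = max_growth \<omega>"
        by (rule max_growth_close_edges) (use enE in \<open>auto simp: F_def\<close>)
      finally show ?thesis .
    qed
    then have "\<phi> -` T \<inter> space M = T"
      unfolding T_def sp by (auto simp: \<phi>_def space_perc)
    then have "T \<in> sets M" using measurable_sets[OF \<phi> T_sets] by simp
    then show "T \<in> sigma_sets (space (perc p)) (\<Union> (A ` {n..}))"
      unfolding M_def using AP by simp
  qed
  have ind': "indep_sets A UNIV"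
    using ind unfolding indep_vars_def A_def by simp
  have sa: "sigma_algebra (space (perc p)) (A i)" for i
    unfolding A_def by (rule sigma_algebra_sigma_sets) auto
  have "prob T = 0 \<or> prob T = 1"
    by (rule kolmogorov_0_1_law[OF sa ind' tail])
  then show ?thesis by (auto simp: T_def)
qed

text \<open>The distribution function takes only the values 0 and 1; the constant is the point where
  it jumps, which lies between 0 and 4.\<close>

lemma max_growth_constant:
  assumes p: "0 \<le> p" "p \<le> 1"
  obtains m where "AE \<omega> in perc p. max_growth \<omega> = ereal m"
proof -
  interpret prob_space "perc p" by (rule prob_space_perc)
  let ?T = "\<lambda>a. {\<omega> \<in> space (perc p). max_growth \<omega> \<le> ereal a}"
  have T: "?T a \<in> sets (perc p)" for a using measurable_max_growth[OF p] by measurable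
  have bnd: "0 \<le> max_growth \<omega>" "max_growth \<omega> \<le> ereal 4" for \<omega>
  proof -
    show "0 \<le> max_growth \<omega>" unfolding max_growth_def by (rule SUP_upper2[of 0]) (auto simp: growth_nonneg)
    show "max_growth \<omega> \<le> ereal 4" unfolding max_growth_def
      by (rule SUP_least) (use growth_le_4 in simp)
  qed
  define I where "I = {a. prob (?T a) = 1}"
  have ae1: "AE \<omega> in perc p. max_growth \<omega> \<le> ereal a" if "a \<in> I" for a
    using that prob_Collect_eq_1[OF T] by (simp add: I_def)
  have ae0: "AE \<omega> in perc p. \<not> max_growth \<omega> \<le> ereal a" if "a \<notin> I" for a
    using that prob_Collect_eq_0[OF T] zero_one_law_max_growth[OF p, of "ereal a"] by (auto simp: I_def)
  have I4: "4 \<in> I" unfolding I_def using bnd(2) by (simp add: prob_space)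
  have Ineg: "0 \<le> a" if "a \<in> I" for a
  proof (rule ccontr)
    assume "\<not> 0 \<le> a"
    then have "\<not> max_growth \<omega> \<le> ereal a" for \<omega>
      using order_trans[OF bnd(1)[of \<omega>], of "ereal a"] by auto
    then have "?T a = {}" by blast
    then have "prob (?T a) = 0" by (metis measure_empty)
    then show False using that by (simp add: I_def)
  qed
  have bdd: "bdd_below I" by (rule bdd_belowI[of _ 0]) (rule Ineg)
  define m where "m = Inf I"
  have "AE \<omega> in perc p. max_growth \<omega> \<le> ereal (m + 1 / real (Suc n))" for n
  proof -
    have "Inf I < m + 1 / real (Suc n)" by (simp add: m_def)
    then obtain a where a: "a \<in> I" "a < m + 1 / real (Suc n)" using cInf_lessD[of I] I4 by blast
    show ?thesis using ae1[OF a(1)] by eventually_elim (use a(2) in \<open>auto intro: order_trans\<close>)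
  qed
  then have up: "AE \<omega> in perc p. \<forall>n. max_growth \<omega> \<le> ereal (m + 1 / real (Suc n))"
    by (simp add: AE_all_countable)
  have "AE \<omega> in perc p. \<not> max_growth \<omega> \<le> ereal (m - 1 / real (Suc n))" for n
  proof (rule ae0)
    show "m - 1 / real (Suc n) \<notin> I" using cInf_lower[OF _ bdd, of "m - 1 / real (Suc n)"] by (auto simp: m_def)
  qed
  then have lo: "AE \<omega> in perc p. \<forall>n. \<not> max_growth \<omega> \<le> ereal (m - 1 / real (Suc n))"
    by (simp add: AE_all_countable)
  from up lo have "AE \<omega> in perc p. max_growth \<omega> = ereal m"
  proof eventually_elim
    case (elim \<omega>)
    obtain g where g: "max_growth \<omega> = ereal g" using bnd[of \<omega>] by (cases "max_growth \<omega>") auto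
    have lim: "(\<lambda>n. 1 / real (Suc n)) \<longlonglongrightarrow> 0" using LIMSEQ_inverse_real_of_nat by (simp add: inverse_eq_divide)
    have "(\<lambda>n. m + 1 / real (Suc n)) \<longlonglongrightarrow> m" using tendsto_add[OF tendsto_const lim, of m] by simp
    then have "g \<le> m" using elim(1) g by (intro LIMSEQ_le_const) auto
    moreover have "(\<lambda>n. m - 1 / real (Suc n)) \<longlonglongrightarrow> m" using tendsto_diff[OF tendsto_const lim, of m] by simp
    then have "m \<le> g" using elim(2) g by (intro LIMSEQ_le_const2) (auto simp: not_le less_imp_le)
    ultimately show ?case using g by simp
  qed
  then show thesis by (rule that)
qed

section \<open>The supercritical phase and the constant \<open>mu2\<close>\<close>

lemma percolation_prob_0: "percolation_prob 0 = 0"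
proof -
  interpret prob_space "perc 0" by (rule prob_space_perc)
  have "AE \<omega> in perc 0. \<not> \<omega> e" if e: "e \<in> E2" for e
  proof -
    have "prob {\<omega> \<in> space (perc 0). opens {e} \<omega> = {}} = 1"
      by (subst measure_cylinder) (use e in auto)
    then have "AE \<omega> in perc 0. opens {e} \<omega> = {}"
      using e by (subst (asm) prob_Collect_eq_1) (auto intro!: sets_cylinder)
    then show ?thesis by eventually_elim auto
  qed
  then have "AE \<omega> in perc 0. \<forall>e\<in>E2. \<not> \<omega> e" using countable_E2 by (simp add: AE_ball_countable)
  then have "AE \<omega> in perc 0. (0, 0) \<notin> infinite_cluster \<omega>"
  proof eventually_elim
    case (elim \<omega>)
    have "cluster \<omega> (0, 0) \<subseteq> {(0, 0)}"
      by (rule cluster_subset_closed) (use elim in \<open>auto simp: open_adj_def\<close>)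
    then show ?case using finite_subset by (auto simp: infinite_cluster_def)
  qed
  then show ?thesis
    unfolding percolation_prob_def using pred_infinite_cluster[where p = 0 and x = "(0, 0)"]
    by (subst prob_Collect_eq_0) (auto simp: pred_def)
qed

lemma supercritical:
  assumes "p_c < p" "p \<le> 1"
  shows "0 < p" "percolation_prob p \<noteq> 0"
proof -
  let ?A = "{p \<in> {0..1}. percolation_prob p = 0}"
  have bdd: "bdd_above ?A" by (rule bdd_aboveI[of _ 1]) auto
  have "0 \<le> p_c" unfolding p_c_def by (rule cSup_upper[OF _ bdd]) (simp add: percolation_prob_0)
  then show "0 < p" using assms by simp
  show "percolation_prob p \<noteq> 0"
  proof
    assume "percolation_prob p = 0"
    then have "p \<le> p_c" unfolding p_c_def using \<open>0 < p\<close> assms(2) by (intro cSup_upper[OF _ bdd]) auto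
    then show False using assms(1) by simp
  qed
qed

text \<open>Statements about all vertices of the infinite cluster hold vacuously when there is none.
  This lemma turns almost sure statements of that kind into relations between constants.\<close>

lemma not_AE_finite_cluster:
  assumes "p_c < p" "p \<le> 1"
  shows "\<not> (AE \<omega> in perc p. (0, 0) \<notin> infinite_cluster \<omega>)"
proof
  interpret prob_space "perc p" by (rule prob_space_perc)
  assume "AE \<omega> in perc p. (0, 0) \<notin> infinite_cluster \<omega>"
  then have "percolation_prob p = 0"
    unfolding percolation_prob_def using pred_infinite_cluster[where p = p and x = "(0, 0)"]
    by (subst prob_Collect_eq_0) (auto simp: pred_def)
  then show False using supercritical(2)[OF assms] by simp
qed

text \<open>Two different constants could both be valid only if the origin were almost surely in a
  finite cluster; hence the description in \<open>mu2\<close> has a unique solution.\<close>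

lemma quenched_constant:
  assumes "p_c < p" "p \<le> 1"
  shows "AE \<omega> in perc p. \<forall>x\<in>infinite_cluster \<omega>. growth \<omega> x = ereal (mu2 p)"
proof -
  have p: "0 < p" "p \<le> 1" "0 \<le> p" using supercritical[OF assms] assms by auto
  have iq: "is_quenched_connective_constant p m \<longleftrightarrow>
      (AE \<omega> in perc p. \<forall>x\<in>infinite_cluster \<omega>. growth \<omega> x = ereal m)" for m
    unfolding is_quenched_connective_constant_def growth_def ..
  obtain m where m: "AE \<omega> in perc p. max_growth \<omega> = ereal m"
    using max_growth_constant[OF p(3,2)] .
  have ex: "is_quenched_connective_constant p m"
    unfolding iq using m AE_unique_infinite_cluster[OF p(1,2)]
  proof eventually_elim
    case (elim \<omega>)
    show ?case
    proof
      fix x assume "x \<in> infinite_cluster \<omega>"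
      then have "growth \<omega> x = max_growth \<omega>" using elim(2) by (intro max_growth_unique_cluster) auto
      then show "growth \<omega> x = ereal m" using elim(1) by simp
    qed
  qed
  have uniq: "m' = m" if "is_quenched_connective_constant p m'" for m'
  proof (rule ccontr)
    assume ne: "m' \<noteq> m"
    have "AE \<omega> in perc p. (0, 0) \<notin> infinite_cluster \<omega>"
      using ex[unfolded iq] that[unfolded iq] by eventually_elim (use ne in auto)
    then show False using not_AE_finite_cluster[OF assms] by simp
  qed
  have "mu2 p = m" unfolding mu2_def by (rule the_equality[where P = "is_quenched_connective_constant p", OF ex uniq])
  then show ?thesis using ex by (simp add: iq)
qed

lemma mu2_ge_one:
  assumes "p_c < p" "p \<le> 1"
  shows "1 \<le> mu2 p"
proof (rule ccontr)
  assume *: "\<not> 1 \<le> mu2 p"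
  have "AE \<omega> in perc p. (0, 0) \<notin> infinite_cluster \<omega>"
    using quenched_constant[OF assms]
    by eventually_elim (use * growth_ge_one in \<open>fastforce simp: one_ereal_def\<close>)
  then show False using not_AE_finite_cluster[OF assms] by simp
qed

text \<open>Monotone coupling: an infinite cluster at the origin in the intersection is also one at
  density \<open>q\<close>, so on this event of positive probability both constants are growth rates
  at the same vertex.\<close>

lemma mu2_strict_contraction:
  assumes p: "p_c < p" and pq: "p < q" and q: "q \<le> 1"
  shows "mu2 p / p < mu2 q / q"
proof -
  have p0: "0 < p" "p \<le> 1" using supercritical(1)[OF p] pq q by auto
  define r where "r = p / q"
  have r: "0 < r" "r < 1" "q * r = p" "0 \<le> r" "r \<le> 1" using p0 pq q by (auto simp: r_def)
  have q': "0 \<le> q" "p_c < q" using p0 pq p by auto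
  obtain \<rho> where \<rho>: "0 < \<rho>" "\<rho> < 1"
    and ev: "\<And>\<omega> x. AE \<eta> in perc r. \<forall>\<^sub>F N in sequentially.
       Z (meet (\<omega>, \<eta>)) N x \<le> (real N + 1)\<^sup>2 * (r * \<rho>) ^ N * Z \<omega> N x"
    by (rule quenched_bound[OF r(1,2)]) (rule that, assumption+)
  interpret Q: prob_space "perc q" by (rule prob_space_perc)
  interpret R: prob_space "perc r" by (rule prob_space_perc)
  interpret QR: pair_prob_space "perc q" "perc r" ..
  let ?M = "perc q \<Otimes>\<^sub>M perc r"
  let ?P = "\<lambda>z. \<forall>\<^sub>F N in sequentially.
       Z (meet z) N (0, 0) \<le> (real N + 1)\<^sup>2 * (r * \<rho>) ^ N * Z (fst z) N (0, 0)"
  \<comment> \<open>The bound holds for every first configuration and almost every second one;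
    measurability of the event makes it almost sure for the product.\<close>
  have 1: "AE z in ?M. ?P z"
  proof (rule QR.AE_pair_measure)
    have [measurable]: "(\<lambda>z. Z (meet z) N x) \<in> borel_measurable ?M" for N x
      using measurable_compose[OF measurable_meet borel_measurable_Z[OF r(4,5)]] .
    have [measurable]: "(\<lambda>z. Z (fst z) N x) \<in> borel_measurable ?M" for N x
      using measurable_compose[OF measurable_fst borel_measurable_Z[OF q'(1) q]] .
    have "Measurable.pred ?M ?P" unfolding eventually_sequentially by measurable
    then show "{z \<in> space ?M. ?P z} \<in> sets ?M" by (simp add: pred_def)
    show "AE \<omega> in perc q. AE \<eta> in perc r. ?P (\<omega>, \<eta>)" using ev by simp
  qed
  have "AE \<omega> in distr ?M (perc q) fst. \<forall>x\<in>infinite_cluster \<omega>. growth \<omega> x = ereal (mu2 q)"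
    unfolding R.distr_pair_fst by (rule quenched_constant[OF q'(2) q])
  then have 2: "AE z in ?M. \<forall>x\<in>infinite_cluster (fst z). growth (fst z) x = ereal (mu2 q)"
    by (rule AE_distrD[OF measurable_fst])
  have 3: "AE z in ?M. \<forall>x\<in>infinite_cluster (meet z). growth (meet z) x = ereal (mu2 p)"
    by (rule AE_perc_meet[OF q'(1) q r(4,5)]) (simp only: r(3) quenched_constant[OF p p0(2)])
  have le: "mu2 p \<le> r * \<rho> * mu2 q"
  proof (rule ccontr)
    assume *: "\<not> ?thesis"
    have "AE z in ?M. (0, 0) \<notin> infinite_cluster (meet z)"
      using 1 2 3
    proof eventually_elim
      case (elim z)
      show ?case
      proof
        assume inf: "(0, 0) \<in> infinite_cluster (meet z)"
        then have "(0, 0) \<in> infinite_cluster (fst z)"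
          using infinite_cluster_mono[of "meet z" "fst z"] by (auto simp: meet_def)
        then have "growth (fst z) (0, 0) = ereal (mu2 q)" using elim(2) by blast
        then have "growth (meet z) (0, 0) \<le> ereal (r * \<rho> * mu2 q)"
          using growth_scale[OF _ elim(1)] r \<rho> by simp
        then show False using elim(3) inf * by simp
      qed
    qed
    then have "AE \<omega> in distr ?M (perc p) meet. (0, 0) \<notin> infinite_cluster \<omega>"
      using pred_infinite_cluster[where p = p and x = "(0, 0)"]
      by (subst AE_distr_iff[OF measurable_meet]) (auto simp: pred_def)
    then have "AE \<omega> in perc p. (0, 0) \<notin> infinite_cluster \<omega>"
      unfolding distr_meet[OF q'(1) q r(4,5), unfolded r(3)] .
    then show False using not_AE_finite_cluster[OF p p0(2)] by simp
  qed
  have "mu2 p / p \<le> \<rho> * (mu2 q / q)"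
    using le p0 pq by (simp add: r_def field_simps)
  also have "\<dots> < 1 * (mu2 q / q)"
    \<comment> \<open>The factor \<rho> gives a strict inequality only because \<open>mu2 q\<close>
      is positive.\<close>
    using \<rho> mu2_ge_one[OF q'(2) q] p0 pq by (intro mult_strict_right_mono) auto
  finally show ?thesis by simp
qed

text \<open>The quenched bound is applied with the fully open lattice as first configuration: its
  number of paths times \<open>p ^ N\<close> is exactly the mean.\<close>

lemma annealed_ratio_decay:
  assumes p: "0 < p" "p < 1"
  shows "AE \<omega> in perc p. limsup (\<lambda>N. ereal (root N (Z \<omega> N (0, 0) / (\<integral>\<omega>'. Z \<omega>' N (0, 0) \<partial>perc p)))) < 1"
proof -
  obtain \<rho> where \<rho>: "0 < \<rho>" "\<rho> < 1"
    and ev: "\<And>\<omega> x. AE \<eta> in perc p. \<forall>\<^sub>F N in sequentially.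
       Z (meet (\<omega>, \<eta>)) N x \<le> (real N + 1)\<^sup>2 * (p * \<rho>) ^ N * Z \<omega> N x"
    by (rule quenched_bound[OF p]) (rule that, assumption+)
  let ?s = "\<lambda>N. Z (\<lambda>_. True) N (0, 0)"
  have "(0, 0) \<in> infinite_cluster (\<lambda>_. True)"
    by (simp add: infinite_cluster_def cluster_full finite_prod)
  then have s: "0 < ?s N" for N
    using infinite_cluster_open_saw[of "(0, 0)" "\<lambda>_. True" N] finite_open_saws[of "\<lambda>_. True" N "(0, 0)"]
    by (simp add: Z_def card_gt_0_iff)
  have E: "(\<integral>\<omega>'. Z \<omega>' N (0, 0) \<partial>perc p) = p ^ N * ?s N" for N
    using p by (intro expectation_Z) auto
  show ?thesis using ev[of "\<lambda>_. True" "(0, 0)"]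
  proof eventually_elim
    case (elim \<eta>)
    have "\<forall>\<^sub>F N in sequentially. Z \<eta> N (0, 0) / (\<integral>\<omega>'. Z \<omega>' N (0, 0) \<partial>perc p) \<le> 4 * real N ^ 2 * \<rho> ^ N"
      using elim eventually_ge_at_top[of 1]
    proof eventually_elim
      case (elim N)
      have "Z \<eta> N (0, 0) \<le> (real N + 1)\<^sup>2 * (p * \<rho>) ^ N * ?s N"
        using elim(1) by (simp add: Z_meet)
      also have "\<dots> \<le> (2 * real N)\<^sup>2 * (p * \<rho>) ^ N * ?s N"
        using elim(2) p \<rho> s[of N] by (intro mult_right_mono power_mono) auto
      finally have "Z \<eta> N (0, 0) \<le> (4 * real N ^ 2 * \<rho> ^ N) * (p ^ N * ?s N)"
        by (simp add: power_mult_distrib mult_ac)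
      then show ?case unfolding E using s[of N] p by (simp add: pos_divide_le_eq)
    qed
    then have "limsup (\<lambda>N. ereal (root N (Z \<eta> N (0, 0) / (\<integral>\<omega>'. Z \<omega>' N (0, 0) \<partial>perc p)))) \<le> ereal \<rho>"
      using \<rho> by (intro limsup_root_le[where C = 4 and k = 2]) auto
    also have "\<dots> < 1" using \<rho> by (simp add: one_ereal_def)
    finally show ?case .
  qed
qed

theorem theorem1p4:
  shows "(\<forall>p. p_c < p \<and> p < 1 \<longrightarrow>
           mu2 p < p * mu2 1 \<and>
           (AE \<omega> in perc p.
              limsup (\<lambda>N. ereal (root N (Z \<omega> N (0, 0) /
                (\<integral>\<omega>'. Z \<omega>' N (0, 0) \<partial>perc p)))) < 1))
       \<and> strict_mono_on {p_c<..1} (\<lambda>p. mu2 p / (p * mu2 1))"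
proof (intro conjI allI impI)
  fix p assume p: "p_c < p \<and> p < 1"
  then have p0: "0 < p" using supercritical(1)[of p] by simp
  show "mu2 p < p * mu2 1"
    using mu2_strict_contraction[of p 1] p p0 by (simp add: pos_divide_less_eq mult.commute)
  show "AE \<omega> in perc p. limsup (\<lambda>N. ereal (root N (Z \<omega> N (0, 0) /
      (\<integral>\<omega>'. Z \<omega>' N (0, 0) \<partial>perc p)))) < 1"
    using p p0 by (intro annealed_ratio_decay) auto
next
  show "strict_mono_on {p_c<..1} (\<lambda>p. mu2 p / (p * mu2 1))"
  proof (rule strict_mono_onI)
    fix p q assume pq: "p \<in> {p_c<..1}" "q \<in> {p_c<..1}" "p < q"
    then have "0 < mu2 1" using mu2_ge_one[of 1] by simp
    moreover have "mu2 p / p < mu2 q / q" using pq by (intro mu2_strict_contraction) auto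
    ultimately have "mu2 p / p / mu2 1 < mu2 q / q / mu2 1" by (intro divide_strict_right_mono)
    then show "mu2 p / (p * mu2 1) < mu2 q / (q * mu2 1)" by simp
  qed
qed

end
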